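(* Each simple weight $\mathfrak{age}(1)$-module is isomorphic to one of the following modules, all of which are simple: (i) a simple highest weight module or a simple lowest weight module; (ii) the module $Q(\lambda,\dot h)=\mathbb{C}[x,x^{-1}]$, where $\dot h\in\mathbb{C}$ and $\lambda\in\mathbb{C}^*$, with the action given, for all $i\in\mathbb{Z}$, by $$z x^i=p x^i=0,\quad q x^i=x^{i+1},\quad e x^i=\lambda x^{i-2},\quad h x^i=(\dot h-i)x^i;$$ (iii) the module $Q'(\dot z,\dot h,\lambda)=\mathbb{C}[x,x^{-1}]$, where $\dot h\in\mathbb{C}$, $\dot z\in\mathbb{C}^*$ and $\lambda\in\mathbb{C}\setminus\mathbb{Z}$, with the action given, for all $i\in\mathbb{Z}$, by $$q x^i=x^{i+1},\quad p x^i=\dot z(\lambda+i)x^{i-1},\quad z x^i=\dot z x^i,\quad h x^i=(\dot h-i)x^i,\quad e x^i=\tfrac{\dot z}{2}(\lambda+i)(\lambda+i-1)x^{i-2};$$ (iv) the module $N_{\dot z,\dot h}$, where $\dot z,\dot h\in\mathbb{C}$ and $N$ is an infinite dimensional simple $R_{\dot z}$-module.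
   Context: All vector spaces and algebras are over $\mathbb{C}$. The ageing algebra $\mathfrak{age}(1)$ is the complex Lie algebra with basis $\{e,h,p,q,z\}$, $z$ central, and brackets $[h,e]=2e$, $[e,q]=p$, $[e,p]=0$, $[h,p]=p$, $[h,q]=-q$, $[p,q]=z$. On every simple module $z$ acts as a scalar, denoted $\dot z$; all modules considered are modules on which $z$ acts as a scalar. A weight module is a module on which $h$ acts diagonalizably; weight vectors are $h$-eigenvectors. A highest weight module is a module generated by a nonzero weight vector $w$ with $ew=pw=0$; a lowest weight module is a module generated by a nonzero weight vector $w$ with $qw=0$. Let $\mathbf{A}$ be the first Weyl algebra, generated by $t$ and $\frac{d}{dt}$ with $\frac{d}{dt}t-t\frac{d}{dt}=1$. Let $R_0$ be the unital subalgebra of $\mathbf{A}$ generated by $t$ and $t^2\frac{d}{dt}$, and for $\dot z\in\mathbb{C}^*$ let $R_{\dot z}=R_1$ be the unital subalgebra of $\mathbf{A}$ generated by $t$ and $t\frac{d}{dt}$. For $\dot z,\dot h\in\mathbb{C}$ and an $R_{\dot z}$-module $N$, the $\mathfrak{age}(1)$-module $N_{\dot z,\dot h}$ is the vector space $N\otimes\mathbb{C}[x,x^{-1}]$ with the following action, for $v\in N$ and $i\in\mathbb{Z}$: $$h(v\otimes x^i)=(\dot h-i)v\otimes x^i,\quad z(v\otimes x^i)=\dot z\,v\otimes x^i,\quad q(v\otimes x^i)=v\otimes x^{i+1},$$ and, if $\dot z=0$, $$p(v\otimes x^i)=(tv)\otimes x^{i-1},\quad e(v\otimes x^i)=\big((t^2\tfrac{d}{dt}+(i-2)t)v\big)\otimes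 x^{i-2},$$ while, if $\dot z\neq0$, $$p(v\otimes x^i)=\big((2\dot z\,t\tfrac{d}{dt}+(i-1)\dot z)v\big)\otimes x^{i-1},$$ $$e(v\otimes x^i)=\big((t+(2i-3)\dot z\,t\tfrac{d}{dt}+2\dot z(t\tfrac{d}{dt})^2+\tfrac{(i-1)(i-2)}{2}\dot z)v\big)\otimes x^{i-2}.$$ *)

theory Defs
  imports Complex_Main "HOL-Analysis.Cartesian_Space"
    "HOL-Computational_Algebra.Polynomial" "HOL-Library.Poly_Mapping"
begin

section \<open>Complex vector spaces with an action\<close>

text \<open>
  A vector space is a subspace \<open>carrier\<close> of an ambient space, which is a whole type equipped with
  the scalar multiplication \<open>scale\<close>; the action \<open>act\<close> is only relevant on \<open>carrier\<close>.
  The same record serves for Lie modules and for modules over associative algebras.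
\<close>

record ('a, 'v) rep =
  scale :: "complex \<Rightarrow> 'v \<Rightarrow> 'v"
  carrier :: "'v set"
  act :: "'a \<Rightarrow> 'v \<Rightarrow> 'v"

definition linear_action :: "'a set \<Rightarrow> ('a, 'v::ab_group_add) rep \<Rightarrow> bool" where
  "linear_action A M \<longleftrightarrow>
     vector_space (scale M) \<and> module.subspace (scale M) (carrier M) \<and>
     (\<forall>a\<in>A. \<forall>v\<in>carrier M. act M a v \<in> carrier M) \<and>
     (\<forall>a\<in>A. \<forall>v\<in>carrier M. \<forall>w\<in>carrier M. act M a (v + w) = act M a v + act M a w) \<and>
     (\<forall>a\<in>A. \<forall>c. \<forall>v\<in>carrier M. act M a (scale M c v) = scale M c (act M a v))"

definition submodule :: "'a set \<Rightarrow> ('a, 'v::ab_group_add) rep \<Rightarrow> 'v set \<Rightarrow> bool" where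
  "submodule A M W \<longleftrightarrow>
     W \<subseteq> carrier M \<and> module.subspace (scale M) W \<and> (\<forall>a\<in>A. \<forall>w\<in>W. act M a w \<in> W)"

definition simple :: "'a set \<Rightarrow> ('a, 'v::ab_group_add) rep \<Rightarrow> bool" where
  "simple A M \<longleftrightarrow>
     carrier M \<noteq> {0} \<and> (\<forall>W. submodule A M W \<longrightarrow> W = {0} \<or> W = carrier M)"

definition infinite_dimensional :: "('a, 'v::ab_group_add) rep \<Rightarrow> bool" where
  "infinite_dimensional M \<longleftrightarrow> \<not> (\<exists>B. finite B \<and> module.span (scale M) B = carrier M)"


section \<open>The ageing algebra and its modules\<close>

datatype age_basis = gen_e | gen_h | gen_p | gen_q | gen_z

lemma UNIV_age_basis: "(UNIV :: age_basis set) = {gen_e, gen_h, gen_p, gen_q, gen_z}"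
  by (auto intro: age_basis.exhaust)

instance age_basis :: finite
  by standard (simp add: UNIV_age_basis)

type_synonym age = "complex ^ age_basis"

abbreviation age_e :: age where "age_e \<equiv> axis gen_e 1"
abbreviation age_h :: age where "age_h \<equiv> axis gen_h 1"
abbreviation age_p :: age where "age_p \<equiv> axis gen_p 1"
abbreviation age_q :: age where "age_q \<equiv> axis gen_q 1"
abbreviation age_z :: age where "age_z \<equiv> axis gen_z 1"

text \<open>The bilinear bracket, in coordinates; its values on the basis are checked below.\<close>

definition bracket :: "age \<Rightarrow> age \<Rightarrow> age" where
  "bracket x y = (\<chi> b. case b of
       gen_e \<Rightarrow> 2 * (x $ gen_h * y $ gen_e - x $ gen_e * y $ gen_h)
     | gen_h \<Rightarrow> 0
     | gen_p \<Rightarrow> (x $ gen_e * y $ gen_q - x $ gen_q * y $ gen_e) + (x $ gen_h * y $ gen_p - x $ gen_p * y $ gen_h)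
     | gen_q \<Rightarrow> - (x $ gen_h * y $ gen_q - x $ gen_q * y $ gen_h)
     | gen_z \<Rightarrow> x $ gen_p * y $ gen_q - x $ gen_q * y $ gen_p)"

lemma bracket_basis:
  "bracket age_h age_e = 2 *s age_e" "bracket age_e age_q = age_p" "bracket age_e age_p = 0"
  "bracket age_h age_p = age_p" "bracket age_h age_q = - age_q" "bracket age_p age_q = age_z"
  "bracket age_z x = 0"
  by (simp_all add: bracket_def vec_eq_iff axis_def split: age_basis.split)

lemma bracket_alternating: "bracket x x = 0"
  by (simp add: bracket_def vec_eq_iff algebra_simps split: age_basis.split)

lemma bracket_jacobi:
  "bracket x (bracket y w) + bracket y (bracket w x) + bracket w (bracket x y) = 0"
  by (simp add: bracket_def vec_eq_iff algebra_simps split: age_basis.split)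

lemma bracket_linear:
  "bracket (x + x') y = bracket x y + bracket x' y" "bracket (c *s x) y = c *s bracket x y"
  "bracket x (y + y') = bracket x y + bracket x y'" "bracket x (c *s y) = c *s bracket x y"
  by (simp_all add: bracket_def vec_eq_iff algebra_simps split: age_basis.split)

definition age_module :: "(age, 'v::ab_group_add) rep \<Rightarrow> bool" where
  "age_module M \<longleftrightarrow> linear_action UNIV M \<and>
     (\<forall>x y. \<forall>v\<in>carrier M. act M (x + y) v = act M x v + act M y v) \<and>
     (\<forall>c x. \<forall>v\<in>carrier M. act M (c *s x) v = scale M c (act M x v)) \<and>
     (\<forall>x y. \<forall>v\<in>carrier M. act M (bracket x y) v = act M x (act M y v) - act M y (act M x v))"

definition simple_age_module :: "(age, 'v::ab_group_add) rep \<Rightarrow> bool" where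
  "simple_age_module M \<longleftrightarrow> age_module M \<and> simple UNIV M"

definition weight_vector :: "(age, 'v::ab_group_add) rep \<Rightarrow> 'v \<Rightarrow> bool" where
  "weight_vector M v \<longleftrightarrow> v \<in> carrier M \<and> v \<noteq> 0 \<and> (\<exists>\<mu>. act M age_h v = scale M \<mu> v)"

definition weight_module :: "(age, 'v::ab_group_add) rep \<Rightarrow> bool" where
  "weight_module M \<longleftrightarrow> age_module M \<and>
     (\<exists>B. \<not> module.dependent (scale M) B \<and> module.span (scale M) B = carrier M \<and>
          (\<forall>b\<in>B. weight_vector M b))"

definition generated_by :: "(age, 'v::ab_group_add) rep \<Rightarrow> 'v \<Rightarrow> bool" where
  "generated_by M w \<longleftrightarrow> \<Inter> {W. submodule UNIV M W \<and> w \<in> W} = carrier M"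

definition highest_weight_module :: "(age, 'v::ab_group_add) rep \<Rightarrow> bool" where
  "highest_weight_module M \<longleftrightarrow> age_module M \<and>
     (\<exists>w. weight_vector M w \<and> act M age_e w = 0 \<and> act M age_p w = 0 \<and> generated_by M w)"

definition lowest_weight_module :: "(age, 'v::ab_group_add) rep \<Rightarrow> bool" where
  "lowest_weight_module M \<longleftrightarrow> age_module M \<and>
     (\<exists>w. weight_vector M w \<and> act M age_q w = 0 \<and> generated_by M w)"

definition age_iso ::
    "(age, 'v::ab_group_add) rep \<Rightarrow> (age, 'w::ab_group_add) rep \<Rightarrow> bool" (infix "\<cong>\<^bsub>age\<^esub>" 50) where
  "M \<cong>\<^bsub>age\<^esub> M' \<longleftrightarrow>
     (\<exists>f. bij_betw f (carrier M) (carrier M') \<and>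
          (\<forall>v\<in>carrier M. \<forall>w\<in>carrier M. f (v + w) = f v + f w) \<and>
          (\<forall>c. \<forall>v\<in>carrier M. f (scale M c v) = scale M' c (f v)) \<and>
          (\<forall>x. \<forall>v\<in>carrier M. f (act M x v) = act M' x (f v)))"


section \<open>The first Weyl algebra and its subalgebras\<close>

text \<open>
  The Weyl algebra is realised by its faithful action on the polynomials in \<open>t\<close>: it consists of the
  differential operators with polynomial coefficients.
\<close>

inductive_set diff_ops :: "(complex poly \<Rightarrow> complex poly) set" where
  ident: "id \<in> diff_ops"
| mult_t: "(\<lambda>f. [:0, 1:] * f) \<in> diff_ops"
| deriv: "pderiv \<in> diff_ops"
| add: "a \<in> diff_ops \<Longrightarrow> b \<in> diff_ops \<Longrightarrow> (\<lambda>f. a f + b f) \<in> diff_ops"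
| smult: "a \<in> diff_ops \<Longrightarrow> (\<lambda>f. Polynomial.smult c (a f)) \<in> diff_ops"
| comp: "a \<in> diff_ops \<Longrightarrow> b \<in> diff_ops \<Longrightarrow> a \<circ> b \<in> diff_ops"

lemma diff_ops_add: "a \<in> diff_ops \<Longrightarrow> a (f + g) = a f + a g"
  by (induction arbitrary: f g rule: diff_ops.induct)
     (simp_all add: algebra_simps pderiv_add smult_add_right)

lemma diff_ops_smult: "a \<in> diff_ops \<Longrightarrow> a (Polynomial.smult k f) = Polynomial.smult k (a f)"
  by (induction arbitrary: f rule: diff_ops.induct)
     (simp_all add: pderiv_smult smult_add_right mult.commute)

lemma diff_ops_zero: "(\<lambda>f. 0) \<in> diff_ops"
  using diff_ops.smult[OF diff_ops.ident, of 0] by simp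

lemma diff_ops_uminus: "a \<in> diff_ops \<Longrightarrow> (\<lambda>f. - a f) \<in> diff_ops"
  using diff_ops.smult[of a "-1"] by simp

lemma diff_ops_minus:
  assumes "a \<in> diff_ops" "b \<in> diff_ops" shows "(\<lambda>f. a f - b f) \<in> diff_ops"
  using diff_ops.add[OF assms(1) diff_ops_uminus[OF assms(2)]] by simp

typedef weyl = diff_ops
  using diff_ops.ident by blast

setup_lifting type_definition_weyl

instantiation weyl :: ring_1
begin
lift_definition zero_weyl :: weyl is "\<lambda>f. 0" by (rule diff_ops_zero)
lift_definition one_weyl :: weyl is id by (rule diff_ops.ident)
lift_definition plus_weyl :: "weyl \<Rightarrow> weyl \<Rightarrow> weyl" is "\<lambda>a b f. a f + b f" by (rule diff_ops.add)
lift_definition uminus_weyl :: "weyl \<Rightarrow> weyl" is "\<lambda>a f. - a f" by (rule diff_ops_uminus)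
lift_definition minus_weyl :: "weyl \<Rightarrow> weyl \<Rightarrow> weyl" is "\<lambda>a b f. a f - b f" by (rule diff_ops_minus)
lift_definition times_weyl :: "weyl \<Rightarrow> weyl \<Rightarrow> weyl" is "\<lambda>a b. a \<circ> b" by (rule diff_ops.comp)
instance
proof
  show "(0::weyl) \<noteq> 1"
    by transfer (auto simp: fun_eq_iff intro!: exI[of _ 1])
qed (transfer; auto simp: fun_eq_iff diff_ops_add)+
end

lift_definition weyl_scale :: "complex \<Rightarrow> weyl \<Rightarrow> weyl" (infixr "*\<^sub>W" 75)
  is "\<lambda>c a f. Polynomial.smult c (a f)" by (rule diff_ops.smult)

lift_definition weyl_t :: weyl is "\<lambda>f. [:0, 1:] * f" by (rule diff_ops.mult_t)
lift_definition weyl_d :: weyl is pderiv by (rule diff_ops.deriv)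

lemma weyl_relation: "weyl_d * weyl_t - weyl_t * weyl_d = 1"
  by transfer (auto simp: fun_eq_iff pderiv_mult pderiv_pCons)

inductive_set unital_subalgebra :: "weyl set \<Rightarrow> weyl set" for S where
  one: "1 \<in> unital_subalgebra S"
| gen: "a \<in> S \<Longrightarrow> a \<in> unital_subalgebra S"
| add: "a \<in> unital_subalgebra S \<Longrightarrow> b \<in> unital_subalgebra S \<Longrightarrow> a + b \<in> unital_subalgebra S"
| scale: "a \<in> unital_subalgebra S \<Longrightarrow> c *\<^sub>W a \<in> unital_subalgebra S"
| mult: "a \<in> unital_subalgebra S \<Longrightarrow> b \<in> unital_subalgebra S \<Longrightarrow> a * b \<in> unital_subalgebra S"

definition R_algebra :: "complex \<Rightarrow> weyl set" where
  "R_algebra z = (if z = 0 then unital_subalgebra {weyl_t, weyl_t\<^sup>2 * weyl_d}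
          else unital_subalgebra {weyl_t, weyl_t * weyl_d})"

definition algebra_module :: "weyl set \<Rightarrow> (weyl, 'n::ab_group_add) rep \<Rightarrow> bool" where
  "algebra_module A N \<longleftrightarrow> linear_action A N \<and>
     (\<forall>v\<in>carrier N. act N 1 v = v) \<and>
     (\<forall>a\<in>A. \<forall>b\<in>A. \<forall>v\<in>carrier N. act N (a + b) v = act N a v + act N b v) \<and>
     (\<forall>c. \<forall>a\<in>A. \<forall>v\<in>carrier N. act N (c *\<^sub>W a) v = scale N c (act N a v)) \<and>
     (\<forall>a\<in>A. \<forall>b\<in>A. \<forall>v\<in>carrier N. act N (a * b) v = act N a (act N b v))"

definition infdim_simple_module :: "weyl set \<Rightarrow> (weyl, 'n::ab_group_add) rep \<Rightarrow> bool" where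
  "infdim_simple_module A N \<longleftrightarrow> algebra_module A N \<and> simple A N \<and> infinite_dimensional N"


section \<open>The modules in the classification\<close>

text \<open>
  The space \<open>N \<otimes> \<complex>[x, x\<inverse>]\<close> is modelled by finitely supported functions
  on the integers, with \<open>v \<otimes> x\<^sup>i\<close> being \<open>Poly_Mapping.single i v\<close>; in particular
  \<open>\<complex>[x, x\<inverse>]\<close> is the type \<open>int \<Rightarrow>\<^sub>0 complex\<close>. The function \<open>extend\<close>
  extends an operator given on the elements \<open>v \<otimes> x\<^sup>i\<close> additively.
\<close>

definition extend :: "(int \<Rightarrow> 'n \<Rightarrow> (int \<Rightarrow>\<^sub>0 'n)) \<Rightarrow> (int \<Rightarrow>\<^sub>0 'n) \<Rightarrow> (int \<Rightarrow>\<^sub>0 'n::ab_group_add)" where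
  "extend \<phi> f = (\<Sum>i\<in>Poly_Mapping.keys f. \<phi> i (Poly_Mapping.lookup f i))"

lemma extend_single:
  "\<phi> i 0 = 0 \<Longrightarrow> extend \<phi> (Poly_Mapping.single i v) = \<phi> i v"
  by (simp add: extend_def)

text \<open>The action of the whole Lie algebra determined by the actions of its five basis vectors.\<close>

definition age_action ::
    "(complex \<Rightarrow> 'v \<Rightarrow> 'v) \<Rightarrow> (age_basis \<Rightarrow> 'v \<Rightarrow> 'v) \<Rightarrow> age \<Rightarrow> 'v \<Rightarrow> 'v::ab_group_add" where
  "age_action s T x v = (\<Sum>b\<in>UNIV. s (x $ b) (T b v))"

lemma age_action_axis:
  assumes "vector_space s"
  shows "age_action s T (axis b 1) v = T b v"
proof -
  interpret vector_space s by (rule assms)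
  have "age_action s T (axis b 1) v = (\<Sum>b'\<in>UNIV. if b' = b then T b' v else 0)"
    unfolding age_action_def by (rule sum.cong) (auto simp: axis_def)
  then show ?thesis by simp
qed

definition Q_module :: "complex \<Rightarrow> complex \<Rightarrow> (age, int \<Rightarrow>\<^sub>0 complex) rep" where
  "Q_module l hh =
     \<lparr>scale = (\<lambda>c. Poly_Mapping.map ((*) c)),
      carrier = UNIV,
      act = age_action (\<lambda>c. Poly_Mapping.map ((*) c)) (\<lambda>b. extend (\<lambda>i c. case b of
          gen_z \<Rightarrow> 0
        | gen_p \<Rightarrow> 0
        | gen_q \<Rightarrow> Poly_Mapping.single (i + 1) c
        | gen_e \<Rightarrow> Poly_Mapping.single (i - 2) (l * c)
        | gen_h \<Rightarrow> Poly_Mapping.single i ((hh - of_int i) * c)))\<rparr>"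

definition Q'_module :: "complex \<Rightarrow> complex \<Rightarrow> complex \<Rightarrow> (age, int \<Rightarrow>\<^sub>0 complex) rep" where
  "Q'_module zz hh l =
     \<lparr>scale = (\<lambda>c. Poly_Mapping.map ((*) c)),
      carrier = UNIV,
      act = age_action (\<lambda>c. Poly_Mapping.map ((*) c)) (\<lambda>b. extend (\<lambda>i c. case b of
          gen_q \<Rightarrow> Poly_Mapping.single (i + 1) c
        | gen_p \<Rightarrow> Poly_Mapping.single (i - 1) (zz * (l + of_int i) * c)
        | gen_z \<Rightarrow> Poly_Mapping.single i (zz * c)
        | gen_h \<Rightarrow> Poly_Mapping.single i ((hh - of_int i) * c)
        | gen_e \<Rightarrow> Poly_Mapping.single (i - 2) (zz / 2 * (l + of_int i) * (l + of_int i - 1) * c)))\<rparr>"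

definition N_module ::
    "(weyl, 'n) rep \<Rightarrow> complex \<Rightarrow> complex \<Rightarrow> (age, int \<Rightarrow>\<^sub>0 'n::ab_group_add) rep" where
  "N_module N zz hh =
     \<lparr>scale = (\<lambda>c. Poly_Mapping.map (scale N c)),
      carrier = {f. \<forall>i. Poly_Mapping.lookup f i \<in> carrier N},
      act = age_action (\<lambda>c. Poly_Mapping.map (scale N c)) (\<lambda>b. extend (\<lambda>i v. case b of
          gen_h \<Rightarrow> Poly_Mapping.single i (scale N (hh - of_int i) v)
        | gen_z \<Rightarrow> Poly_Mapping.single i (scale N zz v)
        | gen_q \<Rightarrow> Poly_Mapping.single (i + 1) v
        | gen_p \<Rightarrow> Poly_Mapping.single (i - 1)
            (act N (if zz = 0 then weyl_t
                    else (2 * zz) *\<^sub>W (weyl_t * weyl_d) + (of_int (i - 1) * zz) *\<^sub>W 1) v)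
        | gen_e \<Rightarrow> Poly_Mapping.single (i - 2)
            (act N (if zz = 0 then weyl_t\<^sup>2 * weyl_d + of_int (i - 2) *\<^sub>W weyl_t
                    else weyl_t + (of_int (2 * i - 3) * zz) *\<^sub>W (weyl_t * weyl_d)
                         + (2 * zz) *\<^sub>W (weyl_t * weyl_d)\<^sup>2
                         + (of_int ((i - 1) * (i - 2)) / 2 * zz) *\<^sub>W 1) v)))\<rparr>"

end

theory Submission
  imports Defs "HOL-Computational_Algebra.Fundamental_Theorem_Algebra"
    "HOL-Analysis.Continuum_Not_Denumerable"
begin

text \<open>
  Let \<open>M\<close> be a simple weight module that is neither a highest nor a lowest weight module. A Schur
  lemma for simple modules of countable dimension makes \<open>z\<close> a scalar. The operators \<open>qp\<close> and
  \<open>q\<^sup>2e\<close> preserve the weight spaces, and they commute with \<open>q\<close> modulo lower terms; hence every weight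
  space is irreducible under them, and \<open>q\<close> maps it bijectively to the next one. Thus \<open>M\<close> is
  \<open>N \<otimes> \<complex>[x, x\<inverse>]\<close> with \<open>q\<close> acting as \<open>x\<close>, where \<open>N\<close> is one weight space, and the action of \<open>p\<close> and
  \<open>e\<close> is determined by \<open>qp\<close> and \<open>q\<^sup>2e\<close> on \<open>N\<close>. These two operators amount to a pair \<open>t, D\<close> satisfying
  the relation of the generators of the algebra \<open>R\<close> at the scalar of \<open>z\<close>: for scalar zero \<open>t = qp\<close>, otherwise
  \<open>t = q\<^sup>2(e - p\<^sup>2/(2z))\<close>. By irreducibility \<open>t\<close> is zero or bijective. If it is bijective, then \<open>N\<close> is an
  infinite dimensional simple module over \<open>R\<close>; if it is zero, then \<open>D\<close> is a scalar by Schur's lemma,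
  \<open>N\<close> is one-dimensional, and \<open>M\<close> is a \<open>Q\<close> or a \<open>Q'\<close>.

  For the converse, the components of a submodule of \<open>N \<otimes> \<complex>[x, x\<inverse>]\<close> form an increasing family of
  submodules of \<open>N\<close>, hence each component is zero or \<open>N\<close>, and the family is constant because \<open>p\<close> is
  nonzero in every degree (or \<open>e\<close>, for \<open>Q\<close>).
\<close>

section \<open>Operators on a subspace and Schur's lemma\<close>

definition endo :: "(complex \<Rightarrow> 'v \<Rightarrow> 'v) \<Rightarrow> 'v set \<Rightarrow> ('v \<Rightarrow> 'v::ab_group_add) \<Rightarrow> bool" where
  "endo s C X \<longleftrightarrow> (\<forall>v\<in>C. X v \<in> C) \<and> (\<forall>v\<in>C. \<forall>w\<in>C. X (v + w) = X v + X w) \<and>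
     (\<forall>c. \<forall>v\<in>C. X (s c v) = s c (X v))"

text \<open>Formulated for a set of operators instead of an algebra, so that the same lemmas apply
  to \<open>age(1)\<close>-modules through their five basis operators and to modules over
  \<open>R_algebra\<close> through two generators.\<close>

definition irreducible_under ::
    "(complex \<Rightarrow> 'v \<Rightarrow> 'v) \<Rightarrow> 'v set \<Rightarrow> ('v \<Rightarrow> 'v::ab_group_add) set \<Rightarrow> bool" where
  "irreducible_under s C \<A> \<longleftrightarrow> C \<noteq> {0} \<and>
     (\<forall>W. module.subspace s W \<and> W \<subseteq> C \<and> (\<forall>X\<in>\<A>. \<forall>w\<in>W. X w \<in> W) \<longrightarrow> W = {0} \<or> W = C)"

text \<open>This is \<open>f(X) v\<close>, evaluated by Horner's scheme.\<close>

definition op_poly ::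
    "(complex \<Rightarrow> 'v \<Rightarrow> 'v) \<Rightarrow> ('v \<Rightarrow> 'v) \<Rightarrow> complex poly \<Rightarrow> 'v \<Rightarrow> 'v::ab_group_add" where
  "op_poly s X f v = fold_coeffs (\<lambda>a w. s a v + X w) f 0"

locale cspace = vector_space s for s :: "complex \<Rightarrow> 'v::ab_group_add \<Rightarrow> 'v" +
  fixes C :: "'v set"
  assumes sub: "subspace C"
begin

lemma C_closed [simp]:
  "0 \<in> C" "v \<in> C \<Longrightarrow> w \<in> C \<Longrightarrow> v + w \<in> C" "v \<in> C \<Longrightarrow> w \<in> C \<Longrightarrow> v - w \<in> C"
  "v \<in> C \<Longrightarrow> s c v \<in> C" "v \<in> C \<Longrightarrow> - v \<in> C"
  using sub by (simp_all add: subspace_0 subspace_add subspace_diff subspace_scale subspace_neg)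

lemma C_sum: "(\<And>i. i \<in> F \<Longrightarrow> m i \<in> C) \<Longrightarrow> sum m F \<in> C"
  using sub by (rule subspace_sum)

lemma endo_closed: "endo s C X \<Longrightarrow> v \<in> C \<Longrightarrow> X v \<in> C"
  and endo_add: "endo s C X \<Longrightarrow> v \<in> C \<Longrightarrow> w \<in> C \<Longrightarrow> X (v + w) = X v + X w"
  and endo_scale: "endo s C X \<Longrightarrow> v \<in> C \<Longrightarrow> X (s c v) = s c (X v)"
  by (simp_all add: endo_def)

lemma endo_0: "endo s C X \<Longrightarrow> X 0 = 0"
  using endo_scale[of X 0 0] by simp

lemma endo_minus: "endo s C X \<Longrightarrow> v \<in> C \<Longrightarrow> X (- v) = - X v"
  using endo_scale[of X v "-1"] by simp

lemma endo_diff: "endo s C X \<Longrightarrow> v \<in> C \<Longrightarrow> w \<in> C \<Longrightarrow> X (v - w) = X v - X w"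
  using endo_add[of X v "-w"] by (simp add: endo_minus)

lemma endo_sum: "endo s C X \<Longrightarrow> (\<And>i. i \<in> F \<Longrightarrow> m i \<in> C) \<Longrightarrow> X (sum m F) = (\<Sum>i\<in>F. X (m i))"
  by (induction F rule: infinite_finite_induct) (auto simp: endo_0 endo_add C_sum)

lemmas endo_simps = endo_closed endo_add endo_scale endo_0 endo_minus endo_diff

lemma subspace_kernel: "endo s C X \<Longrightarrow> subspace {v\<in>C. X v = 0}"
  by (auto simp: subspace_def endo_simps)

lemma subspace_image:
  assumes X: "endo s C X"
  shows "subspace (X ` C)"
proof (rule subspaceI)
  show "0 \<in> X ` C" using X by (auto simp: endo_0 intro!: image_eqI[of _ _ 0])
  fix x y assume "x \<in> X ` C" "y \<in> X ` C"
  then obtain a b where "x = X a" "y = X b" "a \<in> C" "b \<in> C" by blast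
  then show "x + y \<in> X ` C" using X by (auto simp: endo_add intro!: image_eqI[of _ _ "a + b"])
next
  fix c x assume "x \<in> X ` C"
  then obtain a where "x = X a" "a \<in> C" by blast
  then show "s c x \<in> X ` C" using X by (auto simp: endo_scale intro!: image_eqI[of _ _ "s c a"])
qed

lemma subspace_singleton_0: "subspace {0}"
  by (simp add: subspace_def)

lemma endo_shift: "endo s C X \<Longrightarrow> endo s C (\<lambda>v. X v - s c v)"
  by (simp add: endo_def algebra_simps scale_right_distrib scale_left_commute)

lemma irreducibleD:
  assumes "irreducible_under s C \<A>" "subspace W" "W \<subseteq> C" "\<And>X w. X \<in> \<A> \<Longrightarrow> w \<in> W \<Longrightarrow> X w \<in> W"
  shows "W = {0} \<or> W = C"
  using assms unfolding irreducible_under_def by blast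

lemma irreducible_nonzero: "irreducible_under s C \<A> \<Longrightarrow> \<exists>v\<in>C. v \<noteq> 0"
  using C_closed(1) unfolding irreducible_under_def by blast

text \<open>Commutation up to a twist suffices: \<open>Y (X v) = X' (Y v)\<close> makes the kernel
  of \<open>Y\<close> stable under \<open>X\<close>, and \<open>X (Y v) = Y (X'' v)\<close> makes
  its image stable, so irreducibility leaves only the trivial cases. The twisted form serves the
  pair \<open>t\<close>, \<open>D\<close>, which does not commute.\<close>

lemma commuting_zero_or_bij:
  assumes irr: "irreducible_under s C \<A>" and \<A>: "\<And>X. X \<in> \<A> \<Longrightarrow> endo s C X"
    and Y: "endo s C Y"
    and comm: "\<And>X. X \<in> \<A> \<Longrightarrow> \<exists>X' X''. endo s C X' \<and> endo s C X'' \<and>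
      (\<forall>v\<in>C. Y (X v) = X' (Y v)) \<and> (\<forall>v\<in>C. X (Y v) = Y (X'' v))"
  shows "(\<forall>v\<in>C. Y v = 0) \<or> bij_betw Y C C"
proof (rule disjCI)
  assume nb: "\<not> bij_betw Y C C"
  have 1: "{v\<in>C. Y v = 0} = {0} \<or> {v\<in>C. Y v = 0} = C"
  proof (rule irreducibleD[OF irr subspace_kernel[OF Y]], blast)
    fix X w assume X: "X \<in> \<A>" and w: "w \<in> {v\<in>C. Y v = 0}"
    obtain X' where "endo s C X'" "\<forall>v\<in>C. Y (X v) = X' (Y v)" using comm[OF X] by blast
    then show "X w \<in> {v\<in>C. Y v = 0}" using w X \<A> by (simp add: endo_simps)
  qed
  have 2: "Y ` C = {0} \<or> Y ` C = C"
  proof (rule irreducibleD[OF irr subspace_image[OF Y]])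
    show "Y ` C \<subseteq> C" using Y by (auto simp: endo_simps)
    fix X w assume X: "X \<in> \<A>" and w: "w \<in> Y ` C"
    obtain X'' where "endo s C X''" "\<forall>v\<in>C. X (Y v) = Y (X'' v)" using comm[OF X] by blast
    then show "X w \<in> Y ` C" using w by (auto simp: endo_simps)
  qed
  show "\<forall>v\<in>C. Y v = 0"
  proof (rule ccontr)
    assume nz: "\<not> (\<forall>v\<in>C. Y v = 0)"
    then have ker: "{v\<in>C. Y v = 0} = {0}" and im: "Y ` C = C" using 1 2 by auto
    have "inj_on Y C"
    proof (rule inj_onI)
      fix a b assume ab: "a \<in> C" "b \<in> C" "Y a = Y b"
      then have "a - b \<in> {v\<in>C. Y v = 0}" using Y by (simp add: endo_simps)
      then show "a = b" using ker by auto
    qed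
    then show False using im nb by (simp add: bij_betw_def)
  qed
qed

section \<open>Polynomials in one operator\<close>

lemma op_poly_0 [simp]: "op_poly s X 0 v = 0"
  by (simp add: op_poly_def)

lemma op_poly_pCons: "endo s C X \<Longrightarrow> op_poly s X (pCons a f) v = s a v + X (op_poly s X f v)"
  by (cases "a = 0 \<and> f = 0") (auto simp: op_poly_def endo_0)

lemma op_poly_const: "endo s C X \<Longrightarrow> op_poly s X [:a:] v = s a v"
  by (simp add: op_poly_pCons endo_0)

lemma op_poly_closed [simp]: "endo s C X \<Longrightarrow> v \<in> C \<Longrightarrow> op_poly s X f v \<in> C"
  by (induction f) (auto simp: op_poly_pCons endo_simps)

lemma op_poly_add:
  "endo s C X \<Longrightarrow> v \<in> C \<Longrightarrow> op_poly s X (f + g) v = op_poly s X f v + op_poly s X g v"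
  by (induction f g rule: poly_induct2)
     (auto simp: op_poly_pCons endo_simps algebra_simps scale_left_distrib)

lemma op_poly_smult:
  "endo s C X \<Longrightarrow> v \<in> C \<Longrightarrow> op_poly s X (Polynomial.smult c f) v = s c (op_poly s X f v)"
  by (induction f) (auto simp: op_poly_pCons endo_simps scale_right_distrib)

lemma op_poly_diff:
  "endo s C X \<Longrightarrow> v \<in> C \<Longrightarrow> op_poly s X (f - g) v = op_poly s X f v - op_poly s X g v"
  using op_poly_add[of X v f "- g"] op_poly_smult[of X v "-1" g] by simp

lemma op_poly_linear:
  assumes "endo s C X" "v \<in> C" "w \<in> C"
  shows "op_poly s X f (v + w) = op_poly s X f v + op_poly s X f w"
    and "op_poly s X f (s c v) = s c (op_poly s X f v)"
  using assms by (induction f)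
    (auto simp: op_poly_pCons endo_simps algebra_simps scale_right_distrib scale_left_commute)

lemma op_poly_factor:
  assumes "endo s C X" "v \<in> C"
  shows "op_poly s X ([:- c, 1:] * f) v = X (op_poly s X f v) - s c (op_poly s X f v)"
  using assms by (simp add: op_poly_diff op_poly_smult op_poly_pCons)

text \<open>By the fundamental theorem of algebra, a polynomial in \<open>X\<close> is a product of operators
  \<open>X - c\<close>, all of them injective.\<close>
lemma op_poly_nonzero:
  assumes X: "endo s C X" and v: "v \<in> C" "v \<noteq> 0"
    and no: "\<And>c w. w \<in> C \<Longrightarrow> X w = s c w \<Longrightarrow> w = 0"
    and f: "f \<noteq> 0"
  shows "op_poly s X f v \<noteq> 0"
  using f
proof (induction "degree f" arbitrary: f)
  case 0
  then obtain a where "f = [:a:]" "a \<noteq> 0" by (metis degree_0_id pCons_eq_0_iff)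
  then show ?case using v X by (simp add: op_poly_pCons endo_0)
next
  case (Suc n)
  then have "\<not> constant (poly f)" by (simp add: constant_degree)
  then obtain c where "poly f c = 0" using fundamental_theorem_of_algebra by blast
  then obtain g where g: "f = [:- c, 1:] * g" by (metis dvdE poly_eq_0_iff_dvd)
  then have "g \<noteq> 0" using Suc by auto
  then have "degree f = Suc (degree g)" using g by (subst g, subst degree_mult_eq) auto
  then have "op_poly s X g v \<noteq> 0" using Suc \<open>g \<noteq> 0\<close> by auto
  then show ?case using no[of "op_poly s X g v" c] X v unfolding g op_poly_factor[OF X v(1)] by auto
qed

section \<open>Schur's lemma in countable dimension\<close>

lemma family_bound:
  assumes F: "finite F" and B: "finite B" "f ` F \<subseteq> span B"
    and indep: "\<And>a x. (\<Sum>y\<in>F. s (a y) (f y)) = 0 \<Longrightarrow> x \<in> F \<Longrightarrow> a x = 0"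
  shows "card F \<le> card B"
proof -
  have inj: "inj_on f F"
  proof (rule inj_onI, rule ccontr)
    fix x y assume xy: "x \<in> F" "y \<in> F" "f x = f y" "x \<noteq> y"
    \<comment> \<open>A repeated value of \<open>f\<close> would give the nontrivial relation
      \<open>f x - f y = 0\<close>.\<close>
    define a :: "_ \<Rightarrow> complex" where "a = (\<lambda>u. if u = x then 1 else if u = y then - 1 else 0)"
    have "(\<Sum>u\<in>F. s (a u) (f u)) = (\<Sum>u\<in>{x, y}. s (a u) (f u))"
      using F xy by (intro sum.mono_neutral_right) (auto simp: a_def)
    also have "\<dots> = 0" using xy by (simp add: a_def)
    finally have "a x = 0" using indep xy by blast
    then show False by (simp add: a_def)
  qed
  have "independent (f ` F)"
  proof (rule independent_if_scalars_zero)
    show "finite (f ` F)" using F by simp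
    fix u x assume *: "(\<Sum>x\<in>f ` F. s (u x) x) = 0" "x \<in> f ` F"
    have "(\<Sum>y\<in>F. s ((u \<circ> f) y) (f y)) = 0" using *(1) by (simp add: sum.reindex[OF inj])
    then show "u x = 0" using indep[of "u \<circ> f"] *(2) by fastforce
  qed
  then have "card (f ` F) \<le> card B" using independent_span_bound B by blast
  then show ?thesis by (simp add: card_image[OF inj])
qed

text \<open>The \<open>u c\<close> are the resolvent vectors \<open>(X - c)^-1 v\<close>. Comparing
  the sum with \<open>f(X) v\<close> instead of 0 makes the induction work: applying
  \<open>X - d\<close> removes \<open>u d\<close>, rescales every other \<open>u c\<close> by
  \<open>c - d\<close>, and otherwise adds only multiples of \<open>v\<close>, which are absorbed
  into the polynomial.\<close>

lemma resolvent_family_independent: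
  fixes u :: "complex \<Rightarrow> 'v"
  assumes X: "endo s C X" and v: "v \<in> C" "v \<noteq> 0"
    and no: "\<And>c w. w \<in> C \<Longrightarrow> X w = s c w \<Longrightarrow> w = 0"
    and u: "\<And>c. u c \<in> C" "\<And>c. X (u c) = s c (u c) + v"
    and F: "finite F" and eq: "(\<Sum>c\<in>F. s (a c) (u c)) = op_poly s X f v"
  shows "\<forall>c\<in>F. a c = 0"
  using F eq
proof (induction F arbitrary: a f rule: finite_induct)
  case (insert d F)
  have *: "X (op_poly s X f v) - s d (op_poly s X f v) =
      s (a d) v + (\<Sum>c\<in>F. s (a c * (c - d)) (u c) + s (a c) v)"
  proof -
    have "X (s (a c) (u c)) - s d (s (a c) (u c)) = s (a c * (c - d)) (u c) + s (a c) v" for c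
      using X u by (simp add: endo_simps scale_right_distrib algebra_simps)
    then have "(\<Sum>c\<in>insert d F. X (s (a c) (u c))) - s d (\<Sum>c\<in>insert d F. s (a c) (u c)) =
        (\<Sum>c\<in>insert d F. s (a c * (c - d)) (u c) + s (a c) v)"
      by (simp only: scale_sum_right sum_subtractf[symmetric])
    moreover have "X (\<Sum>c\<in>insert d F. s (a c) (u c)) = (\<Sum>c\<in>insert d F. X (s (a c) (u c)))"
      using X u by (simp add: endo_sum)
    ultimately show ?thesis
      using insert.hyps unfolding insert.prems[symmetric] by simp
  qed
  have "(\<Sum>c\<in>F. s (a c * (c - d)) (u c)) = op_poly s X ([:- d, 1:] * f - [:a d + sum a F:]) v"
    unfolding op_poly_diff[OF X v(1)] op_poly_factor[OF X v(1)] op_poly_const[OF X] *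
    by (simp add: sum.distrib scale_sum_left scale_left_distrib)
  then have "\<forall>c\<in>F. a c * (c - d) = 0" by (rule insert.IH)
  then have aF: "\<forall>c\<in>F. a c = 0" using insert.hyps by auto
  \<comment> \<open>Only the term at \<open>d\<close> is left, so \<open>(X - d) f(X) - a d\<close>
    kills \<open>v\<close>. By \<open>op_poly_nonzero\<close> this polynomial is zero, and its value
    at \<open>d\<close> is \<open>- a d\<close>.\<close>
  have "op_poly s X ([:- d, 1:] * f - [:a d:]) v = 0"
    unfolding op_poly_diff[OF X v(1)] op_poly_factor[OF X v(1)] op_poly_const[OF X] *
    using aF by simp
  then have "[:- d, 1:] * f - [:a d:] = 0"
    using op_poly_nonzero[OF X v, of "[:- d, 1:] * f - [:a d:]"] no by blast
  then have "poly ([:- d, 1:] * f - [:a d:]) d = 0" by simp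
  then show ?case using aF by simp
qed simp

text \<open>The words in the operators, applied to one nonzero vector, span a stable subspace. For
  countably many operators this bounds the dimension of \<open>C\<close> by a countable
  cardinal.\<close>

lemma words_span:
  assumes irr: "irreducible_under s C \<A>" and \<A>: "\<And>X. X \<in> \<A> \<Longrightarrow> endo s C X" and v: "v \<in> C" "v \<noteq> 0"
  shows "span ((\<lambda>Xs. foldr (\<lambda>X. X) Xs v) ` lists \<A>) = C" (is "span ?S = C")
proof -
  have S: "?S \<subseteq> C"
  proof (rule image_subsetI)
    fix Xs assume "Xs \<in> lists \<A>"
    then show "foldr (\<lambda>X. X) Xs v \<in> C" by (induction Xs) (auto simp: v endo_closed \<A>)
  qed
  then have le: "span ?S \<subseteq> C" using sub span_minimal by blast
  have "span ?S = {0} \<or> span ?S = C"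
  proof (rule irreducibleD[OF irr subspace_span le])
    fix X w assume X: "X \<in> \<A>" and "w \<in> span ?S"
    from this(2) have "w \<in> C \<and> X w \<in> span ?S"
    proof (induction rule: span_induct_alt)
      case base then show ?case using endo_0[OF \<A>[OF X]] span_zero sub by simp
    next
      case (step c x y)
      then obtain Xs where Xs: "Xs \<in> lists \<A>" "x = foldr (\<lambda>X. X) Xs v" by blast
      have "X x \<in> ?S" using X Xs by (auto intro!: image_eqI[of _ _ "X # Xs"])
      moreover have "x \<in> C" "y \<in> C" using step S by auto
      ultimately show ?case using step \<A>[OF X] by (simp add: endo_simps span_add span_scale span_base)
    qed
    then show "X w \<in> span ?S" ..
  qed
  moreover have "v \<in> span ?S" by (rule span_base, rule image_eqI[of _ _ "[]"]) auto
  ultimately show ?thesis using v by auto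
qed

text \<open>Dixmier's argument: if \<open>Y\<close> is not a scalar, then every \<open>Y - c\<close>
  is bijective, and the vectors \<open>(Y - c)^-1 v\<close> form an uncountable independent family
  in a space of countable dimension.\<close>

lemma schur:
  assumes irr: "irreducible_under s C \<A>" and \<A>: "\<And>X. X \<in> \<A> \<Longrightarrow> endo s C X" and cnt: "countable \<A>"
    and Y: "endo s C Y" and comm: "\<And>X v. X \<in> \<A> \<Longrightarrow> v \<in> C \<Longrightarrow> Y (X v) = X (Y v)"
  shows "\<exists>c. \<forall>v\<in>C. Y v = s c v"
proof (rule ccontr)
  assume neg: "\<not> ?thesis"
  have bij: "bij_betw (\<lambda>v. Y v - s c v) C C" for c
  proof -
    have "(\<forall>v\<in>C. Y v - s c v = 0) \<or> bij_betw (\<lambda>v. Y v - s c v) C C"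
    proof (rule commuting_zero_or_bij[OF irr \<A> endo_shift[OF Y]])
      fix X assume X: "X \<in> \<A>"
      then show "\<exists>X' X''. endo s C X' \<and> endo s C X'' \<and>
        (\<forall>v\<in>C. Y (X v) - s c (X v) = X' (Y v - s c v)) \<and> (\<forall>v\<in>C. X (Y v - s c v) = Y (X'' v) - s c (X'' v))"
        using \<A>[OF X] Y by (intro exI[of _ X]) (simp add: comm endo_simps)
    qed
    then show ?thesis using neg by auto
  qed
  have no: "w = 0" if "w \<in> C" "Y w = s c w" for c w
    using inj_onD[OF bij_betw_imp_inj_on[OF bij[of c]], of w 0] that by (simp add: endo_0[OF Y])
  obtain v where v: "v \<in> C" "v \<noteq> 0"
    using irreducible_nonzero[OF irr] by blast
  have "\<exists>w\<in>C. v = Y w - s c w" for c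
    using bij[of c] v unfolding bij_betw_def by blast
  then obtain u where u: "\<And>c. u c \<in> C" "\<And>c. v = Y (u c) - s c (u c)" by metis
  have u2: "Y (u c) = s c (u c) + v" for c using u(2)[of c] by (metis diff_add_cancel add.commute)
  define S where "S = (\<lambda>Xs. foldr (\<lambda>X. X) Xs v) ` lists \<A>"
  have spanS: "span S = C" unfolding S_def by (rule words_span[OF irr \<A> v])
  have cS: "countable S" "S \<noteq> {}" unfolding S_def using cnt by auto
  \<comment> \<open>The spaces \<open>V n\<close> exhaust \<open>C\<close>. Since the complex
    numbers are uncountable, one of them contains infinitely many \<open>u c\<close>; picking
    \<open>n + 1\<close> of these contradicts that \<open>V n\<close> is spanned by at most
    \<open>n\<close> vectors.\<close>
  define V where "V n = span (from_nat_into S ` {..<n})" for n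
  have "\<exists>n. x \<in> V n" if "x \<in> C" for x
  proof -
    have "x \<in> span S" using that spanS by simp
    then show ?thesis
    proof (induction rule: span_induct_alt)
      case base then show ?case by (auto simp: V_def span_zero)
    next
      case (step c x y)
      then obtain n where n: "y \<in> V n" by blast
      obtain k where k: "x = from_nat_into S k" using cS step by (metis from_nat_into_surj)
      have "y \<in> V (max n (Suc k))" using n unfolding V_def by (rule set_mp[OF span_mono, rotated]) auto
      moreover have "x \<in> V (max n (Suc k))" unfolding V_def k by (rule span_base) auto
      ultimately show ?case unfolding V_def by (metis span_add span_scale)
    qed
  qed
  then have UN: "(\<Union>n. {c. u c \<in> V n}) = UNIV" using u(1) by blast
  have "\<exists>n. infinite {c. u c \<in> V n}"
  proof (rule ccontr)
    assume "\<nexists>n. infinite {c. u c \<in> V n}"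
    then have "countable (\<Union>n. {c. u c \<in> V n})" by (intro countable_UN) (auto intro: countable_finite)
    then show False using uncountable_UNIV_complex unfolding UN by simp
  qed
  then obtain n where "infinite {c. u c \<in> V n}" by blast
  then obtain F where F: "F \<subseteq> {c. u c \<in> V n}" "finite F" "card F = Suc n"
    by (meson infinite_arbitrarily_large)
  have "card F \<le> card (from_nat_into S ` {..<n})"
  proof (rule family_bound[OF F(2)])
    show "u ` F \<subseteq> span (from_nat_into S ` {..<n})" using F by (auto simp: V_def)
    fix a x assume "(\<Sum>y\<in>F. s (a y) (u y)) = 0" "x \<in> F"
    moreover have "\<forall>c\<in>F. a c = 0" if "(\<Sum>y\<in>F. s (a y) (u y)) = op_poly s Y 0 v"
      by (rule resolvent_family_independent[OF Y v _ u(1) u2 F(2) that]) (rule no)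
    ultimately show "a x = 0" by simp
  qed auto
  also have "\<dots> \<le> n" using card_image_le[of "{..<n}"] by force
  finally show False using F by simp
qed

text \<open>When all operators are scalars, every line is stable.\<close>

lemma irreducible_scalars:
  assumes irr: "irreducible_under s C \<A>" and sc: "\<And>X. X \<in> \<A> \<Longrightarrow> \<exists>c. \<forall>v\<in>C. X v = s c v"
  shows "\<exists>v. v \<noteq> 0 \<and> C = range (\<lambda>c. s c v)"
proof -
  obtain v where v: "v \<in> C" "v \<noteq> 0"
    using irreducible_nonzero[OF irr] by blast
  have "range (\<lambda>c. s c v) = {0} \<or> range (\<lambda>c. s c v) = C"
  proof (rule irreducibleD[OF irr])
    show "subspace (range (\<lambda>c. s c v))" using subspace_span[of "{v}"] by (simp add: span_singleton)
    show "range (\<lambda>c. s c v) \<subseteq> C" using v by auto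
    fix X w assume "X \<in> \<A>" "w \<in> range (\<lambda>c. s c v)"
    then show "X w \<in> range (\<lambda>c. s c v)" using sc[of X] v by auto
  qed
  moreover have "v \<in> range (\<lambda>c. s c v)" by (rule image_eqI[of _ _ 1]) auto
  ultimately show ?thesis using v by auto
qed

text \<open>With \<open>W = {0}\<close> this is the linear independence of eigenvectors; with \<open>W\<close> a submodule, the
  fact that submodules of a weight module are sums of their weight spaces.\<close>
lemma eigen_components:
  assumes H: "endo s C H" and W: "subspace W" "W \<subseteq> C" "\<And>w. w \<in> W \<Longrightarrow> H w \<in> W"
    and F: "finite F" "inj_on \<mu> F"
    and m: "\<And>i. i \<in> F \<Longrightarrow> m i \<in> C" "\<And>i. i \<in> F \<Longrightarrow> H (m i) = s (\<mu> i) (m i)"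
    and "sum m F \<in> W"
  shows "\<forall>i\<in>F. m i \<in> W"
  using F m assms(9)
proof (induction F arbitrary: m rule: finite_induct)
  case (insert j F)
  let ?x = "sum m (insert j F)"
  \<comment> \<open>Applying \<open>H - \<mu> j\<close> removes the component at \<open>j\<close>
    and multiplies the others by nonzero scalars.\<close>
  have "H ?x - s (\<mu> j) ?x \<in> W" using insert.prems(4) W by (simp add: subspace_diff subspace_scale)
  also have "H ?x - s (\<mu> j) ?x = (\<Sum>i\<in>F. s (\<mu> i - \<mu> j) (m i))"
    using insert.prems insert.hyps
    by (subst endo_sum[OF H]) (auto simp: scale_right_distrib scale_sum_right sum_subtractf[symmetric]
         scale_left_diff_distrib)
  finally have "\<forall>i\<in>F. s (\<mu> i - \<mu> j) (m i) \<in> W"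
    using insert.prems by (intro insert.IH) (auto simp: endo_simps[OF H] scale_left_commute mult.commute inj_on_def)
  moreover have "\<mu> i - \<mu> j \<noteq> 0" if "i \<in> F" for i
    using insert that by (metis inj_onD insertI1 insertI2 right_minus_eq)
  ultimately have 1: "\<forall>i\<in>F. m i \<in> W"
    by (metis (no_types, lifting) W(1) left_inverse scale_one scale_scale subspace_scale)
  then have "?x - sum m F \<in> W"
    using insert.prems(4) W(1) subspace_sum[of W F m] by (intro subspace_diff) auto
  then show ?case using 1 insert.hyps by simp
qed simp

end

section \<open>Modules over the algebra generated by \<open>t\<close> and \<open>t d/dt\<close>\<close>

abbreviation R1 :: "weyl set" where "R1 \<equiv> unital_subalgebra {weyl_t, weyl_t * weyl_d}"

text \<open>\<open>normal_form a G\<close> says that \<open>a\<close> is the sum of the \<open>t\<^sup>i g\<^sub>i(t d/dt)\<close>, where the polynomials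
  \<open>g\<^sub>i\<close> are the coefficients of \<open>G\<close>: this operator maps \<open>t\<^sup>n\<close> to the sum of the \<open>g\<^sub>i(n) t\<^sup>n\<^sup>+\<^sup>i\<close>.\<close>
definition normal_form :: "weyl \<Rightarrow> complex poly poly \<Rightarrow> bool" where
  "normal_form a G \<longleftrightarrow> (\<forall>n k. coeff (Rep_weyl a (monom 1 n)) k =
     (if n \<le> k then poly (coeff G (k - n)) (of_nat n) else 0))"

text \<open>The images of the monomials \<open>t^n\<close> reveal the values of each coefficient
  polynomial at all natural numbers, and infinitely many values determine a polynomial.\<close>

lemma normal_form_unique:
  assumes "normal_form a G" "normal_form a G'"
  shows "G = G'"
proof (rule poly_eqI)
  fix i
  have "poly (coeff G i - coeff G' i) (of_nat n) = 0" for n :: nat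
    using assms[unfolded normal_form_def, THEN spec[of _ n], THEN spec[of _ "n + i"]] by simp
  then have "range of_nat \<subseteq> {x. poly (coeff G i - coeff G' i) x = 0}" by auto
  moreover have "infinite (range (of_nat :: nat \<Rightarrow> complex))"
    by (simp add: finite_image_iff inj_on_def)
  ultimately have "coeff G i - coeff G' i = 0"
    using poly_roots_finite finite_subset by blast
  then show "coeff G i = coeff G' i" by simp
qed

lemma normal_form_1: "normal_form 1 [:1:]"
  by (auto simp: normal_form_def one_weyl.rep_eq coeff_pCons split: nat.split)

lemma normal_form_add: "normal_form a G \<Longrightarrow> normal_form b H \<Longrightarrow> normal_form (a + b) (G + H)"
  by (simp add: normal_form_def plus_weyl.rep_eq)

lemma normal_form_scale: "normal_form a G \<Longrightarrow> normal_form (c *\<^sub>W a) (Polynomial.smult [:c:] G)"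
  by (simp add: normal_form_def weyl_scale.rep_eq)

lemma normal_form_t_mult: "normal_form a G \<Longrightarrow> normal_form (weyl_t * a) (pCons 0 G)"
  by (auto simp: normal_form_def times_weyl.rep_eq weyl_t.rep_eq coeff_pCons Suc_diff_le split: nat.splits)

text \<open>The effect on normal forms of multiplying by \<open>t d/dt\<close> from the left:
  passing it through \<open>t^i\<close> gives \<open>t^i (t d/dt + i)\<close>, and the summand
  \<open>i\<close> amounts to a derivative in the outer variable.\<close>

definition euler_left :: "complex poly poly \<Rightarrow> complex poly poly" where
  "euler_left G = Polynomial.smult [:0, 1:] G + pCons 0 (pderiv G)"

lemma coeff_euler_left: "coeff (euler_left G) i = ([:0, 1:] + of_nat i) * coeff G i"
  by (cases i) (simp_all add: euler_left_def coeff_pderiv algebra_simps)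

lemma normal_form_td_mult: "normal_form a G \<Longrightarrow> normal_form (weyl_t * weyl_d * a) (euler_left G)"
proof -
  have *: "coeff ([:0, 1:] * pderiv f) k = of_nat k * coeff f k" for f :: "complex poly" and k
    by (cases k) (simp_all add: coeff_pderiv)
  assume "normal_form a G"
  then show ?thesis
    by (auto simp: normal_form_def times_weyl.rep_eq weyl_t.rep_eq weyl_d.rep_eq o_def *
          coeff_euler_left of_nat_diff simp del: mult_pCons_left)
qed

lemma weyl_scale_mult: "(c *\<^sub>W a) * b = c *\<^sub>W (a * b)"
  by transfer (simp add: fun_eq_iff)

lemma normal_form_ex: assumes "a \<in> R1" shows "\<exists>G. normal_form a G"
proof -
  \<comment> \<open>Strengthened for the induction: left multiplication by \<open>a\<close>
    preserves the existence of a normal form. Only products of a generator with a normal form then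
    have to be computed.\<close>
  have "\<forall>b G. normal_form b G \<longrightarrow> (\<exists>H. normal_form (a * b) H)" using assms
  proof induction
    case one then show ?case by auto
  next
    case (gen a)
    then show ?case using normal_form_t_mult normal_form_td_mult by fastforce
  next
    case (add a a')
    then show ?case by (metis distrib_right normal_form_add)
  next
    case (scale a c)
    then show ?case by (metis weyl_scale_mult normal_form_scale)
  next
    case (mult a a')
    then show ?case by (metis mult.assoc)
  qed
  then show ?thesis using normal_form_1 by (metis mult_1_right)
qed

text \<open>This is the sum of the \<open>T^i g_i(D) v\<close>, where the \<open>g_i\<close> are the
  coefficients of \<open>G\<close>: a normal form with \<open>T\<close> in place of \<open>t\<close>
  and \<open>D\<close> in place of \<open>t d/dt\<close>.\<close>

definition op_poly2 :: "(complex \<Rightarrow> 'v \<Rightarrow> 'v) \<Rightarrow> ('v \<Rightarrow> 'v) \<Rightarrow> ('v \<Rightarrow> 'v) \<Rightarrow>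
    complex poly poly \<Rightarrow> 'v \<Rightarrow> 'v::ab_group_add" where
  "op_poly2 s T D G v = fold_coeffs (\<lambda>f w. op_poly s D f v + T w) G 0"

text \<open>Elements of \<open>R1\<close> are concrete differential operators, not words in
  generators. Unique normal forms replace a presentation by generators and relations: they make the
  action determined by \<open>T\<close> and \<open>D\<close> well defined.\<close>

definition weyl_act :: "(complex \<Rightarrow> 'v \<Rightarrow> 'v) \<Rightarrow> ('v \<Rightarrow> 'v) \<Rightarrow> ('v \<Rightarrow> 'v) \<Rightarrow>
    weyl \<Rightarrow> 'v \<Rightarrow> 'v::ab_group_add" where
  "weyl_act s T D a v = op_poly2 s T D (THE G. normal_form a G) v"

lemma weyl_act_eq: "normal_form a G \<Longrightarrow> weyl_act s T D a v = op_poly2 s T D G v"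
  using normal_form_unique unfolding weyl_act_def by (metis the_equality)

locale euler_pair = cspace s C for s :: "complex \<Rightarrow> 'v::ab_group_add \<Rightarrow> 'v" and C +
  fixes T D :: "'v \<Rightarrow> 'v"
  assumes T: "endo s C T" and D: "endo s C D"
    and comm: "v \<in> C \<Longrightarrow> D (T v) = T (D v) + T v"
begin

lemma op_poly2_0 [simp]: "op_poly2 s T D 0 v = 0"
  by (simp add: op_poly2_def)

lemma op_poly2_pCons: "op_poly2 s T D (pCons f G) v = op_poly s D f v + T (op_poly2 s T D G v)"
  by (cases "f = 0 \<and> G = 0") (auto simp: op_poly2_def endo_0[OF T])

lemma op_poly2_closed: "v \<in> C \<Longrightarrow> op_poly2 s T D G v \<in> C"
  by (induction G) (auto simp: op_poly2_pCons endo_simps[OF T] D)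

lemma op_poly2_add:
  "v \<in> C \<Longrightarrow> op_poly2 s T D (F + G) v = op_poly2 s T D F v + op_poly2 s T D G v"
  by (induction F G rule: poly_induct2)
     (auto simp: op_poly2_pCons op_poly2_closed endo_simps[OF T] op_poly_add[OF D] algebra_simps)

lemma op_poly2_smult:
  "v \<in> C \<Longrightarrow> op_poly2 s T D (Polynomial.smult [:c:] G) v = s c (op_poly2 s T D G v)"
  by (induction G)
     (auto simp: op_poly2_pCons op_poly2_closed endo_simps[OF T] op_poly_smult[OF D] scale_right_distrib)

lemma op_poly2_linear:
  assumes "v \<in> C" "w \<in> C"
  shows "op_poly2 s T D G (v + w) = op_poly2 s T D G v + op_poly2 s T D G w"
    and "op_poly2 s T D G (s c v) = s c (op_poly2 s T D G v)"
  using assms by (induction G)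
    (auto simp: op_poly2_pCons op_poly2_closed endo_simps[OF T] op_poly_linear[OF D] scale_right_distrib algebra_simps)

text \<open>The relation between \<open>T\<close> and \<open>D\<close> enters here:
  \<open>D T = T (D + 1)\<close> matches the rule by which \<open>t d/dt\<close> passes through
  \<open>t\<close>.\<close>

lemma op_poly2_euler_left:
  "v \<in> C \<Longrightarrow> op_poly2 s T D (euler_left G) v = D (op_poly2 s T D G v)"
proof (induction G)
  case 0 then show ?case by (simp add: euler_left_def endo_0[OF D])
next
  case (pCons f G)
  have "euler_left (pCons f G) = pCons ([:0, 1:] * f) (euler_left G + G)"
    by (simp add: euler_left_def pderiv_pCons)
  then show ?case using pCons
    by (simp add: op_poly2_pCons op_poly2_add op_poly2_closed endo_simps[OF T] endo_simps[OF D] D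
        op_poly_pCons comm del: mult_pCons_left)
       (simp add: op_poly_pCons D)
qed

abbreviation "act1 \<equiv> weyl_act s T D"

lemma act1_1: "v \<in> C \<Longrightarrow> act1 1 v = v"
  by (simp add: weyl_act_eq[OF normal_form_1] op_poly2_pCons endo_0[OF T] pCons_one[symmetric]
      op_poly_const[OF D] del: pCons_one)

lemma act1_closed: "a \<in> R1 \<Longrightarrow> v \<in> C \<Longrightarrow> act1 a v \<in> C"
  using normal_form_ex by (metis weyl_act_eq op_poly2_closed)

lemma act1_add: "a \<in> R1 \<Longrightarrow> b \<in> R1 \<Longrightarrow> v \<in> C \<Longrightarrow> act1 (a + b) v = act1 a v + act1 b v"
  using normal_form_ex normal_form_add by (metis weyl_act_eq op_poly2_add)

lemma act1_scale: "a \<in> R1 \<Longrightarrow> v \<in> C \<Longrightarrow> act1 (c *\<^sub>W a) v = s c (act1 a v)"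
  using normal_form_ex normal_form_scale by (metis weyl_act_eq op_poly2_smult)

lemma act1_linear:
  assumes "a \<in> R1" "v \<in> C" "w \<in> C"
  shows "act1 a (v + w) = act1 a v + act1 a w" "act1 a (s c v) = s c (act1 a v)"
proof -
  obtain G where "normal_form a G" using normal_form_ex assms by blast
  then show "act1 a (v + w) = act1 a v + act1 a w" "act1 a (s c v) = s c (act1 a v)"
    using assms op_poly2_linear by (simp_all add: weyl_act_eq)
qed

lemma act1_gen_mult:
  assumes "a \<in> R1" "v \<in> C"
  shows "act1 (weyl_t * a) v = T (act1 a v)" "act1 (weyl_t * weyl_d * a) v = D (act1 a v)"
proof -
  obtain G where G: "normal_form a G" using normal_form_ex assms by blast
  show "act1 (weyl_t * a) v = T (act1 a v)" "act1 (weyl_t * weyl_d * a) v = D (act1 a v)"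
    using assms(2)
    by (simp_all add: weyl_act_eq[OF G] weyl_act_eq[OF normal_form_t_mult[OF G]]
        weyl_act_eq[OF normal_form_td_mult[OF G]] op_poly2_pCons op_poly2_euler_left)
qed

lemma act1_gen: "v \<in> C \<Longrightarrow> act1 weyl_t v = T v" "v \<in> C \<Longrightarrow> act1 (weyl_t * weyl_d) v = D v"
  using act1_gen_mult[OF unital_subalgebra.one] by (simp_all add: act1_1)

lemma act1_mult:
  assumes "a \<in> R1" "b \<in> R1" "v \<in> C"
  shows "act1 (a * b) v = act1 a (act1 b v)"
  using assms
proof (induction a arbitrary: b v)
  case one then show ?case by (simp add: act1_1 act1_closed)
next
  case (gen a)
  then show ?case using act1_gen_mult[OF gen(2,3)] act1_gen act1_closed by auto
next
  case (add a a')
  then show ?case by (simp add: distrib_right act1_add act1_closed unital_subalgebra.mult)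
next
  case (scale a c)
  then show ?case by (simp add: weyl_scale_mult act1_scale act1_closed unital_subalgebra.mult)
next
  case (mult a a')
  then show ?case by (simp add: mult.assoc act1_closed unital_subalgebra.mult)
qed

lemma R1_module:
  assumes "A \<subseteq> R1"
  shows "algebra_module A \<lparr>scale = s, carrier = C, act = act1\<rparr>"
proof -
  have "a \<in> R1" if "a \<in> A" for a using assms that by blast
  then show ?thesis
    using vector_space_axioms sub
    by (simp add: algebra_module_def linear_action_def act1_closed act1_linear act1_1 act1_add
        act1_scale act1_mult)
qed

end

section \<open>The algebras \<open>R_algebra z\<close> and their generators\<close>

lemma unital_subalgebra_mono:
  assumes "S \<subseteq> unital_subalgebra S'"
  shows "unital_subalgebra S \<subseteq> unital_subalgebra S'"
proof
  fix a assume "a \<in> unital_subalgebra S"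
  then show "a \<in> unital_subalgebra S'"
    using assms by induction (blast intro: unital_subalgebra.intros)+
qed

text \<open>Since \<open>t^2 d/dt = t (t d/dt)\<close>, the algebra for scalar zero lies in
  \<open>R1\<close> as well, and an action of \<open>R1\<close> serves both cases.\<close>

lemma R_algebra_subset: "R_algebra z \<subseteq> R1"
proof -
  have "weyl_t\<^sup>2 * weyl_d \<in> R1"
    using unital_subalgebra.mult[of weyl_t "{weyl_t, weyl_t * weyl_d}" "weyl_t * weyl_d"]
    by (simp add: unital_subalgebra.gen power2_eq_square mult.assoc)
  then have "{weyl_t, weyl_t\<^sup>2 * weyl_d} \<subseteq> R1"
    by (simp add: unital_subalgebra.gen)
  then show ?thesis using unital_subalgebra_mono by (auto simp: R_algebra_def)
qed

lemma R_algebra_gen: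
  "weyl_t \<in> R_algebra z" "(if z = 0 then weyl_t\<^sup>2 * weyl_d else weyl_t * weyl_d) \<in> R_algebra z"
  by (simp_all add: R_algebra_def unital_subalgebra.gen)

lemma submodule_R_algebra_iff:
  assumes N: "algebra_module (R_algebra z) N"
  shows "submodule (R_algebra z) N W \<longleftrightarrow> W \<subseteq> carrier N \<and> module.subspace (scale N) W \<and>
    (\<forall>w\<in>W. act N weyl_t w \<in> W \<and> act N (if z = 0 then weyl_t\<^sup>2 * weyl_d else weyl_t * weyl_d) w \<in> W)"
    (is "_ \<longleftrightarrow> ?R")
proof
  assume "submodule (R_algebra z) N W"
  then show ?R using R_algebra_gen[of z] by (simp add: submodule_def)
next
  assume R: ?R
  interpret N: vector_space "scale N" using N by (simp add: algebra_module_def linear_action_def)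
  define S where "S = {weyl_t, if z = 0 then weyl_t\<^sup>2 * weyl_d else weyl_t * weyl_d}"
  have RS: "R_algebra z = unital_subalgebra S" by (simp add: R_algebra_def S_def)
  have "act N a w \<in> W" if "a \<in> unital_subalgebra S" "w \<in> W" for a w
    using that
  proof (induction arbitrary: w)
    case one then show ?case using N R by (auto simp: algebra_module_def)
  next
    case (gen a) then show ?case using R by (auto simp: S_def)
  next
    case (add a b)
    then have "act N (a + b) w = act N a w + act N b w" using N R by (auto simp: algebra_module_def RS)
    then show ?case using add R by (auto intro: N.subspace_add)
  next
    case (scale a c)
    then have "act N (c *\<^sub>W a) w = rep.scale N c (act N a w)" using N R by (auto simp: algebra_module_def RS)
    then show ?case using scale R by (auto intro: N.subspace_scale)
  next
    case (mult a b)
    then have "act N (a * b) w = act N a (act N b w)" using N R by (auto simp: algebra_module_def RS)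
    then show ?case using mult by simp
  qed
  then show "submodule (R_algebra z) N W" using R by (auto simp: submodule_def RS)
qed

section \<open>Modules over the ageing algebra through their basis operators\<close>

text \<open>Read as rewrite rules, the relations move \<open>q\<close> away from the vector and
  \<open>h\<close> and \<open>z\<close> towards it.\<close>

locale age_ops = cspace s C for s :: "complex \<Rightarrow> 'v::ab_group_add \<Rightarrow> 'v" and C +
  fixes e h p q z :: "'v \<Rightarrow> 'v"
  assumes endos: "endo s C e" "endo s C h" "endo s C p" "endo s C q" "endo s C z"
    and eq: "v \<in> C \<Longrightarrow> e (q v) = q (e v) + p v"
    and pq: "v \<in> C \<Longrightarrow> p (q v) = q (p v) + z v"
    and pe: "v \<in> C \<Longrightarrow> p (e v) = e (p v)"
    and hq: "v \<in> C \<Longrightarrow> h (q v) = q (h v) - q v"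
    and hp: "v \<in> C \<Longrightarrow> h (p v) = p (h v) + p v"
    and he: "v \<in> C \<Longrightarrow> h (e v) = e (h v) + s 2 (e v)"
    and zc: "v \<in> C \<Longrightarrow> z (e v) = e (z v)" "v \<in> C \<Longrightarrow> z (h v) = h (z v)"
      "v \<in> C \<Longrightarrow> z (p v) = p (z v)" "v \<in> C \<Longrightarrow> z (q v) = q (z v)"
begin

lemmas op_simps [simp] =
  endo_simps[OF endos(1)] endo_simps[OF endos(2)] endo_simps[OF endos(3)]
  endo_simps[OF endos(4)] endo_simps[OF endos(5)]

end

lemma age_action_expand:
  "age_action s T x v = s (x $ gen_e) (T gen_e v) + s (x $ gen_h) (T gen_h v) + s (x $ gen_p) (T gen_p v)
     + s (x $ gen_q) (T gen_q v) + s (x $ gen_z) (T gen_z v)"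
  by (simp add: age_action_def UNIV_age_basis add.assoc)

lemma age_moduleI:
  assumes "age_ops s C (T gen_e) (T gen_h) (T gen_p) (T gen_q) (T gen_z)"
  shows "age_module \<lparr>scale = s, carrier = C, act = age_action s T\<rparr>"
proof -
  interpret age_ops s C "T gen_e" "T gen_h" "T gen_p" "T gen_q" "T gen_z" by fact
  have "age_action s T (bracket x y) v
      = age_action s T x (age_action s T y v) - age_action s T y (age_action s T x v)"
    if "v \<in> C" for x y v
    using that
    by (simp add: age_action_expand bracket_def eq pq pe hq hp he zc scale_right_distrib
        scale_left_distrib scale_left_diff_distrib scale_right_diff_distrib scale_minus_left algebra_simps)
  moreover have "age_action s T x v \<in> C" if "v \<in> C" for x v
    using that by (simp add: age_action_expand)
  ultimately show ?thesis
    using vector_space_axioms sub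
    by (simp add: age_module_def linear_action_def age_action_expand scale_right_distrib
        scale_left_distrib algebra_simps scale_left_commute)
qed

lemma age_vec_expand:
  "x = x $ gen_e *s age_e + x $ gen_h *s age_h + x $ gen_p *s age_p + x $ gen_q *s age_q + x $ gen_z *s age_z"
  for x :: age
  by (simp add: vec_eq_iff axis_def) (metis age_basis.exhaust)

lemma age_module_act:
  assumes "age_module M" "v \<in> carrier M"
  shows "act M x v = age_action (scale M) (\<lambda>b. act M (axis b 1)) x v"
  by (subst age_vec_expand) (use assms in \<open>simp add: age_module_def age_action_expand\<close>)

lemma age_module_ops:
  assumes M: "age_module M"
  shows "age_ops (scale M) (carrier M) (act M age_e) (act M age_h) (act M age_p) (act M age_q) (act M age_z)"
proof -
  interpret cspace "scale M" "carrier M"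
    using M by (simp add: age_module_def linear_action_def cspace_def cspace_axioms_def)
  have br: "act M (bracket x y) v = act M x (act M y v) - act M y (act M x v)"
    if "v \<in> carrier M" for x y v using M that by (simp add: age_module_def)
  have sc: "act M (c *s x) v = rep.scale M c (act M x v)" if "v \<in> carrier M" for c x v
    using M that by (simp add: age_module_def)
  have z: "act M 0 v = 0" if "v \<in> carrier M" for v
    using sc[OF that, of 0 0] by simp
  have m: "act M (- x) v = - act M x v" if "v \<in> carrier M" for x v
    using sc[OF that, of "-1" x] by simp
  show ?thesis
  proof
    show "endo (rep.scale M) (carrier M) (act M age_e)" "endo (rep.scale M) (carrier M) (act M age_h)"
      "endo (rep.scale M) (carrier M) (act M age_p)" "endo (rep.scale M) (carrier M) (act M age_q)"
      "endo (rep.scale M) (carrier M) (act M age_z)"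
      using M by (simp_all add: age_module_def linear_action_def endo_def)
    fix v assume v: "v \<in> carrier M"
    show "act M age_e (act M age_q v) = act M age_q (act M age_e v) + act M age_p v"
      using br[OF v, of age_e age_q] by (simp add: bracket_basis)
    show "act M age_p (act M age_q v) = act M age_q (act M age_p v) + act M age_z v"
      using br[OF v, of age_p age_q] by (simp add: bracket_basis)
    show "act M age_p (act M age_e v) = act M age_e (act M age_p v)"
      using br[OF v, of age_e age_p] by (simp add: bracket_basis z v)
    show "act M age_h (act M age_q v) = act M age_q (act M age_h v) - act M age_q v"
      using br[OF v, of age_h age_q] by (simp add: bracket_basis m v algebra_simps)
    show "act M age_h (act M age_p v) = act M age_p (act M age_h v) + act M age_p v"
      using br[OF v, of age_h age_p] by (simp add: bracket_basis algebra_simps)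
    show "act M age_h (act M age_e v) = act M age_e (act M age_h v) + rep.scale M 2 (act M age_e v)"
      using br[OF v, of age_h age_e] by (simp add: bracket_basis sc v algebra_simps)
    show "act M age_z (act M age_e v) = act M age_e (act M age_z v)"
      "act M age_z (act M age_h v) = act M age_h (act M age_z v)"
      "act M age_z (act M age_p v) = act M age_p (act M age_z v)"
      "act M age_z (act M age_q v) = act M age_q (act M age_z v)"
      using br[OF v, of age_z] by (simp_all add: bracket_basis z v)
  qed
qed


section \<open>Graded modules in which \<open>q\<close> is the shift\<close>

text \<open>The modules \<open>Q\<close>, \<open>Q'\<close> and \<open>N\<close> are all of this
  form, so simplicity and the construction of isomorphisms can be treated once for all
  three.\<close>

definition grad :: "(complex \<Rightarrow> 'n \<Rightarrow> 'n) \<Rightarrow> 'n set \<Rightarrow> complex \<Rightarrow> complex \<Rightarrow>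
    (int \<Rightarrow> 'n \<Rightarrow> 'n) \<Rightarrow> (int \<Rightarrow> 'n \<Rightarrow> 'n) \<Rightarrow> (age, int \<Rightarrow>\<^sub>0 'n::ab_group_add) rep" where
  "grad s C hh zz P E =
     \<lparr>scale = (\<lambda>c. Poly_Mapping.map (s c)),
      carrier = {f. \<forall>i. Poly_Mapping.lookup f i \<in> C},
      act = age_action (\<lambda>c. Poly_Mapping.map (s c)) (\<lambda>b. extend (\<lambda>i v. case b of
          gen_h \<Rightarrow> Poly_Mapping.single i (s (hh - of_int i) v)
        | gen_z \<Rightarrow> Poly_Mapping.single i (s zz v)
        | gen_q \<Rightarrow> Poly_Mapping.single (i + 1) v
        | gen_p \<Rightarrow> Poly_Mapping.single (i - 1) (P i v)
        | gen_e \<Rightarrow> Poly_Mapping.single (i - 2) (E i v)))\<rparr>"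

lemma lookup_extend:
  assumes "\<And>i. X i 0 = 0"
  shows "Poly_Mapping.lookup (extend (\<lambda>i v. Poly_Mapping.single (i + d) (X i v)) f) j
    = X (j - d) (Poly_Mapping.lookup f (j - d))"
proof -
  have "Poly_Mapping.lookup (extend (\<lambda>i v. Poly_Mapping.single (i + d) (X i v)) f) j
     = (\<Sum>i\<in>Poly_Mapping.keys f. if i = j - d then X i (Poly_Mapping.lookup f i) else 0)"
    unfolding extend_def lookup_sum by (rule sum.cong) (auto simp: lookup_single when_def)
  also have "\<dots> = X (j - d) (Poly_Mapping.lookup f (j - d))"
    by (auto simp: sum.delta assms in_keys_iff)
  finally show ?thesis .
qed

lemma sum_single_lookup:
  "(\<Sum>i\<in>Poly_Mapping.keys f. Poly_Mapping.single i (Poly_Mapping.lookup f i)) = f"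
  by (rule poly_mapping_eqI) (auto simp: lookup_sum lookup_single when_def in_keys_iff)

text \<open>The last three assumptions are the brackets \<open>[p,q] = z\<close>,
  \<open>[e,q] = p\<close> and \<open>[e,p] = 0\<close>, read off in degree
  \<open>i\<close>.\<close>

locale graded = cspace s C for s :: "complex \<Rightarrow> 'n::ab_group_add \<Rightarrow> 'n" and C +
  fixes hh zz :: complex and P E :: "int \<Rightarrow> 'n \<Rightarrow> 'n"
  assumes P: "endo s C (P i)" and E: "endo s C (E i)"
    and P_step: "v \<in> C \<Longrightarrow> P (i + 1) v = P i v + s zz v"
    and E_step: "v \<in> C \<Longrightarrow> E (i + 1) v = E i v + P i v"
    and PE: "v \<in> C \<Longrightarrow> E (i - 1) (P i v) = P (i - 2) (E i v)"
begin

abbreviation "gs \<equiv> \<lambda>c. Poly_Mapping.map (s c)"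
abbreviation "gC \<equiv> {f. \<forall>i::int. Poly_Mapping.lookup f i \<in> C}"
definition gop :: "age_basis \<Rightarrow> (int \<Rightarrow>\<^sub>0 'n) \<Rightarrow> (int \<Rightarrow>\<^sub>0 'n)" where
  "gop = (\<lambda>b. extend (\<lambda>i v. case b of
          gen_h \<Rightarrow> Poly_Mapping.single i (s (hh - of_int i) v)
        | gen_z \<Rightarrow> Poly_Mapping.single i (s zz v)
        | gen_q \<Rightarrow> Poly_Mapping.single (i + 1) v
        | gen_p \<Rightarrow> Poly_Mapping.single (i - 1) (P i v)
        | gen_e \<Rightarrow> Poly_Mapping.single (i - 2) (E i v)))"

lemma lookup_gs [simp]: "Poly_Mapping.lookup (gs c f) i = s c (Poly_Mapping.lookup f i)"
  by (simp add: map.rep_eq when_def)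

lemma lookup_gop [simp]:
  "Poly_Mapping.lookup (gop gen_h f) i = s (hh - of_int i) (Poly_Mapping.lookup f i)"
  "Poly_Mapping.lookup (gop gen_z f) i = s zz (Poly_Mapping.lookup f i)"
  "Poly_Mapping.lookup (gop gen_q f) i = Poly_Mapping.lookup f (i - 1)"
  "Poly_Mapping.lookup (gop gen_p f) i = P (i + 1) (Poly_Mapping.lookup f (i + 1))"
  "Poly_Mapping.lookup (gop gen_e f) i = E (i + 2) (Poly_Mapping.lookup f (i + 2))"
  using lookup_extend[of "\<lambda>i. s (hh - of_int i)" 0 f i] lookup_extend[of "\<lambda>i. s zz" 0 f i]
    lookup_extend[of "\<lambda>i v. v" 1 f i] lookup_extend[of P "-1" f i] lookup_extend[of E "-2" f i]
  by (simp_all add: gop_def endo_0[OF P] endo_0[OF E])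

sublocale g: age_ops gs gC "gop gen_e" "gop gen_h" "gop gen_p" "gop gen_q" "gop gen_z"
proof -
  interpret gv: vector_space gs
    by standard (auto intro!: poly_mapping_eqI simp: lookup_add scale_right_distrib scale_left_distrib)
  show "age_ops gs gC (gop gen_e) (gop gen_h) (gop gen_p) (gop gen_q) (gop gen_z)"
  proof
    show "gv.subspace gC" by (simp add: gv.subspace_def lookup_add)
    show "endo gs gC (gop gen_e)" "endo gs gC (gop gen_h)" "endo gs gC (gop gen_p)"
      "endo gs gC (gop gen_q)" "endo gs gC (gop gen_z)"
      unfolding endo_def
      by (auto intro!: poly_mapping_eqI simp: lookup_add endo_simps[OF P] endo_simps[OF E]
          scale_right_distrib scale_left_commute)
    fix v assume v: "v \<in> gC"
    have E': "E (i + 2) w = E (i + 1) w + P (i + 1) w" and P': "P (i + 2) w = P (i + 1) w + s zz w"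
      if "w \<in> C" for i w using E_step[OF that, of "i + 1"] P_step[OF that, of "i + 1"] by (simp_all add: algebra_simps)
    show "gop gen_e (gop gen_q v) = gop gen_q (gop gen_e v) + gop gen_p v"
      using v E_step by (auto intro!: poly_mapping_eqI simp: lookup_add E' algebra_simps)
    show "gop gen_p (gop gen_q v) = gop gen_q (gop gen_p v) + gop gen_z v"
      using v P_step by (auto intro!: poly_mapping_eqI simp: lookup_add algebra_simps)
    show "gop gen_p (gop gen_e v) = gop gen_e (gop gen_p v)"
    proof (rule poly_mapping_eqI)
      fix i show "Poly_Mapping.lookup (gop gen_p (gop gen_e v)) i = Poly_Mapping.lookup (gop gen_e (gop gen_p v)) i"
        using v PE[of "Poly_Mapping.lookup v (i + 3)" "i + 3"] by (simp add: algebra_simps)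
    qed
    show "gop gen_h (gop gen_q v) = gop gen_q (gop gen_h v) - gop gen_q v"
      "gop gen_h (gop gen_p v) = gop gen_p (gop gen_h v) + gop gen_p v"
      "gop gen_h (gop gen_e v) = gop gen_e (gop gen_h v) + gs 2 (gop gen_e v)"
      "gop gen_z (gop gen_e v) = gop gen_e (gop gen_z v)"
      "gop gen_z (gop gen_h v) = gop gen_h (gop gen_z v)"
      "gop gen_z (gop gen_p v) = gop gen_p (gop gen_z v)"
      "gop gen_z (gop gen_q v) = gop gen_q (gop gen_z v)"
      using v
      by (auto intro!: poly_mapping_eqI simp: lookup_add lookup_minus endo_simps[OF P] endo_simps[OF E]
          algebra_simps scale_left_distrib scale_left_diff_distrib scale_left_commute)
  qed
qed

lemma age_module_grad: "age_module (grad s C hh zz P E)"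
  unfolding grad_def gop_def[symmetric] by (rule age_moduleI[OF g.age_ops_axioms])

lemma act_grad: "act (grad s C hh zz P E) (axis b 1) f = gop b f"
  unfolding grad_def gop_def[symmetric] by (simp add: age_action_axis[OF g.vector_space_axioms])

lemma single_gC: "v \<in> C \<Longrightarrow> Poly_Mapping.single i v \<in> gC"
  by (simp add: lookup_single when_def)

lemma gop_single:
  "gop gen_h (Poly_Mapping.single i v) = Poly_Mapping.single i (s (hh - of_int i) v)"
  "gop gen_z (Poly_Mapping.single i v) = Poly_Mapping.single i (s zz v)"
  "gop gen_q (Poly_Mapping.single i v) = Poly_Mapping.single (i + 1) v"
  "gop gen_p (Poly_Mapping.single i v) = Poly_Mapping.single (i - 1) (P i v)"
  "gop gen_e (Poly_Mapping.single i v) = Poly_Mapping.single (i - 2) (E i v)"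
  by (simp_all add: gop_def extend_single endo_0[OF P] endo_0[OF E])

text \<open>The eigenvalues of \<open>h\<close> separate the degrees, so a submodule contains the
  components of its elements. Simplicity thus becomes a statement about families of subspaces of
  \<open>C\<close>.\<close>

lemma simple_grad:
  assumes nz: "C \<noteq> {0}"
    and family: "\<And>W. (\<And>i. subspace (W i)) \<Longrightarrow> (\<And>i. W i \<subseteq> C) \<Longrightarrow>
      (\<And>i w. w \<in> W i \<Longrightarrow> w \<in> W (i + 1)) \<Longrightarrow> (\<And>i w. w \<in> W i \<Longrightarrow> P i w \<in> W (i - 1)) \<Longrightarrow>
      (\<And>i w. w \<in> W i \<Longrightarrow> E i w \<in> W (i - 2)) \<Longrightarrow> (\<forall>i. W i = {0}) \<or> (\<forall>i. W i = C)"
  shows "simple UNIV (grad s C hh zz P E)"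
  unfolding simple_def
proof (intro conjI allI impI)
  obtain v where "v \<in> C" "v \<noteq> 0" using nz C_closed(1) by blast
  then have "Poly_Mapping.single 0 v \<in> gC" "Poly_Mapping.single (0::int) v \<noteq> 0"
    using single_gC by (blast, metis lookup_single_eq lookup_zero)
  then show "carrier (grad s C hh zz P E) \<noteq> {0}" by (auto simp: grad_def)
next
  fix U assume "submodule UNIV (grad s C hh zz P E) U"
  then have U: "U \<subseteq> gC" "g.subspace U" and "\<And>b f. f \<in> U \<Longrightarrow> act (grad s C hh zz P E) (axis b 1) f \<in> U"
    by (auto simp: submodule_def grad_def)
  then have U_gop: "f \<in> U \<Longrightarrow> gop b f \<in> U" for b f by (simp only: act_grad)
  have comp: "Poly_Mapping.single i (Poly_Mapping.lookup f i) \<in> U" if f: "f \<in> U" for f i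
  proof (cases "i \<in> Poly_Mapping.keys f")
    case True
    have "\<forall>i\<in>Poly_Mapping.keys f. Poly_Mapping.single i (Poly_Mapping.lookup f i) \<in> U"
    proof (rule g.eigen_components[OF g.endos(2) U(2,1), where \<mu> = "\<lambda>i. hh - of_int i"])
      fix i
      show "Poly_Mapping.single i (Poly_Mapping.lookup f i) \<in> gC" using f U single_gC by blast
      show "gop gen_h (Poly_Mapping.single i (Poly_Mapping.lookup f i)) =
        gs (hh - of_int i) (Poly_Mapping.single i (Poly_Mapping.lookup f i))"
        by (rule poly_mapping_eqI) (simp add: lookup_single when_def)
    qed (auto intro: U_gop simp: inj_on_def sum_single_lookup f)
    then show ?thesis using True by blast
  qed (simp add: in_keys_iff g.subspace_0[OF U(2)])
  define W where "W i = {v\<in>C. Poly_Mapping.single i v \<in> U}" for i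
  have "(\<forall>i. W i = {0}) \<or> (\<forall>i. W i = C)"
  proof (rule family)
    fix i :: int
    have "Poly_Mapping.single i (s c v) = gs c (Poly_Mapping.single i v)" for c v
      by (rule poly_mapping_eqI) (simp add: lookup_single when_def)
    then have "Poly_Mapping.single i (s c v) \<in> U" if "Poly_Mapping.single i v \<in> U" for c v
      using g.subspace_scale[OF U(2) that] by metis
    then show "subspace (W i)"
      using g.subspace_0[OF U(2)] g.subspace_add[OF U(2)]
      by (auto simp: W_def subspace_def single_add)
    fix w assume "w \<in> W i"
    then have w: "w \<in> C" "Poly_Mapping.single i w \<in> U" by (simp_all add: W_def)
    then show "w \<in> W (i + 1)" "P i w \<in> W (i - 1)" "E i w \<in> W (i - 2)"
      using U_gop[OF w(2), of gen_q] U_gop[OF w(2), of gen_p] U_gop[OF w(2), of gen_e]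
      unfolding gop_single by (auto simp: W_def endo_closed[OF P] endo_closed[OF E])
  qed (simp add: W_def)
  then show "U = {0} \<or> U = carrier (grad s C hh zz P E)"
  proof
    assume "\<forall>i. W i = {0}"
    have "f = 0" if f: "f \<in> U" for f
    proof (rule poly_mapping_eqI)
      fix k
      have "Poly_Mapping.lookup f k \<in> W k" using comp[OF f] f U(1) by (auto simp: W_def)
      then show "Poly_Mapping.lookup f k = Poly_Mapping.lookup 0 k" using \<open>\<forall>i. W i = {0}\<close> by simp
    qed
    then show ?thesis using g.subspace_0[OF U(2)] by auto
  next
    assume W: "\<forall>i. W i = C"
    have "f \<in> U" if "f \<in> gC" for f
    proof -
      have "Poly_Mapping.single i (Poly_Mapping.lookup f i) \<in> U" for i
        using W that by (auto simp: W_def set_eq_iff)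
      then have "(\<Sum>i\<in>Poly_Mapping.keys f. Poly_Mapping.single i (Poly_Mapping.lookup f i)) \<in> U"
        by (intro g.subspace_sum[OF U(2)])
      then show ?thesis by (simp add: sum_single_lookup)
    qed
    then show ?thesis using U(1) by (auto simp: grad_def)
  qed
qed

end

section \<open>Simplicity of the modules \<open>Q\<close>, \<open>Q'\<close> and \<open>N\<close>\<close>

lemma vector_space_mult: "vector_space ((*) :: complex \<Rightarrow> complex \<Rightarrow> complex)"
  by standard (simp_all add: algebra_simps)

lemma cspace_mult: "cspace ((*) :: complex \<Rightarrow> complex \<Rightarrow> complex) UNIV"
  by (simp add: cspace_def cspace_axioms_def vector_space_mult vector_space_over_itself.subspace_UNIV)

lemma subspace_complex_cases:
  assumes "module.subspace ((*) :: complex \<Rightarrow> complex \<Rightarrow> complex) W"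
  shows "W = {0} \<or> W = UNIV"
proof -
  have "c \<in> W" if "w \<in> W" "w \<noteq> 0" for c w
    using vector_space_over_itself.subspace_scale[OF assms that(1), of "c / w"] that by simp
  then show ?thesis using vector_space_over_itself.subspace_0[OF assms] by blast
qed

lemma UNIV_complex_neq_0: "(UNIV :: complex set) \<noteq> {0}"
  by (metis UNIV_I one_neq_zero singletonD)

lemma int_family_constant:
  assumes W: "\<And>i::int. W i = A \<or> W i = B"
    and up: "\<And>i. W i = B \<Longrightarrow> W (i + 1) = B" and down: "\<And>i. W i = B \<Longrightarrow> W (i - 1) = B"
  shows "(\<forall>i. W i = A) \<or> (\<forall>i. W i = B)"
proof (rule disjCI, intro allI)
  fix j assume "\<not> (\<forall>i. W i = B)"
  then obtain k where k: "W k \<noteq> B" by blast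
  have "W j \<noteq> B"
  proof
    assume "W j = B"
    then have "W k = B"
      by (induction k rule: int_induct[where k = j]) (simp, simp only: up, simp only: down)
    with k show False ..
  qed
  then show "W j = A" using W by blast
qed

lemma Q_module_grad: "Q_module l hh = grad (*) UNIV hh 0 (\<lambda>i c. 0) (\<lambda>i c. l * c)"
  by (simp add: Q_module_def grad_def)
    (rule arg_cong[where f = "age_action _"], auto simp: fun_eq_iff extend_def intro!: sum.cong split: age_basis.split)

lemma Q'_module_grad:
  "Q'_module zz hh l = grad (*) UNIV hh zz (\<lambda>i c. zz * (l + of_int i) * c)
     (\<lambda>i c. zz / 2 * (l + of_int i) * (l + of_int i - 1) * c)"
  by (simp add: Q'_module_def grad_def)
    (rule arg_cong[where f = "age_action _"], auto simp: fun_eq_iff extend_def intro!: sum.cong split: age_basis.split)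

lemma graded_Q: "graded (*) UNIV 0 (\<lambda>i c. 0) (\<lambda>i c. l * c)"
  by (intro graded.intro cspace_mult graded_axioms.intro) (auto simp: endo_def algebra_simps)

lemma graded_Q': "graded (*) UNIV zz (\<lambda>i c. zz * (l + of_int i) * c)
     (\<lambda>i c. zz / 2 * (l + of_int i) * (l + of_int i - 1) * c)"
  by (intro graded.intro cspace_mult graded_axioms.intro) (auto simp: endo_def field_simps)

lemma simple_Q:
  assumes "l \<noteq> 0"
  shows "simple_age_module (Q_module l hh)"
proof -
  interpret graded "(*)" UNIV hh 0 "\<lambda>i c. 0" "\<lambda>i c. l * c" by (rule graded_Q)
  have "simple UNIV (Q_module l hh)" unfolding Q_module_grad
  proof (rule simple_grad)
    fix W :: "int \<Rightarrow> complex set"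
    assume sub: "\<And>i. module.subspace (*) (W i)" and up: "\<And>i w. w \<in> W i \<Longrightarrow> w \<in> W (i + 1)"
      and E: "\<And>i w. w \<in> W i \<Longrightarrow> l * w \<in> W (i - 2)"
    have full: "W i = UNIV" if "w \<in> W i" "w \<noteq> 0" for i w
      using subspace_complex_cases[OF sub, of i] that by auto
    show "(\<forall>i. W i = {0}) \<or> (\<forall>i. W i = UNIV)"
    proof (rule int_family_constant)
      fix i
      show "W i = {0} \<or> W i = UNIV" by (rule subspace_complex_cases[OF sub])
      show "W (i + 1) = UNIV" if "W i = UNIV" using up[of 1 i] that by (intro full[of 1]) auto
      \<comment> \<open>Here \<open>p\<close> is zero, so degree \<open>i - 1\<close> is reached by
        going down two degrees with \<open>e\<close> and up one with \<open>q\<close>.\<close>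
      show "W (i - 1) = UNIV" if "W i = UNIV"
        using up[of l "i - 2"] E[of 1 i] that assms by (intro full[of l]) auto
    qed
  qed (rule UNIV_complex_neq_0)
  then show ?thesis using age_module_grad by (simp add: simple_age_module_def Q_module_grad)
qed

lemma simple_Q':
  assumes "zz \<noteq> 0" "l \<notin> \<int>"
  shows "simple_age_module (Q'_module zz hh l)"
proof -
  interpret graded "(*)" UNIV hh zz "\<lambda>i c. zz * (l + of_int i) * c"
     "\<lambda>i c. zz / 2 * (l + of_int i) * (l + of_int i - 1) * c" by (rule graded_Q')
  have nz: "l + of_int i \<noteq> 0" for i
  proof
    assume "l + of_int i = 0"
    then have "l = of_int (- i)" by (simp add: eq_neg_iff_add_eq_0)
    then show False using assms(2) Ints_of_int by metis
  qed
  have "simple UNIV (Q'_module zz hh l)" unfolding Q'_module_grad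
  proof (rule simple_grad)
    fix W :: "int \<Rightarrow> complex set"
    assume sub: "\<And>i. module.subspace (*) (W i)" and up: "\<And>i w. w \<in> W i \<Longrightarrow> w \<in> W (i + 1)"
      and P: "\<And>i w. w \<in> W i \<Longrightarrow> zz * (l + of_int i) * w \<in> W (i - 1)"
    have full: "W i = UNIV" if "w \<in> W i" "w \<noteq> 0" for i w
      using subspace_complex_cases[OF sub, of i] that by auto
    show "(\<forall>i. W i = {0}) \<or> (\<forall>i. W i = UNIV)"
    proof (rule int_family_constant)
      fix i
      show "W i = {0} \<or> W i = UNIV" by (rule subspace_complex_cases[OF sub])
      show "W (i + 1) = UNIV" if "W i = UNIV" using up[of 1 i] that by (intro full[of 1]) auto
      show "W (i - 1) = UNIV" if "W i = UNIV"
        using P[of 1 i] that assms nz by (intro full[of "zz * (l + of_int i)"]) auto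
    qed
  qed (rule UNIV_complex_neq_0)
  then show ?thesis using age_module_grad by (simp add: simple_age_module_def Q'_module_grad)
qed

section \<open>The modules \<open>N_module\<close>\<close>

lemma N_module_grad:
  "N_module N zz hh = grad (scale N) (carrier N) hh zz
     (\<lambda>i. act N (if zz = 0 then weyl_t
          else (2 * zz) *\<^sub>W (weyl_t * weyl_d) + (of_int (i - 1) * zz) *\<^sub>W 1))
     (\<lambda>i. act N (if zz = 0 then weyl_t\<^sup>2 * weyl_d + of_int (i - 2) *\<^sub>W weyl_t
          else weyl_t + (of_int (2 * i - 3) * zz) *\<^sub>W (weyl_t * weyl_d)
               + (2 * zz) *\<^sub>W (weyl_t * weyl_d)\<^sup>2
               + (of_int ((i - 1) * (i - 2)) / 2 * zz) *\<^sub>W 1))"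
  by (simp add: N_module_def grad_def)

lemma weyl_td_t: "weyl_t * weyl_d * weyl_t = weyl_t * (weyl_t * weyl_d) + weyl_t"
proof -
  have "weyl_d * weyl_t = weyl_t * weyl_d + 1" using weyl_relation by (simp add: algebra_simps)
  then show ?thesis by (simp add: mult.assoc distrib_left)
qed

text \<open>The module \<open>N_module N zz hh\<close> in terms of the two operators \<open>t\<close> and \<open>D\<close> by which the
  generators of \<open>R_algebra zz\<close> act: \<open>D\<close> stands for \<open>t\<^sup>2 d/dt\<close> if \<open>zz = 0\<close>, and for \<open>t d/dt\<close> otherwise.\<close>
definition N_p :: "(complex \<Rightarrow> 'n \<Rightarrow> 'n) \<Rightarrow> complex \<Rightarrow> ('n \<Rightarrow> 'n) \<Rightarrow> ('n \<Rightarrow> 'n) \<Rightarrow> int \<Rightarrow> 'n \<Rightarrow> 'n::ab_group_add" where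
  "N_p s zz t D i v = (if zz = 0 then t v else s (2 * zz) (D v) + s (of_int (i - 1) * zz) v)"

definition N_e :: "(complex \<Rightarrow> 'n \<Rightarrow> 'n) \<Rightarrow> complex \<Rightarrow> ('n \<Rightarrow> 'n) \<Rightarrow> ('n \<Rightarrow> 'n) \<Rightarrow> int \<Rightarrow> 'n \<Rightarrow> 'n::ab_group_add" where
  "N_e s zz t D i v = (if zz = 0 then D v + s (of_int (i - 2)) (t v)
     else t v + s (of_int (2 * i - 3) * zz) (D v) + s (2 * zz) (D (D v))
       + s (of_int ((i - 1) * (i - 2)) / 2 * zz) v)"

locale R_module =
  fixes N :: "(weyl, 'n::ab_group_add) rep" and zz :: complex
  assumes N: "algebra_module (R_algebra zz) N"
begin

abbreviation "t \<equiv> act N weyl_t"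
abbreviation "D \<equiv> act N (if zz = 0 then weyl_t\<^sup>2 * weyl_d else weyl_t * weyl_d)"

sublocale cspace "scale N" "carrier N"
  using N by (simp add: algebra_module_def linear_action_def cspace_def cspace_axioms_def)

lemma endo_act: "a \<in> R_algebra zz \<Longrightarrow> endo (scale N) (carrier N) (act N a)"
  using N by (simp add: algebra_module_def linear_action_def endo_def)

lemmas endo_t = endo_act[OF R_algebra_gen(1)]
lemmas endo_D = endo_act[OF R_algebra_gen(2)]

lemma R_closed:
  "1 \<in> R_algebra zz" "a \<in> R_algebra zz \<Longrightarrow> b \<in> R_algebra zz \<Longrightarrow> a + b \<in> R_algebra zz"
  "a \<in> R_algebra zz \<Longrightarrow> c *\<^sub>W a \<in> R_algebra zz"
  "a \<in> R_algebra zz \<Longrightarrow> b \<in> R_algebra zz \<Longrightarrow> a * b \<in> R_algebra zz"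
  by (auto simp: R_algebra_def intro: unital_subalgebra.intros)

lemma act_rules:
  assumes "v \<in> carrier N"
  shows "act N 1 v = v"
    "a \<in> R_algebra zz \<Longrightarrow> b \<in> R_algebra zz \<Longrightarrow> act N (a + b) v = act N a v + act N b v"
    "a \<in> R_algebra zz \<Longrightarrow> act N (c *\<^sub>W a) v = scale N c (act N a v)"
    "a \<in> R_algebra zz \<Longrightarrow> b \<in> R_algebra zz \<Longrightarrow> act N (a * b) v = act N a (act N b v)"
  using assms N by (simp_all add: algebra_module_def)

lemma D_t:
  assumes v: "v \<in> carrier N"
  shows "D (t v) = t (D v) + (if zz = 0 then t (t v) else t v)"
proof (cases "zz = 0")
  case True
  have "weyl_t\<^sup>2 * weyl_d * weyl_t = weyl_t * (weyl_t\<^sup>2 * weyl_d) + weyl_t * weyl_t"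
    using weyl_td_t by (simp add: power2_eq_square mult.assoc distrib_left)
  then have "act N (weyl_t\<^sup>2 * weyl_d * weyl_t) v = act N (weyl_t * (weyl_t\<^sup>2 * weyl_d) + weyl_t * weyl_t) v"
    by simp
  then show ?thesis using True R_algebra_gen[of zz] v
    by (simp add: act_rules R_closed[unfolded True])
next
  case False
  have "act N (weyl_t * weyl_d * weyl_t) v = act N (weyl_t * (weyl_t * weyl_d) + weyl_t) v"
    by (simp add: weyl_td_t)
  then show ?thesis using False R_algebra_gen[of zz] v
    by (simp add: act_rules R_closed del: mult.assoc)
qed

lemma act_p:
  assumes "v \<in> carrier N"
  shows "act N (if zz = 0 then weyl_t
      else (2 * zz) *\<^sub>W (weyl_t * weyl_d) + (of_int (i - 1) * zz) *\<^sub>W 1) v = N_p (scale N) zz t D i v"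
proof (cases "zz = 0")
  case False
  then show ?thesis using assms R_algebra_gen[of zz] by (simp add: N_p_def act_rules R_closed)
qed (simp add: N_p_def)

lemma act_e:
  assumes "v \<in> carrier N"
  shows "act N (if zz = 0 then weyl_t\<^sup>2 * weyl_d + of_int (i - 2) *\<^sub>W weyl_t
          else weyl_t + (of_int (2 * i - 3) * zz) *\<^sub>W (weyl_t * weyl_d)
               + (2 * zz) *\<^sub>W (weyl_t * weyl_d)\<^sup>2
               + (of_int ((i - 1) * (i - 2)) / 2 * zz) *\<^sub>W 1) v = N_e (scale N) zz t D i v"
proof (cases "zz = 0")
  case True
  then show ?thesis using assms R_algebra_gen[of zz]
    by (simp add: N_e_def act_rules R_closed[unfolded True])
next
  case False
  have "(weyl_t * weyl_d)\<^sup>2 = (weyl_t * weyl_d) * (weyl_t * weyl_d)" by (simp add: power2_eq_square)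
  then show ?thesis using False assms R_algebra_gen[of zz]
    by (simp add: N_e_def act_rules R_closed)
qed

end

text \<open>Only the relation between the two operators is assumed. This covers the modules over
  \<open>R_algebra\<close> as well as a weight space for which no such module structure has been
  constructed yet.\<close>

locale N_ops = cspace s C for s :: "complex \<Rightarrow> 'n::ab_group_add \<Rightarrow> 'n" and C +
  fixes zz :: complex and t D :: "'n \<Rightarrow> 'n"
  assumes t: "endo s C t" and D: "endo s C D"
    and D_t: "v \<in> C \<Longrightarrow> D (t v) = t (D v) + (if zz = 0 then t (t v) else t v)"
begin

lemma endo_N_p: "endo s C (N_p s zz t D i)"
  by (simp add: endo_def N_p_def endo_simps[OF t] endo_simps[OF D] scale_right_distrib
      scale_left_commute algebra_simps)

lemma endo_N_e: "endo s C (N_e s zz t D i)"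
  by (simp add: endo_def N_e_def endo_simps[OF t] endo_simps[OF D] scale_right_distrib
      scale_left_commute algebra_simps)

text \<open>For \<open>zz \<noteq> 0\<close> these operators are, up to the factor
  \<open>zz\<close>, the action of \<open>p\<close> in the various degrees. They commute with each
  other, and passing \<open>t\<close> only shifts the index.\<close>

definition L :: "int \<Rightarrow> 'n \<Rightarrow> 'n" where
  "L j v = s 2 (D v) + s (of_int j) v"

lemma endo_L: "endo s C (L j)"
  by (simp add: endo_def L_def endo_simps[OF D] scale_right_distrib scale_left_commute algebra_simps)

lemma L_commute: "v \<in> C \<Longrightarrow> L j (L k v) = L k (L j v)"
  by (simp add: L_def endo_simps[OF D] scale_right_distrib scale_left_commute algebra_simps)

lemma L_t: "zz \<noteq> 0 \<Longrightarrow> v \<in> C \<Longrightarrow> L j (t v) = t (L (j + 2) v)"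
  by (simp add: L_def endo_simps[OF D] endo_simps[OF t] D_t scale_right_distrib scale_left_distrib)

lemma N_p_L: "zz \<noteq> 0 \<Longrightarrow> N_p s zz t D i v = s zz (L (i - 1) v)"
  by (simp add: L_def N_p_def scale_right_distrib mult.commute)

text \<open>Completing the square in the formula for \<open>e\<close>: apart from the summand \<open>t\<close>, it is a product of
  two commuting operators, which are the ones in the formula for \<open>p\<close>.\<close>
lemma N_e_L:
  assumes "zz \<noteq> 0" "v \<in> C"
  shows "N_e s zz t D i v = t v + s (zz / 2) (L (i - 1) (L (i - 2) v))"
proof -
  have "complex_of_int (2 * i - 3) * zz = zz / 2 * (2 * of_int (i - 2)) + zz / 2 * (of_int (i - 1) * 2)"
    "2 * zz = zz / 2 * (2 * 2)"
    "complex_of_int ((i - 1) * (i - 2)) / 2 * zz = zz / 2 * (of_int (i - 1) * of_int (i - 2))"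
    by (simp_all add: field_simps)
  then have "N_e s zz t D i v = t v + (s (zz / 2 * (2 * of_int (i - 2))) (D v)
     + s (zz / 2 * (of_int (i - 1) * 2)) (D v)) + s (zz / 2 * (2 * 2)) (D (D v))
     + s (zz / 2 * (of_int (i - 1) * of_int (i - 2))) v"
    using assms(1) unfolding N_e_def by (simp only: scale_left_distrib if_False)
  also have "\<dots> = t v + s (zz / 2) (L (i - 1) (L (i - 2) v))"
    using assms(2) unfolding L_def
    by (simp only: endo_simps[OF D] C_closed scale_right_distrib scale_scale ac_simps)
  finally show ?thesis .
qed

lemma graded_N: "graded s C zz (N_p s zz t D) (N_e s zz t D)"
proof
  show "endo s C (N_p s zz t D i)" "endo s C (N_e s zz t D i)" for i
    by (rule endo_N_p, rule endo_N_e)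
  fix v i assume v: "v \<in> C"
  show "N_p s zz t D (i + 1) v = N_p s zz t D i v + s zz v"
    by (simp add: N_p_def algebra_simps scale_left_distrib scale_left_diff_distrib)
  have "complex_of_int (i + 1 - 2) = complex_of_int (i - 2) + 1"
    "complex_of_int (2 * (i + 1) - 3) * zz = complex_of_int (2 * i - 3) * zz + 2 * zz"
    "complex_of_int ((i + 1 - 1) * (i + 1 - 2)) / 2 * zz
     = complex_of_int ((i - 1) * (i - 2)) / 2 * zz + complex_of_int (i - 1) * zz"
    by (simp_all add: field_simps)
  then show "N_e s zz t D (i + 1) v = N_e s zz t D i v + N_p s zz t D i v"
    unfolding N_p_def N_e_def by (simp only: scale_left_distrib scale_one) (simp add: ac_simps)
  show "N_e s zz t D (i - 1) (N_p s zz t D i v) = N_p s zz t D (i - 2) (N_e s zz t D i v)"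
  proof (cases "zz = 0")
    case True
    then show ?thesis using v scale_left_distrib[of 1 2 "t (t v)"]
      by (simp add: N_p_def N_e_def D_t endo_simps[OF t] endo_simps[OF D] scale_left_diff_distrib algebra_simps)
  next
    case False
    \<comment> \<open>The summands with \<open>t\<close> agree because
      \<open>L (i - 3) (t v) = t (L (i - 1) v)\<close>; the others are the product of
      \<open>L (i - 1)\<close>, \<open>L (i - 2)\<close>, \<open>L (i - 3)\<close> in different
      orders.\<close>
    then show ?thesis using v
      by (simp add: N_p_L N_e_L L_t L_commute endo_simps[OF t] endo_simps[OF endo_L] L_commute[of _ "i - 3"]
          scale_left_commute scale_right_distrib)
  qed
qed

text \<open>Each \<open>W i\<close> is stable under \<open>t\<close> and \<open>D\<close>, hence trivial, and it is the operators \<open>N_p\<close> which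
  prevent the family from jumping.\<close>
lemma family_N:
  assumes irr: "irreducible_under s C {t, D}"
    and nz: "\<And>i. \<exists>v\<in>C. N_p s zz t D i v \<noteq> 0"
    and W: "\<And>i::int. subspace (W i)" "\<And>i. W i \<subseteq> C" "\<And>i w. w \<in> W i \<Longrightarrow> w \<in> W (i + 1)"
    and Wp: "\<And>i w. w \<in> W i \<Longrightarrow> N_p s zz t D i w \<in> W (i - 1)"
    and We: "\<And>i w. w \<in> W i \<Longrightarrow> N_e s zz t D i w \<in> W (i - 2)"
  shows "(\<forall>i. W i = {0}) \<or> (\<forall>i. W i = C)"
proof (rule int_family_constant)
  fix i
  show dich: "W i = {0} \<or> W i = C" for i
  proof (rule irreducibleD[OF irr W(1,2)])
    fix X w assume X: "X \<in> {t, D}" and w: "w \<in> W i"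
    \<comment> \<open>The inclusions of \<open>W i\<close> in \<open>W (i + 1)\<close> undo the
      lowering by \<open>p\<close> and \<open>e\<close>. From the two resulting elements of
      \<open>W i\<close>, the formulas for \<open>N_p\<close> and \<open>N_e\<close> are solved for
      \<open>t w\<close> and \<open>D w\<close>.\<close>
    have p: "N_p s zz t D i w \<in> W i" using W(3)[OF Wp[OF w]] by simp
    have e: "N_e s zz t D i w \<in> W i" using W(3)[OF W(3)[OF We[OF w]]] by (simp add: algebra_simps)
    have "t w \<in> W i \<and> D w \<in> W i"
    proof (cases "zz = 0")
      case True
      have t: "t w \<in> W i" using p True by (simp add: N_p_def)
      have "N_e s zz t D i w - s (of_int (i - 2)) (t w) \<in> W i"
        by (intro subspace_diff subspace_scale W(1) e t)
      then show ?thesis using t True by (simp add: N_e_def)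
    next
      case False
      have D: "D w \<in> W i" if w: "w \<in> W i" for w
      proof -
        have "N_p s zz t D i w \<in> W i" using W(3)[OF Wp[OF w]] by simp
        then have "s (1 / (2 * zz)) (N_p s zz t D i w - s (of_int (i - 1) * zz) w) \<in> W i"
          by (intro subspace_diff subspace_scale W(1) w)
        then show ?thesis using False by (simp add: N_p_def)
      qed
      have "N_e s zz t D i w - s (of_int (2 * i - 3) * zz) (D w) - s (2 * zz) (D (D w))
         - s (of_int ((i - 1) * (i - 2)) / 2 * zz) w \<in> W i"
        by (intro subspace_diff subspace_scale W(1) e w D)
      moreover have "N_e s zz t D i w - s (of_int (2 * i - 3) * zz) (D w) - s (2 * zz) (D (D w))
         - s (of_int ((i - 1) * (i - 2)) / 2 * zz) w = t w"
        using False unfolding N_e_def by simp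
      ultimately show ?thesis using D[OF w] by simp
    qed
    then show "X w \<in> W i" using X by auto
  qed
  show "W (i + 1) = C" if "W i = C" using W(3)[of _ i] that W(2)[of "i + 1"] by auto
  show "W (i - 1) = C" if "W i = C"
    using nz[of i] Wp[of _ i] that dich[of "i - 1"] by auto
qed

lemma t_zero_scalar:
  assumes irr: "irreducible_under s C {t, D}" and t0: "\<And>v. v \<in> C \<Longrightarrow> t v = 0"
  obtains c u where "u \<noteq> 0" "\<And>v. v \<in> C \<Longrightarrow> D v = s c v" "C = range (\<lambda>a. s a u)"
proof -
  have "\<exists>c. \<forall>v\<in>C. D v = s c v"
  proof (rule schur[OF irr])
    show "D (X v) = X (D v)" if "X \<in> {t, D}" "v \<in> C" for X v
      using that t0 by (auto simp: endo_simps[OF D])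
  qed (auto simp: t D)
  then obtain c where c: "\<And>v. v \<in> C \<Longrightarrow> D v = s c v" by blast
  have "\<exists>u. u \<noteq> 0 \<and> C = range (\<lambda>a. s a u)"
  proof (rule irreducible_scalars[OF irr])
    fix X assume "X \<in> {t, D}"
    then show "\<exists>c. \<forall>v\<in>C. X v = s c v" using c t0 by (auto intro: exI[of _ 0])
  qed
  then show ?thesis using that c by blast
qed

text \<open>If \<open>p\<close> vanished in some degree, then either \<open>t = 0\<close> at once,
  or \<open>D\<close> would be a scalar and \<open>D t = t D + t\<close> would again give
  \<open>t = 0\<close>. In both cases \<open>C\<close> would be a line.\<close>

lemma N_p_nonzero:
  assumes irr: "irreducible_under s C {t, D}" and inf: "\<And>v. C \<noteq> range (\<lambda>c. s c v)"
  shows "\<exists>v\<in>C. N_p s zz t D i v \<noteq> 0"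
proof (rule ccontr)
  assume "\<not> ?thesis"
  then have 0: "N_p s zz t D i v = 0" if "v \<in> C" for v using that by blast
  have "t v = 0" if v: "v \<in> C" for v
  proof (cases "zz = 0")
    case True
    then show ?thesis using 0[OF v] by (simp add: N_p_def)
  next
    case False
    have D: "D v = s (- (of_int (i - 1) / 2)) v" if "v \<in> C" for v
    proof -
      have "s (1 / (2 * zz)) (N_p s zz t D i v) = D v + s (of_int (i - 1) / 2) v"
        using False by (simp add: N_p_def scale_right_distrib)
      then show ?thesis unfolding scale_minus_left eq_neg_iff_add_eq_0 using 0[OF that] by simp
    qed
    then show ?thesis
      using D_t[OF v] D[OF v] D[OF endo_closed[OF t v]] False v by (simp add: endo_simps[OF t])
  qed
  then show False using t_zero_scalar[OF irr] inf by metis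
qed

lemma t_zero_or_bij:
  assumes irr: "irreducible_under s C {t, D}"
  shows "(\<forall>v\<in>C. t v = 0) \<or> bij_betw t C C"
proof (rule commuting_zero_or_bij[OF irr _ t])
  \<comment> \<open>The relation reads \<open>D t = t (D + F)\<close>, equivalently
    \<open>t D = (D - F) t\<close>, which provides the twists required.\<close>
  define F where "F = (\<lambda>v. if zz = 0 then t v else v)"
  have F: "endo s C F" using t by (auto simp: F_def endo_def)
  have tF: "t (F v) = F (t v)" for v by (simp add: F_def)
  have "endo s C (\<lambda>v. D v - F v)" "endo s C (\<lambda>v. D v + F v)"
    by (simp_all add: endo_def endo_simps[OF F] endo_simps[OF D] scale_right_distrib
        scale_right_diff_distrib algebra_simps)
  moreover have "t (D v) = D (t v) - F (t v)" "D (t v) = t (D v + F v)" if "v \<in> C" for v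
    using D_t[OF that] that endo_simps[OF F] endo_simps[OF D] endo_simps[OF t] tF
    by (auto simp: F_def)
  ultimately have "\<exists>X' X''. endo s C X' \<and> endo s C X'' \<and>
      (\<forall>v\<in>C. t (D v) = X' (t v)) \<and> (\<forall>v\<in>C. D (t v) = t (X'' v))" by blast
  moreover have "\<exists>X' X''. endo s C X' \<and> endo s C X'' \<and>
      (\<forall>v\<in>C. t (t v) = X' (t v)) \<and> (\<forall>v\<in>C. t (t v) = t (X'' v))" using t by blast
  ultimately show "\<exists>X' X''. endo s C X' \<and> endo s C X'' \<and>
      (\<forall>v\<in>C. t (X v) = X' (t v)) \<and> (\<forall>v\<in>C. X (t v) = t (X'' v))" if "X \<in> {t, D}" for X
    using that by auto
  show "endo s C X" if "X \<in> {t, D}" for X using that t D by auto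
qed

text \<open>For \<open>zz = 0\<close> the operator \<open>D\<close> plays the role of \<open>t\<^sup>2 d/dt\<close>, and \<open>t d/dt\<close> is recovered by
  inverting \<open>t\<close>.\<close>
lemma euler_ex:
  assumes bij: "bij_betw t C C"
  obtains \<Theta> where "euler_pair s C t \<Theta>" "\<And>v. v \<in> C \<Longrightarrow> D v = (if zz = 0 then t (\<Theta> v) else \<Theta> v)"
proof (cases "zz = 0")
  case False
  show ?thesis
    by (rule that[of D]) (unfold_locales, simp_all add: False t D D_t)
next
  case True
  define \<Theta> where "\<Theta> v = the_inv_into C t (D v)" for v
  have t\<Theta>: "t (\<Theta> v) = D v" and \<Theta>C: "\<Theta> v \<in> C" if "v \<in> C" for v
    using f_the_inv_into_f_bij_betw[OF bij, of "D v"] bij_betwE[OF bij_betw_the_inv_into[OF bij]]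
      endo_closed[OF D that] by (simp_all add: \<Theta>_def)
  have inj: "v = w" if "v \<in> C" "w \<in> C" "t v = t w" for v w
    using inj_onD[OF bij_betw_imp_inj_on[OF bij]] that by blast
  have "endo s C \<Theta>" unfolding endo_def
  proof (intro conjI ballI allI)
    show "\<Theta> v \<in> C" if "v \<in> C" for v by (rule \<Theta>C[OF that])
    show "\<Theta> (v + w) = \<Theta> v + \<Theta> w" if "v \<in> C" "w \<in> C" for v w
      by (rule inj) (use that in \<open>simp_all add: \<Theta>C t\<Theta> endo_simps[OF t] endo_simps[OF D]\<close>)
    show "\<Theta> (s c v) = s c (\<Theta> v)" if "v \<in> C" for c v
      by (rule inj) (use that in \<open>simp_all add: \<Theta>C t\<Theta> endo_simps[OF t] endo_simps[OF D]\<close>)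
  qed
  \<comment> \<open>After applying the injective \<open>t\<close>, this is the relation
    \<open>D t = t D + t^2\<close>.\<close>
  moreover have "\<Theta> (t v) = t (\<Theta> v) + t v" if "v \<in> C" for v
    by (rule inj)
      (use that D_t[OF that] True in \<open>simp_all add: \<Theta>C t\<Theta> endo_simps[OF t] endo_simps[OF D]\<close>)
  ultimately show ?thesis
    by (intro that[of \<Theta>]) (unfold_locales, simp_all add: t t\<Theta> True)
qed

end

lemma (in cspace) endo_cong: "(\<And>v. v \<in> C \<Longrightarrow> X v = Y v) \<Longrightarrow> endo s C X = endo s C Y"
  by (simp add: endo_def)

context R_module
begin

sublocale N_ops "scale N" "carrier N" zz t D
  by standard (rule endo_t, rule endo_D, rule D_t)

lemma irreducible_iff_simple: "simple (R_algebra zz) N \<longleftrightarrow> irreducible_under (scale N) (carrier N) {t, D}"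
  unfolding simple_def irreducible_under_def submodule_R_algebra_iff[OF N] by blast

abbreviation "actP \<equiv> \<lambda>i. act N (if zz = 0 then weyl_t
          else (2 * zz) *\<^sub>W (weyl_t * weyl_d) + (of_int (i - 1) * zz) *\<^sub>W 1)"
abbreviation "actE \<equiv> \<lambda>i. act N (if zz = 0 then weyl_t\<^sup>2 * weyl_d + of_int (i - 2) *\<^sub>W weyl_t
          else weyl_t + (of_int (2 * i - 3) * zz) *\<^sub>W (weyl_t * weyl_d)
               + (2 * zz) *\<^sub>W (weyl_t * weyl_d)\<^sup>2
               + (of_int ((i - 1) * (i - 2)) / 2 * zz) *\<^sub>W 1)"

lemma graded_act: "graded (scale N) (carrier N) zz actP actE"
proof -
  interpret G: graded "rep.scale N" "carrier N" 0 zz "N_p (rep.scale N) zz t D" "N_e (rep.scale N) zz t D"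
    by (rule graded_N)
  show ?thesis
  proof
    show "endo (rep.scale N) (carrier N) (actP i)" for i
      by (subst endo_cong[where Y = "N_p (rep.scale N) zz t D i"]) (erule act_p, rule G.P)
    show "endo (rep.scale N) (carrier N) (actE i)" for i
      by (subst endo_cong[where Y = "N_e (rep.scale N) zz t D i"]) (erule act_e, rule G.E)
    fix v i assume v: "v \<in> carrier N"
    show "actP (i + 1) v = actP i v + rep.scale N zz v"
      unfolding act_p[OF v] by (rule G.P_step[OF v])
    show "actE (i + 1) v = actE i v + actP i v"
      unfolding act_p[OF v] act_e[OF v] by (rule G.E_step[OF v])
    show "actE (i - 1) (actP i v) = actP (i - 2) (actE i v)"
      unfolding act_p[OF v] act_e[OF v]
      unfolding act_p[OF endo_closed[OF endo_N_e v]] act_e[OF endo_closed[OF endo_N_p v]]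
      by (rule G.PE[OF v])
  qed
qed

lemma simple_N:
  assumes "simple (R_algebra zz) N" "infinite_dimensional N"
  shows "simple_age_module (N_module N zz hh)"
proof -
  interpret G: graded "rep.scale N" "carrier N" hh zz actP actE by (rule graded_act)
  have irr: "irreducible_under (rep.scale N) (carrier N) {t, D}"
    using assms(1) irreducible_iff_simple by blast
  have "carrier N \<noteq> range (\<lambda>c. rep.scale N c v)" for v
    using assms(2) unfolding infinite_dimensional_def by (metis finite.emptyI finite_insert span_singleton)
  then have nz: "\<exists>v\<in>carrier N. N_p (rep.scale N) zz t D i v \<noteq> 0" for i by (rule N_p_nonzero[OF irr])
  have "simple UNIV (N_module N zz hh)" unfolding N_module_grad
  proof (rule G.simple_grad)
    show "carrier N \<noteq> {0}" using irr by (simp add: irreducible_under_def)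
    fix W :: "int \<Rightarrow> 'n set"
    assume W: "\<And>i. subspace (W i)" "\<And>i. W i \<subseteq> carrier N" "\<And>i w. w \<in> W i \<Longrightarrow> w \<in> W (i + 1)"
      and Wp: "\<And>i w. w \<in> W i \<Longrightarrow> actP i w \<in> W (i - 1)"
      and We: "\<And>i w. w \<in> W i \<Longrightarrow> actE i w \<in> W (i - 2)"
    show "(\<forall>i. W i = {0}) \<or> (\<forall>i. W i = carrier N)"
    proof (rule family_N[where W = W, OF irr nz W])
      fix i w assume w: "w \<in> W i"
      then have "w \<in> carrier N" using W(2) by blast
      from act_p[OF this] act_e[OF this] Wp[OF w] We[OF w]
      show "N_p (rep.scale N) zz t D i w \<in> W (i - 1)" "N_e (rep.scale N) zz t D i w \<in> W (i - 2)"
        by (simp_all only:)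
    qed
  qed
  then show ?thesis using G.age_module_grad by (simp add: simple_age_module_def N_module_grad)
qed

end

section \<open>Recognising graded modules\<close>

text \<open>The natural map goes from the model to \<open>M\<close>, whereas the isomorphism wanted
  goes from \<open>M\<close> to the model.\<close>

lemma age_iso_inverse:
  assumes g: "bij_betw g (carrier G) (carrier M)"
    "\<And>v w. v \<in> carrier G \<Longrightarrow> w \<in> carrier G \<Longrightarrow> g (v + w) = g v + g w"
    "\<And>c v. v \<in> carrier G \<Longrightarrow> g (scale G c v) = scale M c (g v)"
    "\<And>x v. v \<in> carrier G \<Longrightarrow> g (act G x v) = act M x (g v)"
    and cl: "\<And>v w. v \<in> carrier G \<Longrightarrow> w \<in> carrier G \<Longrightarrow> v + w \<in> carrier G"
    "\<And>c v. v \<in> carrier G \<Longrightarrow> scale G c v \<in> carrier G"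
    "\<And>x v. v \<in> carrier G \<Longrightarrow> act G x v \<in> carrier G"
  shows "M \<cong>\<^bsub>age\<^esub> G"
  unfolding age_iso_def
proof (intro exI[of _ "the_inv_into (carrier G) g"] conjI ballI allI)
  let ?f = "the_inv_into (carrier G) g"
  have inj: "inj_on g (carrier G)" using g(1) by (rule bij_betw_imp_inj_on)
  have f: "?f w = v" if "v \<in> carrier G" "g v = w" for v w
    using the_inv_into_f_f[OF inj] that by blast
  have im: "\<exists>v\<in>carrier G. g v = w" if "w \<in> carrier M" for w using that unfolding bij_betw_imp_surj_on[OF g(1), symmetric] by blast
  show "bij_betw ?f (carrier M) (carrier G)" by (rule bij_betw_the_inv_into[OF g(1)])
  show "?f (v + w) = ?f v + ?f w" if "v \<in> carrier M" "w \<in> carrier M" for v w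
    using im[OF that(1)] im[OF that(2)] by (auto intro!: f simp: f g cl)
  show "?f (scale M c v) = scale G c (?f v)" if "v \<in> carrier M" for c v
    using im[OF that] by (auto intro!: f simp: f g cl)
  show "?f (act M x v) = act G x (?f v)" if "v \<in> carrier M" for x v
    using im[OF that] by (auto intro!: f simp: f g cl)
qed

text \<open>Here \<open>\<kappa> i v\<close> is the image of \<open>v\<close> times
  \<open>x^i\<close>. Its additive extension is injective because images of different degrees are
  \<open>h\<close>-eigenvectors for different eigenvalues, and it is surjective by the assumption
  \<open>span\<close>.\<close>

lemma grad_iso:
  fixes \<kappa> :: "int \<Rightarrow> 'n::ab_group_add \<Rightarrow> 'v::ab_group_add"
  assumes M: "age_module M" and G: "graded s C zz P E"
    and \<kappa>: "\<And>i v. v \<in> C \<Longrightarrow> \<kappa> i v \<in> carrier M"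
      "\<And>i v w. v \<in> C \<Longrightarrow> w \<in> C \<Longrightarrow> \<kappa> i (v + w) = \<kappa> i v + \<kappa> i w"
      "\<And>i c v. v \<in> C \<Longrightarrow> \<kappa> i (s c v) = scale M c (\<kappa> i v)"
    and inj: "\<And>i v. v \<in> C \<Longrightarrow> \<kappa> i v = 0 \<Longrightarrow> v = 0"
    and h: "\<And>i v. v \<in> C \<Longrightarrow> act M age_h (\<kappa> i v) = scale M (hh - of_int i) (\<kappa> i v)"
    and z: "\<And>i v. v \<in> C \<Longrightarrow> act M age_z (\<kappa> i v) = scale M zz (\<kappa> i v)"
    and q: "\<And>i v. v \<in> C \<Longrightarrow> act M age_q (\<kappa> i v) = \<kappa> (i + 1) v"
    and p: "\<And>i v. v \<in> C \<Longrightarrow> act M age_p (\<kappa> i v) = \<kappa> (i - 1) (P i v)"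
    and e: "\<And>i v. v \<in> C \<Longrightarrow> act M age_e (\<kappa> i v) = \<kappa> (i - 2) (E i v)"
    and span: "carrier M \<subseteq> module.span (scale M) (\<Union>i. \<kappa> i ` C)"
  shows "M \<cong>\<^bsub>age\<^esub> grad s C hh zz P E"
proof -
  interpret graded s C hh zz P E by (rule G)
  interpret M: age_ops "rep.scale M" "carrier M" "act M age_e" "act M age_h" "act M age_p" "act M age_q" "act M age_z"
    by (rule age_module_ops[OF M])
  let ?G = "grad s C hh zz P E"
  have endM: "endo (rep.scale M) (carrier M) (act M x)" for x
    using M by (simp add: age_module_def linear_action_def endo_def)
  have endG: "endo gs gC (gop b)" for b by (cases b) (auto intro: g.endos)
  have carG: "carrier ?G = gC" and scG: "rep.scale ?G = gs" by (simp_all add: grad_def)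
  define k where "k f = (\<Sum>i\<in>Poly_Mapping.keys f. \<kappa> i (Poly_Mapping.lookup f i))" for f
  have \<kappa>0: "\<kappa> i 0 = 0" for i using \<kappa>(3)[of 0 i 0] by simp
  \<comment> \<open>Supports may shrink under addition and scaling, so the sum defining
    \<open>k\<close> is also needed over larger index sets.\<close>
  have k_sup: "k f = (\<Sum>i\<in>K. \<kappa> i (Poly_Mapping.lookup f i))" if "finite K" "Poly_Mapping.keys f \<subseteq> K" for K f
    unfolding k_def using that by (intro sum.mono_neutral_left) (auto simp: in_keys_iff \<kappa>0)
  have k_closed: "k f \<in> carrier M" if "f \<in> gC" for f
    unfolding k_def using that \<kappa>(1) by (intro M.C_sum) auto
  have k_add: "k (f + f') = k f + k f'" if "f \<in> gC" "f' \<in> gC" for f f'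
  proof -
    let ?K = "Poly_Mapping.keys f \<union> Poly_Mapping.keys f'"
    have "k (f + f') = (\<Sum>i\<in>?K. \<kappa> i (Poly_Mapping.lookup (f + f') i))"
      using Poly_Mapping.keys_add[of f f'] by (intro k_sup) auto
    also have "\<dots> = (\<Sum>i\<in>?K. \<kappa> i (Poly_Mapping.lookup f i)) + (\<Sum>i\<in>?K. \<kappa> i (Poly_Mapping.lookup f' i))"
      using that by (simp add: lookup_add \<kappa>(2) sum.distrib)
    also have "\<dots> = k f + k f'" using k_sup[of ?K f] k_sup[of ?K f'] by simp
    finally show ?thesis .
  qed
  have k_scale: "k (gs c f) = rep.scale M c (k f)" if "f \<in> gC" for c f
  proof -
    have "k (gs c f) = (\<Sum>i\<in>Poly_Mapping.keys f. \<kappa> i (Poly_Mapping.lookup (gs c f) i))"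
      by (intro k_sup) (auto simp: in_keys_iff)
    then show ?thesis using that unfolding k_def by (simp add: \<kappa>(3) M.scale_sum_right)
  qed
  have k_single: "k (Poly_Mapping.single i v) = \<kappa> i v" for i v
    using k_sup[of "{i}" "Poly_Mapping.single i v"] by simp
  have k_sum: "k (sum F K) = (\<Sum>j\<in>K. k (F j))" if "\<And>j. j \<in> K \<Longrightarrow> F j \<in> gC" for F and K :: "int set"
    using that
  proof (induction K rule: infinite_finite_induct)
    case (insert a K)
    have "sum F K \<in> gC" using insert by (intro g.C_sum) auto
    then show ?case using insert k_add[of "F a" "sum F K"] by simp
  qed (simp_all add: k_def)
  have k_single_act: "k (gop b (Poly_Mapping.single i v)) = act M (axis b 1) (\<kappa> i v)" if "v \<in> C" for b i v
    using that by (cases b)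
      (simp_all add: gop_single k_single h z q p e \<kappa>(3))
  have k_gop: "k (gop b f) = act M (axis b 1) (k f)" if f: "f \<in> gC" for b f
  proof -
    let ?F = "\<lambda>i. Poly_Mapping.single i (Poly_Mapping.lookup f i)"
    have F: "?F i \<in> gC" for i using f single_gC by blast
    have "k (gop b f) = k (gop b (\<Sum>i\<in>Poly_Mapping.keys f. ?F i))" by (simp only: sum_single_lookup)
    also have "\<dots> = (\<Sum>i\<in>Poly_Mapping.keys f. k (gop b (?F i)))"
      using F by (simp only: g.endo_sum[OF endG F] k_sum g.endo_closed[OF endG F])
    also have "\<dots> = (\<Sum>i\<in>Poly_Mapping.keys f. act M (axis b 1) (\<kappa> i (Poly_Mapping.lookup f i)))"
      using f by (simp add: k_single_act)
    also have "\<dots> = act M (axis b 1) (k f)"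
      unfolding k_def using f \<kappa>(1) by (subst M.endo_sum[OF endM]) auto
    finally show ?thesis .
  qed
  have k_act: "k (act ?G x f) = act M x (k f)" if f: "f \<in> gC" for x f
  proof -
    have "gop b f \<in> gC" for b using g.endo_closed[OF endG f] .
    then have cl: "gs c (gop b f) \<in> gC" for b c by simp
    have "k (act ?G x f) = k (age_action gs gop x f)"
      by (simp add: grad_def gop_def)
    also have "\<dots> = age_action (rep.scale M) (\<lambda>b. act M (axis b 1)) x (k f)"
      unfolding age_action_expand
      by (simp only: k_add k_scale k_gop g.C_closed(2) cl f \<open>\<And>b. gop b f \<in> gC\<close>)
    finally show ?thesis using age_module_act[OF M k_closed[OF f]] by simp
  qed
  have k_inj: "f = 0" if f: "f \<in> gC" "k f = 0" for f
  proof -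
    have "\<forall>i\<in>Poly_Mapping.keys f. \<kappa> i (Poly_Mapping.lookup f i) \<in> {0}"
    proof (rule M.eigen_components[OF M.endos(2) M.subspace_singleton_0, where \<mu> = "\<lambda>i. hh - of_int i"])
      show "(\<Sum>i\<in>Poly_Mapping.keys f. \<kappa> i (Poly_Mapping.lookup f i)) \<in> {0}" using f by (simp add: k_def)
    qed (use f \<kappa>(1) h in \<open>auto simp: inj_on_def M.endo_0[OF endM]\<close>)
    then have "Poly_Mapping.lookup f i = 0" if "i \<in> Poly_Mapping.keys f" for i
      using that f(1) inj[of "Poly_Mapping.lookup f i" i] by simp
    then have "Poly_Mapping.keys f = {}" by (meson equals0I in_keys_iff)
    then show ?thesis by simp
  qed
  have "inj_on k gC"
  proof (rule inj_onI)
    fix f f' assume ff: "f \<in> gC" "f' \<in> gC" "k f = k f'"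
    have "k (f - f') = k f - k f'"
      using k_add[of "f - f'" f'] ff g.C_closed(3)[OF ff(1,2)] by simp
    then show "f = f'" using k_inj[of "f - f'"] g.C_closed(3)[OF ff(1,2)] ff by simp
  qed
  moreover have "k ` gC = carrier M"
  proof
    show "k ` gC \<subseteq> carrier M" using k_closed by blast
    have "module.subspace (rep.scale M) (k ` gC)"
    proof (rule M.subspaceI)
      show "0 \<in> k ` gC" by (rule image_eqI[of _ _ 0]) (simp_all add: k_def)
      fix x y assume "x \<in> k ` gC" "y \<in> k ` gC"
      then obtain a b where "x = k a" "y = k b" "a \<in> gC" "b \<in> gC" by blast
      then show "x + y \<in> k ` gC"
        using k_add[of a b] g.C_closed(2)[of a b] by (intro image_eqI[of _ _ "a + b"]) simp_all
    next
      fix c x assume "x \<in> k ` gC"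
      then obtain a where "x = k a" "a \<in> gC" by blast
      then show "rep.scale M c x \<in> k ` gC"
        using k_scale[of a c] g.C_closed(4)[of a c] by (intro image_eqI[of _ _ "gs c a"]) simp_all
    qed
    moreover have "(\<Union>i. \<kappa> i ` C) \<subseteq> k ` gC"
    proof (intro UN_least image_subsetI)
      fix i v assume "v \<in> C"
      then have "k (Poly_Mapping.single i v) \<in> k ` gC" by (intro imageI single_gC)
      then show "\<kappa> i v \<in> k ` gC" by (simp only: k_single)
    qed
    ultimately show "carrier M \<subseteq> k ` gC" using order_trans[OF span M.span_minimal] by simp
  qed
  ultimately have bij: "bij_betw k gC (carrier M)" by (simp add: bij_betw_def)
  show ?thesis
  proof (rule age_iso_inverse[of k])
    have "linear_action UNIV ?G" using age_module_grad by (simp add: age_module_def)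
    then show "act ?G x v \<in> carrier ?G" if "v \<in> carrier ?G" for x v using that by (simp add: linear_action_def)
  qed (use bij k_add k_scale k_act g.C_closed in \<open>simp_all add: carG scG\<close>)
qed

section \<open>Weight spaces of a simple weight module\<close>

context cspace
begin

lemma span_family_invariant:
  assumes X: "endo s C X" and S: "\<And>i. S i \<subseteq> C" "\<And>i v. v \<in> S i \<Longrightarrow> X v \<in> span (\<Union>i. S i)"
    and w: "w \<in> span (\<Union>i. S i)"
  shows "X w \<in> span (\<Union>i. S i)"
proof -
  have "w \<in> C \<and> X w \<in> span (\<Union>i. S i)" using w
  proof (induction rule: span_induct_alt)
    case base then show ?case by (simp add: endo_0[OF X] span_zero)
  next
    case (step c x y)
    then have "x \<in> C" "X x \<in> span (\<Union>i. S i)" using S by blast+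
    then show ?case using step by (simp add: endo_simps[OF X] span_add span_scale)
  qed
  then show ?thesis ..
qed

lemma span_family_rep:
  assumes S: "\<And>i. subspace (S i)" and w: "w \<in> span (\<Union>i. S i)"
  shows "\<exists>F m. finite F \<and> (\<forall>i. m i \<in> S i) \<and> (\<forall>i. i \<notin> F \<longrightarrow> m i = 0) \<and> w = sum m F"
  using w
proof (induction rule: span_induct_alt)
  case base
  then show ?case using S by (intro exI[of _ "{}"] exI[of _ "\<lambda>i. 0"]) (simp add: subspace_0)
next
  case (step c x y)
  then obtain F m where m: "finite F" "\<And>i. m i \<in> S i" "\<And>i. i \<notin> F \<Longrightarrow> m i = 0" "y = sum m F" by blast
  obtain j where j: "x \<in> S j" using step by blast
  let ?m = "m(j := s c x + m j)"
  have "sum ?m (insert j F) = s c x + m j + sum m (F - {j})"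
    using m(1) by (simp add: sum.insert_remove)
  also have "m j + sum m (F - {j}) = sum m (insert j F)" using m(1) by (simp add: sum.insert_remove)
  then have "s c x + m j + sum m (F - {j}) = s c x + sum m (insert j F)" by (simp add: add.assoc)
  also have "sum m (insert j F) = y"
    using m by (auto simp: insert_absorb intro!: sum.mono_neutral_right)
  finally show ?case using m S j
    by (intro exI[of _ "insert j F"] exI[of _ ?m]) (auto simp: subspace_add subspace_scale)
qed

end

text \<open>The last two assumptions exclude the weight vectors that would generate \<open>M\<close>
  as a lowest or a highest weight module. The weight \<open>hh\<close> is the one placed in degree
  0.\<close>

locale simple_weight = age_ops s C e h p q z
  for s :: "complex \<Rightarrow> 'v::ab_group_add \<Rightarrow> 'v" and C e h p q z +
  fixes zz hh :: complex
  assumes irr: "irreducible_under s C {e, h, p, q, z}"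
    and z_scalar: "v \<in> C \<Longrightarrow> z v = s zz v"
    and hh_weight: "\<exists>v\<in>C. v \<noteq> 0 \<and> h v = s hh v"
    and not_lowest: "v \<in> C \<Longrightarrow> h v = s \<mu> v \<Longrightarrow> q v = 0 \<Longrightarrow> v = 0"
    and not_highest: "v \<in> C \<Longrightarrow> h v = s \<mu> v \<Longrightarrow> e v = 0 \<Longrightarrow> p v = 0 \<Longrightarrow> v = 0"
begin

definition wt :: "int \<Rightarrow> 'v set" where
  "wt i = {v\<in>C. h v = s (hh - of_int i) v}"

lemma wt_C: "v \<in> wt i \<Longrightarrow> v \<in> C" by (simp add: wt_def)

lemma subspace_wt: "subspace (wt i)"
  by (auto simp: subspace_def wt_def scale_right_distrib scale_left_commute)

sublocale wt: cspace s "wt i" for i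
  by standard (rule subspace_wt)

lemma wt_ops:
  assumes "v \<in> wt i"
  shows "q v \<in> wt (i + 1)" "p v \<in> wt (i - 1)" "e v \<in> wt (i - 2)"
proof -
  have v: "v \<in> C" and hv: "h v = s (hh - of_int i) v" using assms by (simp_all add: wt_def)
  show "q v \<in> wt (i + 1)" "p v \<in> wt (i - 1)" "e v \<in> wt (i - 2)"
    using v by (simp_all add: wt_def hq hp he hv scale_left_diff_distrib scale_left_distrib algebra_simps)
qed

lemma wt_inj: "v \<in> wt i \<Longrightarrow> w \<in> wt i \<Longrightarrow> q v = q w \<Longrightarrow> v = w"
  using not_lowest[of "v - w" "hh - of_int i"]
  by (simp add: wt_def scale_right_diff_distrib)

text \<open>The weights in \<open>hh\<close> plus the integers already give a nonzero submodule, so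
  by simplicity they fill the whole of \<open>C\<close>.\<close>

lemma span_wt: "span (\<Union>i. wt i) = C"
proof -
  have "span (\<Union>i. wt i) \<subseteq> C" using sub wt_C by (intro span_minimal) auto
  then have "span (\<Union>i. wt i) = {0} \<or> span (\<Union>i. wt i) = C"
  proof (rule irreducibleD[OF irr subspace_span])
    fix X w assume X: "X \<in> {e, h, p, q, z}" and w: "w \<in> span (\<Union>i. wt i)"
    show "X w \<in> span (\<Union>i. wt i)"
    proof (rule span_family_invariant[OF _ _ _ w])
      show "endo s C X" using X endos by auto
      show "wt i \<subseteq> C" for i using wt_C by blast
      fix i v assume v: "v \<in> wt i"
      have "h v = s (hh - of_int i) v" "z v = s zz v" using v z_scalar by (simp_all add: wt_def)
      then have "h v \<in> wt i" "z v \<in> wt i" using v by simp_all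
      then have "\<exists>j. X v \<in> wt j" using X wt_ops[OF v] by (elim insertE emptyE) auto
      then show "X v \<in> span (\<Union>i. wt i)" by (intro span_base) simp
    qed
  qed
  moreover obtain v where "v \<in> wt 0" "v \<noteq> 0" using hh_weight by (auto simp: wt_def)
  then have "span (\<Union>i. wt i) \<noteq> {0}" using span_base[of v "\<Union>i. wt i"] by auto
  ultimately show ?thesis by blast
qed

text \<open>Subtracting \<open>v\<close> from the component at \<open>j\<close> of its decomposition
  leaves a vanishing sum of \<open>h\<close>-eigenvectors with distinct eigenvalues, so each of its
  terms is zero.\<close>

lemma wt_in_span_family:
  assumes S: "\<And>i. subspace (S i)" "\<And>i. S i \<subseteq> wt i" and v: "v \<in> wt j" "v \<in> span (\<Union>i. S i)"
  shows "v \<in> S j"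
proof -
  obtain F m where m: "finite F" "\<And>i. m i \<in> S i" "\<And>i. i \<notin> F \<Longrightarrow> m i = 0" "v = sum m F"
    using span_family_rep[OF S(1) v(2)] by blast
  define d where "d i = m i - (if i = j then v else 0)" for i
  have d: "d i \<in> wt i" for i
    using m(2)[of i] S(2)[of i] v(1) by (auto simp: d_def)
  \<comment> \<open>The index \<open>j\<close> is inserted because it need not belong to
    \<open>F\<close>.\<close>
  have "sum d (insert j F) = sum m (insert j F) - (\<Sum>i\<in>insert j F. if i = j then v else 0)"
    unfolding d_def by (rule sum_subtractf)
  also have "sum m (insert j F) = v" using m by (auto simp: insert_absorb intro!: sum.mono_neutral_right)
  also have "(\<Sum>i\<in>insert j F. if i = j then v else 0) = v" using m(1) by (subst sum.delta) auto
  finally have "sum d (insert j F) \<in> {0}" by simp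
  then have "\<forall>i\<in>insert j F. d i \<in> {0}"
    using m(1) d
    by (intro eigen_components[OF endos(2) subspace_singleton_0, where \<mu> = "\<lambda>i. hh - of_int i"])
       (auto simp: inj_on_def wt_def)
  then have "v = m j" by (simp add: d_def)
  then show ?thesis using m(2) by simp
qed

section \<open>Stable subspaces and irreducibility of the weight spaces\<close>

text \<open>The operators \<open>qp\<close> and \<open>q\<^sup>2e\<close> commute with \<open>q\<close> up to multiples of \<open>q\<close> and \<open>q\<^sup>2p\<close>, so that \<open>q\<close> carries
  their invariant subspaces to invariant subspaces.\<close>
definition stable :: "'v set \<Rightarrow> bool" where
  "stable K \<longleftrightarrow> subspace K \<and> K \<subseteq> C \<and> (\<forall>w\<in>K. q (p w) \<in> K \<and> q (q (e w)) \<in> K)"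

lemma stable_wt: "stable (wt i)"
proof -
  have "q (p v) \<in> wt i" "q (q (e v)) \<in> wt i" if "v \<in> wt i" for v
    using wt_ops(1)[OF wt_ops(2)[OF that]] wt_ops(1)[OF wt_ops(1)[OF wt_ops(3)[OF that]]] by simp_all
  then show ?thesis using subspace_wt wt_C by (auto simp: stable_def)
qed

lemma stable_Int: "stable K \<Longrightarrow> stable L \<Longrightarrow> stable (K \<inter> L)"
  by (auto simp: stable_def subspace_inter)

lemma qp_q: "v \<in> C \<Longrightarrow> q (p (q v)) = q (q (p v)) + s zz (q v)"
  by (simp add: pq z_scalar)

lemma qqe_q: "v \<in> C \<Longrightarrow> q (q (e (q v))) = q (q (q (e v))) + q (q (p v))"
  by (simp add: eq)

lemma stable_image:
  assumes K: "stable K"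
  shows "stable (q ` K)"
proof -
  interpret K: cspace s K by unfold_locales (use K in \<open>simp add: stable_def\<close>)
  have KC: "k \<in> C" if "k \<in> K" for k using K that by (auto simp: stable_def)
  have "subspace (q ` K)"
  proof (rule subspaceI)
    show "0 \<in> q ` K" by (rule image_eqI[of _ _ 0]) auto
    fix x y assume "x \<in> q ` K" "y \<in> q ` K"
    then obtain a b where "x = q a" "y = q b" "a \<in> K" "b \<in> K" by blast
    then show "x + y \<in> q ` K" by (intro image_eqI[of _ _ "a + b"]) (auto simp: KC)
  next
    fix c x assume "x \<in> q ` K"
    then obtain a where "x = q a" "a \<in> K" by blast
    then show "s c x \<in> q ` K" by (intro image_eqI[of _ _ "s c a"]) (auto simp: KC)
  qed
  moreover have "q (p (q k)) \<in> q ` K \<and> q (q (e (q k))) \<in> q ` K" if "k \<in> K" for k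
  proof -
    have "q (p k) \<in> K" "q (q (e k)) \<in> K" using K that by (auto simp: stable_def)
    moreover have "q (p (q k)) = q (q (p k) + s zz k)" "q (q (e (q k))) = q (q (q (e k)) + q (p k))"
      using that by (simp_all add: qp_q qqe_q KC)
    ultimately show ?thesis using that by (metis K.C_closed(2,4) imageI)
  qed
  ultimately show ?thesis using KC by (auto simp: stable_def)
qed

lemma stable_vimage:
  assumes K: "stable K"
  shows "stable {v\<in>C. q v \<in> K}"
proof -
  interpret K: cspace s K by unfold_locales (use K in \<open>simp add: stable_def\<close>)
  have "q (q (p v)) \<in> K \<and> q (q (q (e v))) \<in> K" if v: "v \<in> C" "q v \<in> K" for v
  proof -
    have 1: "q (p (q v)) \<in> K" "q (q (e (q v))) \<in> K" using K v by (auto simp: stable_def)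
    have "q (p (q v)) - s zz (q v) \<in> K" using 1 v by simp
    then have 2: "q (q (p v)) \<in> K" using v by (simp add: qp_q)
    then have "q (q (e (q v))) - q (q (p v)) \<in> K" using 1 by simp
    then show ?thesis using 2 v by (simp add: qqe_q)
  qed
  then show ?thesis by (auto simp: stable_def subspace_def)
qed

lemma q_pow_wt: "v \<in> wt i \<Longrightarrow> (q ^^ n) v \<in> wt (i + int n)"
proof (induction n)
  case (Suc n)
  then show ?case using wt_ops(1)[of "(q ^^ n) v" "i + int n"] by (simp add: algebra_simps)
qed simp

lemma stable_image_pow: "stable K \<Longrightarrow> stable ((q ^^ n) ` K)"
proof (induction n)
  case (Suc n)
  then show ?case unfolding funpow.simps image_comp[symmetric] by (intro stable_image)
qed simp

lemma stable_vimage_pow: "stable K \<Longrightarrow> stable {v\<in>C. (q ^^ n) v \<in> K}"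
proof (induction n)
  case 0 then show ?case by (simp add: stable_def Collect_conj_eq subspace_inter sub Int_absorb1)
next
  case (Suc n)
  have "{v\<in>C. (q ^^ Suc n) v \<in> K} = {v\<in>C. q v \<in> {v\<in>C. (q ^^ n) v \<in> K}}"
    by (auto simp: funpow_swap1)
  then show ?case using stable_vimage[OF Suc.IH[OF Suc.prems]] by simp
qed

text \<open>From degree \<open>j\<close> upwards the family consists of images of \<open>K\<close>
  under powers of \<open>q\<close>, below it of preimages. Injectivity of \<open>q\<close> on weight
  spaces gives the last property, by which membership can be pulled back along
  \<open>q\<close>.\<close>

lemma stable_family:
  assumes K: "stable K" "K \<subseteq> wt j"
  obtains S where "\<And>i. stable (S i)" "\<And>i. S i \<subseteq> wt i" "S j = K"
    "\<And>i v. v \<in> S i \<Longrightarrow> q v \<in> S (i + 1)" "\<And>i v. v \<in> wt i \<Longrightarrow> q v \<in> S (i + 1) \<Longrightarrow> v \<in> S i"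
proof
  define S where "S i = wt i \<inter> (if j \<le> i then (q ^^ nat (i - j)) ` K
     else {v\<in>C. (q ^^ nat (j - i)) v \<in> K})" for i
  show "stable (S i)" for i
    unfolding S_def by (intro stable_Int stable_wt) (simp add: stable_image_pow stable_vimage_pow K)
  show "S i \<subseteq> wt i" for i by (simp add: S_def)
  show "S j = K" using K by (auto simp: S_def)
  fix i v
  show "q v \<in> S (i + 1)" if v: "v \<in> S i"
  proof (cases "j \<le> i")
    case True
    then have "nat (i + 1 - j) = Suc (nat (i - j))" by simp
    then show ?thesis using v True wt_ops(1)[of v i] by (auto simp: S_def)
  next
    case False
    then have "nat (j - i) = Suc (nat (j - (i + 1)))" by simp
    then show ?thesis using v False wt_ops(1)[of v i]
      by (auto simp: S_def funpow_swap1 dest: wt_C)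
  qed
  show "v \<in> S i" if v: "v \<in> wt i" "q v \<in> S (i + 1)"
  proof (cases "j \<le> i")
    case True
    then have "nat (i + 1 - j) = Suc (nat (i - j))" by simp
    then obtain k where k: "k \<in> K" "q v = q ((q ^^ nat (i - j)) k)" using v True by (auto simp: S_def)
    have "(q ^^ nat (i - j)) k \<in> wt i" using q_pow_wt[of k j "nat (i - j)"] k K True by auto
    then have "v = (q ^^ nat (i - j)) k" using wt_inj v k by blast
    then show ?thesis using v True k by (auto simp: S_def)
  next
    case False
    then have "nat (j - i) = Suc (nat (j - (i + 1)))" by simp
    then show ?thesis using v False by (auto simp: S_def funpow_swap1 wt_C split: if_splits)
  qed
qed

text \<open>The subspace \<open>K\<close> is spread over all degrees. The span of the family is
  stable under \<open>p\<close> and \<open>e\<close>, because \<open>q (p v)\<close> and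
  \<open>q (q (e v))\<close> stay in \<open>S i\<close> and membership is pulled back along
  \<open>q\<close>. Simplicity of the whole module decides about the span, and its part in degree
  \<open>j\<close> is \<open>K\<close>.\<close>

lemma stable_wt_cases:
  assumes K: "stable K" "K \<subseteq> wt j"
  shows "K = {0} \<or> K = wt j"
proof -
  obtain S where S: "\<And>i. stable (S i)" "\<And>i. S i \<subseteq> wt i" "S j = K"
    "\<And>i v. v \<in> S i \<Longrightarrow> q v \<in> S (i + 1)" "\<And>i v. v \<in> wt i \<Longrightarrow> q v \<in> S (i + 1) \<Longrightarrow> v \<in> S i"
    using stable_family[OF K] by blast
  have subS: "subspace (S i)" and SC: "S i \<subseteq> C" for i using S(1)[of i] by (simp_all add: stable_def)
  have "span (\<Union>i. S i) \<subseteq> C" using sub SC by (intro span_minimal) auto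
  then have "span (\<Union>i. S i) = {0} \<or> span (\<Union>i. S i) = C"
  proof (rule irreducibleD[OF irr subspace_span])
    fix X w assume X: "X \<in> {e, h, p, q, z}" and w: "w \<in> span (\<Union>i. S i)"
    show "X w \<in> span (\<Union>i. S i)"
    proof (rule span_family_invariant[OF _ SC _ w])
      show "endo s C X" using X endos by auto
      fix i v assume v: "v \<in> S i"
      then have vw: "v \<in> wt i" using S(2) by blast
      have "h v \<in> S i" "z v \<in> S i"
        using vw z_scalar[OF wt_C[OF vw]] subspace_scale[OF subS v] by (simp_all add: wt_def)
      moreover have "p v \<in> S (i - 1)"
        using S(5)[OF wt_ops(2)[OF vw]] S(1)[of i] v by (simp add: stable_def)
      moreover have "e v \<in> S (i - 2)"
      proof -
        have "q (e v) \<in> wt (i - 1)" using wt_ops(1)[OF wt_ops(3)[OF vw]] by simp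
        then have "q (e v) \<in> S (i - 1)" using S(5)[of "q (e v)" "i - 1"] S(1)[of i] v by (simp add: stable_def)
        then show ?thesis using S(5)[OF wt_ops(3)[OF vw]] by simp
      qed
      moreover have "q v \<in> S (i + 1)" using S(4)[OF v] .
      ultimately have "\<exists>j. X v \<in> S j" using X by (elim insertE emptyE) auto
      then show "X v \<in> span (\<Union>i. S i)" by (intro span_base) simp
    qed
  qed
  then show ?thesis
  proof
    assume "span (\<Union>i. S i) = {0}"
    then have "K \<subseteq> {0}" using span_base[of _ "\<Union>i. S i"] S(3) by blast
    then show ?thesis using K(1) subspace_0 by (auto simp: stable_def)
  next
    assume span: "span (\<Union>i. S i) = C"
    have "v \<in> K" if "v \<in> wt j" for v
      using wt_in_span_family[OF subS S(2) that] wt_C[OF that] span S(3) by simp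
    then show ?thesis using K(2) by blast
  qed
qed

section \<open>Identification of all weight spaces through \<open>q\<close>\<close>

lemma wt_nontrivial: "\<exists>v\<in>wt i. v \<noteq> 0"
proof (induction i rule: int_induct[where k = 0])
  case base then show ?case using hh_weight by (auto simp: wt_def)
next
  case (step1 i)
  then obtain v where v: "v \<in> wt i" "v \<noteq> 0" by blast
  then have "q v \<noteq> 0" using wt_inj[OF v(1), of 0] by auto
  then show ?case using wt_ops(1)[OF v(1)] by blast
next
  case (step2 i)
  then obtain v where v: "v \<in> wt i" "v \<noteq> 0" by blast
  \<comment> \<open>If \<open>p\<close> kills \<open>v\<close>, then \<open>e\<close> does not, and
    the injective \<open>q\<close> lifts \<open>e v\<close> from degree \<open>i - 2\<close> to
    degree \<open>i - 1\<close>.\<close>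
  show ?case
  proof (cases "p v = 0")
    case True
    then have "e v \<noteq> 0" using not_highest[of v "hh - of_int i"] v by (auto simp: wt_def)
    then have "q (e v) \<noteq> 0" using wt_inj[OF wt_ops(3)[OF v(1)], of 0] by auto
    moreover have "q (e v) \<in> wt (i - 1)" using wt_ops(1)[OF wt_ops(3)[OF v(1)]] by simp
    ultimately show ?thesis by blast
  qed (use v wt_ops(2) in blast)
qed

text \<open>Surjectivity comes from irreducibility: the image of \<open>q\<close> is a nonzero
  stable subspace of the next weight space.\<close>

lemma q_bij: "bij_betw q (wt i) (wt (i + 1))"
proof -
  have "q ` wt i = {0} \<or> q ` wt i = wt (i + 1)"
    using wt_ops(1) by (intro stable_wt_cases stable_image stable_wt) auto
  moreover have "q ` wt i \<noteq> {0}"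
  proof -
    obtain v where v: "v \<in> wt i" "v \<noteq> 0" using wt_nontrivial by blast
    then have "q v \<noteq> 0" using wt_inj[OF v(1), of 0] by auto
    then show ?thesis using v(1) by blast
  qed
  ultimately show ?thesis using wt_inj by (auto simp: bij_betw_def inj_on_def)
qed

lemma q_pow_bij: "bij_betw (q ^^ n) (wt i) (wt (i + int n))"
proof (induction n)
  case (Suc n)
  from bij_betw_trans[OF Suc q_bij] show ?case by (simp only: funpow.simps of_nat_Suc ac_simps)
qed (simp add: bij_betw_def)

text \<open>The power \<open>q^i\<close> on \<open>wt 0\<close>. For negative \<open>i\<close> the
  inverse is taken between the weight spaces \<open>wt i\<close> and \<open>wt 0\<close>. In the
  model, \<open>\<iota> i v\<close> corresponds to \<open>v\<close> times
  \<open>x^i\<close>.\<close>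

definition \<iota> :: "int \<Rightarrow> 'v \<Rightarrow> 'v" where
  "\<iota> i = (if 0 \<le> i then q ^^ nat i else the_inv_into (wt i) (q ^^ nat (- i)))"

lemma \<iota>_bij: "bij_betw (\<iota> i) (wt 0) (wt i)"
proof (cases "0 \<le> i")
  case True
  then show ?thesis using q_pow_bij[of "nat i" 0] by (simp add: \<iota>_def)
next
  case False
  then show ?thesis using bij_betw_the_inv_into[OF q_pow_bij[of "nat (- i)" i]] by (simp add: \<iota>_def)
qed

lemma \<iota>_wt: "v \<in> wt 0 \<Longrightarrow> \<iota> i v \<in> wt i"
  using \<iota>_bij bij_betwE by blast

lemma \<iota>_0 [simp]: "\<iota> 0 v = v"
  by (simp add: \<iota>_def)

lemma q_\<iota>:
  assumes v: "v \<in> wt 0"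
  shows "q (\<iota> i v) = \<iota> (i + 1) v"
proof (cases "0 \<le> i")
  case True
  then have "nat (i + 1) = Suc (nat i)" by simp
  then show ?thesis using True by (simp add: \<iota>_def)
next
  case False
  then have n: "nat (- i) = Suc (nat (- (i + 1)))" by simp
  have b: "bij_betw (q ^^ nat (- k)) (wt k) (wt 0)" if "k \<le> 0" for k
    using q_pow_bij[of "nat (- k)" k] that by simp
  have "(q ^^ nat (- i)) (\<iota> i v) = v"
    using f_the_inv_into_f_bij_betw[OF b[of i]] False v by (simp add: \<iota>_def)
  then have "(q ^^ nat (- (i + 1))) (q (\<iota> i v)) = v" by (simp add: n funpow_swap1)
  moreover have "q (\<iota> i v) \<in> wt (i + 1)" using wt_ops(1)[OF \<iota>_wt[OF v]] .
  moreover have "(q ^^ nat (- (i + 1))) (\<iota> (i + 1) v) = v"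
    using f_the_inv_into_f_bij_betw[OF b[of "i + 1"]] False v
    by (cases "i = -1") (auto simp: \<iota>_def)
  moreover have "inj_on (q ^^ nat (- (i + 1))) (wt (i + 1))"
    using bij_betw_imp_inj_on[OF b[of "i + 1"]] False by simp
  ultimately show ?thesis using \<iota>_wt[OF v, of "i + 1"] by (metis inj_onD)
qed

lemma \<iota>_linear:
  assumes "v \<in> wt 0" "w \<in> wt 0"
  shows "\<iota> i (v + w) = \<iota> i v + \<iota> i w" "\<iota> i (s c v) = s c (\<iota> i v)"
proof -
  have "\<iota> i (v + w) = \<iota> i v + \<iota> i w \<and> \<iota> i (s c v) = s c (\<iota> i v)"
  proof (induction i rule: int_induct[where k = 0])
    case (step1 i)
    have "\<iota> i v \<in> C" "\<iota> i w \<in> C" using \<iota>_wt assms wt_C by blast+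
    then have "q (\<iota> i (v + w)) = q (\<iota> i v) + q (\<iota> i w)" "q (\<iota> i (s c v)) = s c (q (\<iota> i v))"
      using step1 by simp_all
    then show ?case using assms by (simp add: q_\<iota>)
  next
    case (step2 i)
    have "\<iota> (i - 1) v \<in> C" "\<iota> (i - 1) w \<in> C" using \<iota>_wt assms wt_C by blast+
    then have "q (\<iota> (i - 1) (v + w)) = q (\<iota> (i - 1) v + \<iota> (i - 1) w)"
      "q (\<iota> (i - 1) (s c v)) = q (s c (\<iota> (i - 1) v))"
      using step2 assms by (simp_all add: q_\<iota>)
    then show ?case using assms \<iota>_wt[of _ "i - 1"]
      by (auto intro!: wt_inj[of _ "i - 1"])
  qed simp
  then show "\<iota> i (v + w) = \<iota> i v + \<iota> i w" "\<iota> i (s c v) = s c (\<iota> i v)" by simp_all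
qed

text \<open>Since \<open>[p,q] = z\<close> and \<open>[e,q] = p\<close>, the action of \<open>p\<close> and \<open>e\<close> in one degree determines the others.\<close>
lemma pe_\<iota>:
  assumes G: "graded s (wt 0) zz P E"
    and P0: "\<And>v. v \<in> wt 0 \<Longrightarrow> P 0 v = q (p v)" and E0: "\<And>v. v \<in> wt 0 \<Longrightarrow> E 0 v = q (q (e v))"
    and v: "v \<in> wt 0"
  shows "p (\<iota> i v) = \<iota> (i - 1) (P i v) \<and> e (\<iota> i v) = \<iota> (i - 2) (E i v)"
proof -
  interpret graded s "wt 0" 0 zz P E by (rule G)
  have Pv: "P i v \<in> wt 0" and Ev: "E i v \<in> wt 0" for i
    using v P E by (simp_all add: wt.endo_closed)
  have \<iota>v: "\<iota> i v \<in> wt i" "\<iota> i v \<in> C" for i using \<iota>_wt[OF v] wt_C by blast+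
  have add: "\<iota> j (P i v) + s zz (\<iota> j v) = \<iota> j (P (i + 1) v)" "\<iota> j (E i v) + \<iota> j (P i v) = \<iota> j (E (i + 1) v)"
    for i j using v Pv Ev by (simp_all add: P_step E_step \<iota>_linear)
  show ?thesis
  proof (induction i rule: int_induct[where k = 0])
    case base
    have "q (p v) = q (\<iota> (- 1) (P 0 v))" unfolding q_\<iota>[OF Pv] by (simp add: P0[OF v])
    then have 1: "p v = \<iota> (- 1) (P 0 v)" using wt_ops(2)[OF v] \<iota>_wt[OF Pv] by (auto intro: wt_inj)
    have "q (q (e v)) = q (q (\<iota> (- 2) (E 0 v)))" unfolding q_\<iota>[OF Ev] by (simp add: E0[OF v])
    then have "q (e v) = q (\<iota> (- 2) (E 0 v))"
      using wt_ops(1)[OF wt_ops(3)[OF v]] wt_ops(1)[OF \<iota>_wt[OF Ev], of "-2"] by (auto intro: wt_inj)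
    then have "e v = \<iota> (- 2) (E 0 v)" using wt_ops(3)[OF v] \<iota>_wt[OF Ev] by (auto intro: wt_inj)
    with 1 show ?case by simp
  next
    case (step1 i)
    have "p (\<iota> (i + 1) v) = \<iota> i (P i v) + s zz (\<iota> i v)"
      using step1 pq[OF \<iota>v(2)[of i]] Pv v \<iota>v by (simp add: q_\<iota> z_scalar)
    moreover have "e (\<iota> (i + 1) v) = \<iota> (i - 1) (E i v) + \<iota> (i - 1) (P i v)"
      using step1 eq[OF \<iota>v(2)[of i]] Pv Ev v by (simp add: q_\<iota>)
    ultimately show ?case by (simp add: add)
  next
    case (step2 i)
    \<comment> \<open>Going down, the brackets determine \<open>p\<close> and \<open>e\<close> only
      after applying \<open>q\<close>, which is then cancelled by injectivity.\<close>
    have "q (p (\<iota> (i - 1) v)) = \<iota> (i - 1) (P i v) - s zz (\<iota> (i - 1) v)"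
      using step2 pq[OF \<iota>v(2)[of "i - 1"]] v \<iota>v by (simp add: q_\<iota> z_scalar)
    also have "\<dots> = q (\<iota> (i - 2) (P (i - 1) v))"
      using add(1)[of "i - 1" "i - 1"] Pv by (simp add: q_\<iota> algebra_simps)
    finally have 1: "p (\<iota> (i - 1) v) = \<iota> (i - 2) (P (i - 1) v)"
      using wt_ops(2)[OF \<iota>v(1)[of "i - 1"]] \<iota>_wt[OF Pv] by (auto intro: wt_inj)
    have "q (e (\<iota> (i - 1) v)) = \<iota> (i - 2) (E i v) - \<iota> (i - 2) (P (i - 1) v)"
      using step2 eq[OF \<iota>v(2)[of "i - 1"]] v 1 by (simp add: q_\<iota>)
    also have "\<dots> = q (\<iota> (i - 3) (E (i - 1) v))"
      using add(2)[of "i - 2" "i - 1"] Ev by (simp add: q_\<iota> algebra_simps)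
    finally have "e (\<iota> (i - 1) v) = \<iota> (i - 3) (E (i - 1) v)"
      using wt_ops(3)[OF \<iota>v(1)[of "i - 1"]] \<iota>_wt[OF Ev] by (auto intro: wt_inj)
    with 1 show ?case by simp
  qed
qed

end

section \<open>The module structure on a weight space\<close>

text \<open>If \<open>v\<close> is an eigenvector of \<open>D\<close>, then the \<open>T\<^sup>n v\<close> are eigenvectors for different eigenvalues;
  if there is none, then the \<open>D\<^sup>n v\<close> are linearly independent.\<close>
lemma (in euler_pair) span_finite_neq:
  assumes inj: "\<And>v. v \<in> C \<Longrightarrow> T v = 0 \<Longrightarrow> v = 0" and nz: "C \<noteq> {0}"
    and B: "finite B"
  shows "span B \<noteq> C"
proof
  assume span: "span B = C"
  have "\<exists>f :: nat \<Rightarrow> 'v. range f \<subseteq> C \<and> (\<forall>F a x. finite F \<longrightarrow> (\<Sum>y\<in>F. s (a y) (f y)) = 0 \<longrightarrow> x \<in> F \<longrightarrow> a x = 0)"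
  proof (cases "\<exists>c v. v \<in> C \<and> v \<noteq> 0 \<and> D v = s c v")
    case True
    then obtain c v where v: "v \<in> C" "v \<noteq> 0" "D v = s c v" by blast
    have f: "(T ^^ n) v \<in> C \<and> (T ^^ n) v \<noteq> 0 \<and> D ((T ^^ n) v) = s (c + of_nat n) ((T ^^ n) v)" for n
    proof (induction n)
      case (Suc n)
      then show ?case
        using inj[of "(T ^^ n) v"] by (auto simp: comm endo_simps[OF T] scale_left_distrib)
    qed (use v in simp)
    have "a x = 0" if F: "finite F" "(\<Sum>y\<in>F. s (a y) ((T ^^ y) v)) = 0" "x \<in> F" for F a x
    proof -
      have "\<forall>y\<in>F. s (a y) ((T ^^ y) v) \<in> {0}"
      proof (rule eigen_components[OF D subspace_singleton_0, where \<mu> = "\<lambda>n. c + of_nat n"])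
        show "D (s (a y) ((T ^^ y) v)) = s (c + of_nat y) (s (a y) ((T ^^ y) v))" for y
          using f[of y] by (simp add: endo_simps[OF D] scale_left_commute)
      qed (use F f in \<open>auto simp: inj_on_def endo_0[OF D]\<close>)
      then show ?thesis using F f[of x] by auto
    qed
    then show ?thesis using f by (intro exI[of _ "\<lambda>n. (T ^^ n) v"]) blast
  next
    case False
    obtain v where v: "v \<in> C" "v \<noteq> 0" using nz C_closed(1) by blast
    have f: "(D ^^ n) v \<in> C" for n by (induction n) (auto simp: v endo_closed[OF D])
    have mon: "op_poly s D (monom a n) v = s a ((D ^^ n) v)" for a n
      by (induction n) (simp_all add: monom_0 monom_Suc op_poly_pCons[OF D] endo_simps[OF D] f)
    have sum: "op_poly s D (\<Sum>n\<in>F. monom (a n) n) v = (\<Sum>n\<in>F. s (a n) ((D ^^ n) v))" if "finite F" for F a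
      using that by induction (simp_all add: op_poly_add[OF D v(1)] mon)
    have "a x = 0" if F: "finite F" "(\<Sum>y\<in>F. s (a y) ((D ^^ y) v)) = 0" "x \<in> F" for F a x
    proof -
      have "op_poly s D (\<Sum>n\<in>F. monom (a n) n) v = 0" using F by (simp add: sum)
      then have "(\<Sum>n\<in>F. monom (a n) n) = 0" using op_poly_nonzero[OF D v] False by blast
      then have "coeff (\<Sum>n\<in>F. monom (a n) n) x = 0" by simp
      then show ?thesis using F by (simp add: coeff_sum sum.delta)
    qed
    then show ?thesis using f by (intro exI[of _ "\<lambda>n. (D ^^ n) v"]) blast
  qed
  then obtain f :: "nat \<Rightarrow> 'v" where f: "range f \<subseteq> C"
    "\<And>F a x. finite F \<Longrightarrow> (\<Sum>y\<in>F. s (a y) (f y)) = 0 \<Longrightarrow> x \<in> F \<Longrightarrow> a x = 0" by blast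
  \<comment> \<open>The index set \<open>{..card B}\<close> has \<open>card B + 1\<close> elements,
    one too many for independent vectors in the span of \<open>B\<close>.\<close>
  have "card {..card B} \<le> card B"
  proof (rule family_bound[OF _ B])
    show "f ` {..card B} \<subseteq> span B" using f(1) span by auto
  qed (use f(2) in auto)
  then show False by simp
qed

text \<open>A nonzero \<open>t\<close> is bijective, so in both cases there is an operator for
  \<open>t d/dt\<close> on \<open>C\<close>. Normal forms then make \<open>C\<close> an
  \<open>R1\<close>-module, restricted here to the subalgebra, and injectivity of \<open>t\<close>
  excludes finite dimension.\<close>

lemma (in N_ops) R_module_ex:
  assumes irr: "irreducible_under s C {t, D}" and nz: "\<exists>v\<in>C. t v \<noteq> 0"
  obtains N where "infdim_simple_module (R_algebra zz) N" "scale N = s" "carrier N = C"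
    "\<And>v. v \<in> C \<Longrightarrow> act N weyl_t v = t v"
    "\<And>v. v \<in> C \<Longrightarrow> act N (if zz = 0 then weyl_t\<^sup>2 * weyl_d else weyl_t * weyl_d) v = D v"
proof -
  have bij: "bij_betw t C C" using t_zero_or_bij[OF irr] nz by blast
  obtain \<Theta> where "euler_pair s C t \<Theta>" and D\<Theta>: "\<And>v. v \<in> C \<Longrightarrow> D v = (if zz = 0 then t (\<Theta> v) else \<Theta> v)"
    using euler_ex[OF bij] by blast
  then interpret E: euler_pair s C t \<Theta> by simp
  define N where "N = \<lparr>scale = s, carrier = C, act = E.act1\<rparr>"
  have R: "algebra_module (R_algebra zz) N"
    unfolding N_def by (rule E.R1_module[OF R_algebra_subset])
  then interpret R: R_module N zz by unfold_locales
  have actt: "act N weyl_t v = t v" if "v \<in> C" for v using that by (simp add: N_def E.act1_gen)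
  have actD: "R.D v = D v" if "v \<in> C" for v
  proof (cases "zz = 0")
    case True
    have "weyl_t\<^sup>2 * weyl_d = weyl_t * (weyl_t * weyl_d)" by (simp add: power2_eq_square mult.assoc)
    then show ?thesis
      using E.act1_gen_mult(1)[OF unital_subalgebra.gen, of "weyl_t * weyl_d" v] that True D\<Theta>[OF that]
      by (simp add: N_def E.act1_gen)
  next
    case False
    then show ?thesis using that D\<Theta>[OF that] by (simp add: N_def E.act1_gen)
  qed
  have "irreducible_under s C {R.t, R.D}"
    using irr actt actD unfolding irreducible_under_def by (auto 0 3 simp: subset_iff)
  then have "simple (R_algebra zz) N" using R.irreducible_iff_simple by (simp add: N_def)
  moreover have "infinite_dimensional N"
  proof -
    have "C \<noteq> {0}" using irr by (simp add: irreducible_under_def)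
    moreover have "v = 0" if "v \<in> C" "t v = 0" for v
      using inj_onD[OF bij_betw_imp_inj_on[OF bij], of v 0] that by (simp add: endo_0[OF t])
    ultimately show ?thesis
      unfolding infinite_dimensional_def using E.span_finite_neq by (auto simp: N_def)
  qed
  ultimately have "infdim_simple_module (R_algebra zz) N" using R by (simp add: infdim_simple_module_def)
  moreover have "scale N = s" "carrier N = C" by (simp_all add: N_def)
  ultimately show ?thesis using that actt actD by blast
qed

context simple_weight
begin

text \<open>For \<open>zz \<noteq> 0\<close>, \<open>p^2 / (2 zz)\<close> has the same commutators
  with \<open>p\<close> and \<open>q\<close> as \<open>e\<close>, so that the difference commutes
  with both.\<close>

definition t :: "'v \<Rightarrow> 'v" where
  "t v = (if zz = 0 then q (p v) else q (q (e v - s (1 / (2 * zz)) (p (p v)))))"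

text \<open>Obtained by solving for \<open>D\<close> in degree 0: from \<open>N_e = q^2 e\<close> if
  \<open>zz = 0\<close>, and from \<open>N_p = q p\<close> otherwise.\<close>

definition D :: "'v \<Rightarrow> 'v" where
  "D v = (if zz = 0 then q (q (e v)) + s 2 (q (p v)) else s (1 / (2 * zz)) (q (p v) + s zz v))"

lemma endo_t_D: "endo s C t" "endo s C D"
  unfolding endo_def t_def D_def
  by (auto simp: scale_right_distrib scale_right_diff_distrib scale_left_commute algebra_simps)

lemma half_sum: "s (1 / 2) v + s (1 / 2) v = v"
  by (simp add: scale_left_distrib[symmetric])

lemma D_t:
  assumes v: "v \<in> C"
  shows "D (t v) = t (D v) + (if zz = 0 then t (t v) else t v)"
proof (cases "zz = 0")
  case True
  show ?thesis
    unfolding t_def D_def if_P[OF True] using v True by (simp add: eq pq pe z_scalar)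
next
  case False
  define c where "c v = e v - s (1 / (2 * zz)) (p (p v))" for v
  have cC: "c w \<in> C" if "w \<in> C" for w using that by (simp add: c_def)
  have cq: "c (q w) = q (c w)" if w: "w \<in> C" for w
  proof -
    have "c (q w) = q (c w) + (p w - (s (1 / 2) (p w) + s (1 / 2) (p w)))"
      using w False by (simp add: c_def eq pq z_scalar scale_right_distrib algebra_simps)
    then show ?thesis by (simp add: half_sum)
  qed
  have cp: "p (c w) = c (p w)" if "w \<in> C" for w using that by (simp add: c_def pe)
  have t: "t w = q (q (c w))" for w using False by (simp add: t_def c_def)
  have c_lin: "c (s a w) = s a (c w)" "c (w + w') = c w + c w'" if "w \<in> C" "w' \<in> C" for a w w'
    using that by (simp_all add: c_def scale_right_distrib scale_right_diff_distrib scale_left_commute algebra_simps)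
  \<comment> \<open>Moving \<open>p\<close> through the two factors \<open>q\<close> of
    \<open>t = q^2 c\<close> produces \<open>2 zz t\<close>.\<close>
  have "q (p (t v)) = t (q (p v)) + (s zz (t v) + s zz (t v))"
    using v by (simp add: t cq cp cC pq z_scalar)
  then have "D (t v) = s (1 / (2 * zz)) (t (q (p v)) + s zz (t v)) + (s (1 / 2) (t v) + s (1 / 2) (t v))"
    using False by (simp add: D_def scale_right_distrib)
  also have "s (1 / (2 * zz)) (t (q (p v)) + s zz (t v)) = t (D v)"
    using v False by (simp add: D_def t c_lin cC)
  finally show ?thesis using False by (simp add: half_sum)
qed

lemma t_wt: "v \<in> wt i \<Longrightarrow> t v \<in> wt i" and D_wt: "v \<in> wt i \<Longrightarrow> D v \<in> wt i"
proof -
  assume v: "v \<in> wt i"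
  have "p (p v) \<in> wt (i - 2)" using wt_ops(2)[OF wt_ops(2)[OF v]] by simp
  then have "e v - s (1 / (2 * zz)) (p (p v)) \<in> wt (i - 2)" using wt_ops(3)[OF v] by simp
  from wt_ops(1)[OF wt_ops(1)[OF this]] show "t v \<in> wt i"
    using wt_ops(1)[OF wt_ops(2)[OF v]] by (simp add: t_def)
  show "D v \<in> wt i"
    using wt_ops(1)[OF wt_ops(2)[OF v]] wt_ops(1)[OF wt_ops(1)[OF wt_ops(3)[OF v]]] v
    by (simp add: D_def)
qed

sublocale N: N_ops s "wt 0" zz t D
proof
  show "endo s (wt 0) t" "endo s (wt 0) D"
    using endo_t_D by (auto simp: endo_def t_wt D_wt wt_C)
qed (use D_t wt_C in blast)

lemma N_p_0: "v \<in> wt 0 \<Longrightarrow> N_p s zz t D 0 v = q (p v)"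
  unfolding N_p_def t_def D_def by (auto simp: scale_right_distrib)

lemma N_e_0:
  assumes v: "v \<in> wt 0"
  shows "N_e s zz t D 0 v = q (q (e v))"
proof (cases "zz = 0")
  case True
  show ?thesis unfolding N_e_def t_def D_def if_P[OF True] by simp
next
  case False
  have L: "N.L (- 1) w = s (1 / zz) (q (p w))" "N.L (- 2) w = s (1 / zz) (q (p w)) - w" for w
    using False scale_left_distrib[of 1 1 w]
    by (simp_all add: N.L_def D_def scale_right_distrib scale_minus_left)
  have "N_e s zz t D 0 v = t v + s (zz / 2) (s (1 / zz) (q (p (s (1 / zz) (q (p v)) - v))))"
    using N.N_e_L[OF False v, of 0] by (simp add: L)
  \<comment> \<open>By \<open>q p q p = q^2 p^2 + zz q p\<close> the product becomes
    \<open>q^2 p^2 / (2 zz)\<close>, which cancels the correction term in \<open>t\<close>.\<close>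
  also have "\<dots> = q (q (e v))"
    using wt_C[OF v] False
    by (simp add: t_def pq z_scalar scale_right_distrib scale_right_diff_distrib)
  finally show ?thesis .
qed

lemma pe_\<iota>_N:
  assumes "v \<in> wt 0"
  shows "p (\<iota> i v) = \<iota> (i - 1) (N_p s zz t D i v) \<and> e (\<iota> i v) = \<iota> (i - 2) (N_e s zz t D i v)"
  by (rule pe_\<iota>[OF N.graded_N _ _ assms]) (simp_all add: N_p_0 N_e_0)

lemma not_highest_N:
  assumes v: "v \<in> wt 0" "v \<noteq> 0"
  shows "N_p s zz t D i v \<noteq> 0 \<or> N_e s zz t D i v \<noteq> 0"
proof (rule ccontr)
  assume "\<not> ?thesis"
  moreover have \<iota>0: "\<iota> j 0 = 0" for j using \<iota>_linear(2)[of 0 0 j 0] by simp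
  ultimately have "p (\<iota> i v) = 0" "e (\<iota> i v) = 0" using pe_\<iota>_N[OF v(1), of i] by simp_all
  then have "\<iota> i v = 0" using not_highest \<iota>_wt[OF v(1), of i] by (auto simp: wt_def)
  then show False using bij_betw_imp_inj_on[OF \<iota>_bij[of i]] v \<iota>0[of i] by (metis inj_onD wt.C_closed(1))
qed

text \<open>In degree 0, \<open>N_p\<close> and \<open>N_e\<close> are \<open>q p\<close> and
  \<open>q^2 e\<close>, and both are polynomials in \<open>t\<close> and \<open>D\<close>. A
  subspace invariant under \<open>t\<close> and \<open>D\<close> is therefore stable.\<close>

lemma irreducible_N: "irreducible_under s (wt 0) {t, D}"
  unfolding irreducible_under_def
proof (intro conjI allI impI)
  show "wt 0 \<noteq> {0}" using wt_nontrivial[of 0] by auto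
  fix W assume "subspace W \<and> W \<subseteq> wt 0 \<and> (\<forall>X\<in>{t, D}. \<forall>w\<in>W. X w \<in> W)"
  then have W: "subspace W" "W \<subseteq> wt 0" "\<And>w. w \<in> W \<Longrightarrow> t w \<in> W" "\<And>w. w \<in> W \<Longrightarrow> D w \<in> W" by auto
  interpret W: cspace s W by unfold_locales (rule W(1))
  have "N_p s zz t D 0 w \<in> W" "N_e s zz t D 0 w \<in> W" if "w \<in> W" for w
    using that W(3,4) unfolding N_p_def N_e_def by (cases "zz = 0"; simp only: simp_thms if_True if_False W.C_closed)+
  moreover have "w \<in> wt 0" if "w \<in> W" for w using W(2) that by blast
  ultimately have "q (p w) \<in> W \<and> q (q (e w)) \<in> W" if "w \<in> W" for w
    using that by (simp flip: N_p_0 N_e_0)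
  then have "stable W" using W(1,2) wt_C unfolding stable_def by blast
  then show "W = {0} \<or> W = wt 0" using W(2) by (rule stable_wt_cases)
qed

end

section \<open>The classification\<close>

lemma simple_weight_classification:
  fixes M :: "(age, 'v::ab_group_add) rep"
  assumes M: "age_module M"
    and W: "simple_weight (scale M) (carrier M) (act M age_e) (act M age_h) (act M age_p) (act M age_q)
      (act M age_z) zz hh"
  shows "(\<exists>l hh. l \<noteq> 0 \<and> M \<cong>\<^bsub>age\<^esub> Q_module l hh) \<or>
    (\<exists>zz hh l. zz \<noteq> 0 \<and> l \<notin> \<int> \<and> M \<cong>\<^bsub>age\<^esub> Q'_module zz hh l) \<or>
    (\<exists>zz hh (N :: (weyl, 'v) rep).
       infdim_simple_module (R_algebra zz) N \<and> M \<cong>\<^bsub>age\<^esub> N_module N zz hh)"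
proof -
  interpret simple_weight "rep.scale M" "carrier M" "act M age_e" "act M age_h" "act M age_p" "act M age_q"
      "act M age_z" zz hh by (rule W)
  let ?s = "rep.scale M"
  have \<iota>C: "\<iota> i v \<in> carrier M" if "v \<in> wt 0" for i v using \<iota>_wt[OF that] wt_C by blast
  have \<iota>_inj: "v = 0" if "v \<in> wt 0" "\<iota> i v = 0" for i v
    using bij_betw_imp_inj_on[OF \<iota>_bij[of i]] that \<iota>_linear(2)[of 0 0 i 0]
    by (metis inj_onD wt.C_closed(1) scale_zero_left)
  have \<iota>h: "act M age_h (\<iota> i v) = ?s (hh - of_int i) (\<iota> i v)" if "v \<in> wt 0" for i v
    using \<iota>_wt[OF that] by (simp add: wt_def)
  have \<iota>_span: "carrier M \<subseteq> span (\<Union>i. \<iota> i ` wt 0)"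
    using span_wt \<iota>_bij by (simp add: bij_betw_def)
  show ?thesis
  proof (cases "\<exists>v\<in>wt 0. t v \<noteq> 0")
    case True
    obtain N where N: "infdim_simple_module (R_algebra zz) N" "rep.scale N = ?s" "carrier N = wt 0"
      "\<And>v. v \<in> wt 0 \<Longrightarrow> act N weyl_t v = t v"
      "\<And>v. v \<in> wt 0 \<Longrightarrow> act N (if zz = 0 then weyl_t\<^sup>2 * weyl_d else weyl_t * weyl_d) v = D v"
      using N.R_module_ex[OF irreducible_N True] by blast
    interpret R: R_module N zz using N(1) by unfold_locales (simp add: infdim_simple_module_def)
    have P: "R.actP i v = N_p ?s zz t D i v" and E: "R.actE i v = N_e ?s zz t D i v" if v: "v \<in> wt 0" for i v
    proof -
      have "v \<in> carrier N" using v N(3) by simp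
      then show "R.actP i v = N_p ?s zz t D i v" "R.actE i v = N_e ?s zz t D i v"
        unfolding R.act_p[OF \<open>v \<in> carrier N\<close>] R.act_e[OF \<open>v \<in> carrier N\<close>] N_p_def N_e_def
        by (simp_all only: N v D_wt)
    qed
    have "M \<cong>\<^bsub>age\<^esub> grad (rep.scale N) (carrier N) hh zz R.actP R.actE"
    proof (rule grad_iso[OF M R.graded_act, where \<kappa> = \<iota>], unfold N(2,3))
      fix i v assume v: "v \<in> wt 0"
      show "act M age_p (\<iota> i v) = \<iota> (i - 1) (R.actP i v)" "act M age_e (\<iota> i v) = \<iota> (i - 2) (R.actE i v)"
        unfolding P[OF v] E[OF v] using pe_\<iota>_N[OF v] by simp_all
    qed (use \<iota>C \<iota>_linear \<iota>_inj \<iota>h q_\<iota> z_scalar \<iota>_span in simp_all)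
    then show ?thesis using N(1) unfolding N_module_grad[symmetric] by blast
  next
    case False
    then obtain c u where u: "u \<noteq> 0" "\<And>v. v \<in> wt 0 \<Longrightarrow> D v = ?s c v" "wt 0 = range (\<lambda>a. ?s a u)"
      using N.t_zero_scalar[OF irreducible_N] by metis
    have su: "?s a u \<in> wt 0" for a using u(3) by blast
    have u0: "u \<in> wt 0" using su[of 1] by simp
    \<comment> \<open>The space \<open>wt 0\<close> is the line through \<open>u\<close>, so
      \<open>a\<close> times \<open>x^i\<close> corresponds to \<open>\<iota> i\<close> of
      \<open>a u\<close>.\<close>
    define \<kappa> where "\<kappa> i a = \<iota> i (?s a u)" for i a
    have \<kappa>_mult: "\<kappa> i (a * b) = ?s a (\<kappa> i b)" for i a b
      by (simp only: \<kappa>_def scale_scale[symmetric] \<iota>_linear(2)[OF su su])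
    have \<kappa>: "\<kappa> i a \<in> carrier M" "\<kappa> i (a + b) = \<kappa> i a + \<kappa> i b"
      "act M age_h (\<kappa> i a) = ?s (hh - of_int i) (\<kappa> i a)" "act M age_z (\<kappa> i a) = ?s zz (\<kappa> i a)"
      "act M age_q (\<kappa> i a) = \<kappa> (i + 1) a" for i a b
      using \<iota>C su \<iota>_linear(1)[OF su su] \<iota>h z_scalar q_\<iota>
      by (simp_all add: \<kappa>_def scale_left_distrib)
    have \<kappa>_inj: "a = 0" if "\<kappa> i a = 0" for i a using \<iota>_inj[OF su] that u(1) by (fastforce simp: \<kappa>_def)
    have \<kappa>_span: "carrier M \<subseteq> span (\<Union>i. \<kappa> i ` UNIV)"
    proof -
      have "\<kappa> i ` UNIV = \<iota> i ` wt 0" for i unfolding u(3) \<kappa>_def by (simp add: image_image)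
      then show ?thesis using \<iota>_span by simp
    qed
    have t0: "t v = 0" if "v \<in> wt 0" for v using False that by blast
    have L: "N.L j (?s a u) = ?s ((2 * c + of_int j) * a) u" for j a
      using su by (simp add: N.L_def u(2) distrib_right scale_left_distrib)
    show ?thesis
    proof (cases "zz = 0")
      case True
      have Np: "N_p ?s zz t D i (?s a u) = 0" and Ne: "N_e ?s zz t D i (?s a u) = ?s (c * a) u" for i a
        unfolding N_p_def N_e_def if_P[OF True] using su by (simp_all add: t0 u(2))
      \<comment> \<open>Otherwise \<open>p\<close> and \<open>e\<close> would both vanish in degree
        0.\<close>
      have "c \<noteq> 0" using not_highest_N[OF u0 u(1), of 0] Np[of 0 1] Ne[of 0 1] by auto
      moreover have "M \<cong>\<^bsub>age\<^esub> Q_module c hh"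
        unfolding Q_module_grad
      proof (rule grad_iso[OF M graded_Q, where \<kappa> = \<kappa>])
        show "act M age_p (\<kappa> i a) = \<kappa> (i - 1) 0" "act M age_e (\<kappa> i a) = \<kappa> (i - 2) (c * a)" for i a
          using pe_\<iota>_N[OF su] by (simp_all add: \<kappa>_def Np Ne)
        show "act M age_z (\<kappa> i a) = ?s 0 (\<kappa> i a)" for i a using \<kappa>(4) True by simp
      qed (use \<kappa> \<kappa>_mult \<kappa>_inj \<kappa>_span in simp_all)
      ultimately show ?thesis by blast
    next
      case zz: False
      \<comment> \<open>Chosen so that the action of \<open>p\<close> in degree \<open>i\<close>,
        which is \<open>zz * L (i - 1)\<close> and hence \<open>zz (2 c + i - 1)\<close>, becomes
        \<open>zz (l + i)\<close>.\<close>
      define l where "l = 2 * c - 1"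
      have Np: "N_p ?s zz t D i (?s a u) = ?s (zz * (l + of_int i) * a) u" for i a
        using zz by (simp add: N.N_p_L L l_def algebra_simps)
      have Ne: "N_e ?s zz t D i (?s a u) = ?s (zz / 2 * (l + of_int i) * (l + of_int i - 1) * a) u" for i a
      proof -
        have "l + of_int i = 2 * c + of_int (i - 1)" "l + of_int i - 1 = 2 * c + of_int (i - 2)"
          by (simp_all add: l_def)
        then show ?thesis by (simp only: N.N_e_L[OF zz su] t0[OF su] L scale_scale add_0 mult.assoc)
      qed
      \<comment> \<open>If \<open>l\<close> were an integer \<open>k\<close>, the factor
        \<open>l + i\<close> would make \<open>p\<close> and \<open>e\<close> both vanish in degree
        \<open>- k\<close>, giving a highest weight vector.\<close>
      have "l \<notin> \<int>"
      proof
        assume "l \<in> \<int>"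
        then obtain k where "l = of_int k" by (elim Ints_cases)
        then show False using not_highest_N[OF u0 u(1), of "- k"] Np[of "- k" 1] Ne[of "- k" 1] by simp
      qed
      moreover have "M \<cong>\<^bsub>age\<^esub> Q'_module zz hh l"
        unfolding Q'_module_grad
      proof (rule grad_iso[OF M graded_Q', where \<kappa> = \<kappa>])
        show "act M age_p (\<kappa> i a) = \<kappa> (i - 1) (zz * (l + of_int i) * a)"
          "act M age_e (\<kappa> i a) = \<kappa> (i - 2) (zz / 2 * (l + of_int i) * (l + of_int i - 1) * a)" for i a
          using pe_\<iota>_N[OF su] by (simp_all add: \<kappa>_def Np Ne)
      qed (use \<kappa> \<kappa>_mult \<kappa>_inj \<kappa>_span in simp_all)
      ultimately show ?thesis using zz by blast
    qed
  qed
qed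

lemma submodule_age_iff:
  assumes M: "age_module M"
  shows "submodule UNIV M W \<longleftrightarrow> W \<subseteq> carrier M \<and> module.subspace (scale M) W \<and>
    (\<forall>X\<in>{act M age_e, act M age_h, act M age_p, act M age_q, act M age_z}. \<forall>w\<in>W. X w \<in> W)"
    (is "_ \<longleftrightarrow> ?R")
proof
  assume R: ?R
  then have W: "act M (axis b 1) w \<in> W" if "w \<in> W" for b w using that by (cases b) auto
  interpret vector_space "rep.scale M" using M by (simp add: age_module_def linear_action_def)
  have "act M x w \<in> W" if "w \<in> W" for x w
  proof -
    have "w \<in> carrier M" using R that by blast
    then show ?thesis using R W[OF that]
      unfolding age_module_act[OF M \<open>w \<in> carrier M\<close>, of x] age_action_def
      by (intro subspace_sum subspace_scale) auto
  qed
  then show "submodule UNIV M W" using R by (auto simp: submodule_def)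
qed (auto simp: submodule_def)

lemma simple_generated:
  assumes "simple UNIV M" "age_module M" "w \<in> carrier M" "w \<noteq> 0"
  shows "generated_by M w"
proof -
  have "submodule UNIV M (carrier M)"
    using assms(2) by (auto simp: age_module_def linear_action_def submodule_def)
  moreover have "W = carrier M" if "submodule UNIV M W" "w \<in> W" for W
    using assms that unfolding simple_def by blast
  ultimately have "{W. submodule UNIV M W \<and> w \<in> W} = {carrier M}" using assms(3) by blast
  then show ?thesis by (simp add: generated_by_def)
qed

lemma weight_module_classification:
  fixes M :: "(age, 'v::ab_group_add) rep"
  assumes "simple_age_module M" "weight_module M"
    and nh: "\<not> highest_weight_module M" and nl: "\<not> lowest_weight_module M"
  shows "(\<exists>l hh. l \<noteq> 0 \<and> M \<cong>\<^bsub>age\<^esub> Q_module l hh) \<or>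
    (\<exists>zz hh l. zz \<noteq> 0 \<and> l \<notin> \<int> \<and> M \<cong>\<^bsub>age\<^esub> Q'_module zz hh l) \<or>
    (\<exists>zz hh (N :: (weyl, 'v) rep).
       infdim_simple_module (R_algebra zz) N \<and> M \<cong>\<^bsub>age\<^esub> N_module N zz hh)"
proof -
  have M: "age_module M" and sM: "simple UNIV M" using assms(1) by (simp_all add: simple_age_module_def)
  interpret age_ops "rep.scale M" "carrier M" "act M age_e" "act M age_h" "act M age_p" "act M age_q" "act M age_z"
    by (rule age_module_ops[OF M])
  let ?A = "{act M age_e, act M age_h, act M age_p, act M age_q, act M age_z}"
  have irr: "irreducible_under (rep.scale M) (carrier M) ?A"
    using sM unfolding simple_def irreducible_under_def submodule_age_iff[OF M] by blast
  have "\<exists>c. \<forall>v\<in>carrier M. act M age_z v = rep.scale M c v"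
  proof (rule schur[OF irr])
    show "act M age_z (X v) = X (act M age_z v)" if "X \<in> ?A" "v \<in> carrier M" for X v
      using that zc by auto
    show "endo (rep.scale M) (carrier M) X" if "X \<in> ?A" for X using that endos by auto
  qed (use endos in auto)
  then obtain zz where zz: "\<And>v. v \<in> carrier M \<Longrightarrow> act M age_z v = rep.scale M zz v" by blast
  obtain B where B: "span B = carrier M" "\<And>b. b \<in> B \<Longrightarrow> weight_vector M b"
    using assms(2) unfolding weight_module_def by blast
  have "B \<noteq> {}" using B(1) irr by (auto simp: irreducible_under_def)
  then obtain b where "weight_vector M b" using B(2) by blast
  then obtain hh where hh: "b \<in> carrier M" "b \<noteq> 0" "act M age_h b = rep.scale M hh b"
    by (auto simp: weight_vector_def)
  show ?thesis
  proof (rule simple_weight_classification[OF M], unfold_locales)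
    show "irreducible_under (rep.scale M) (carrier M) ?A" by (rule irr)
    show "act M age_z v = rep.scale M zz v" if "v \<in> carrier M" for v by (rule zz[OF that])
    show "\<exists>v\<in>carrier M. v \<noteq> 0 \<and> act M age_h v = rep.scale M hh v" using hh by blast
    fix v \<mu> assume v: "v \<in> carrier M" "act M age_h v = rep.scale M \<mu> v"
    show "v = 0" if "act M age_q v = 0"
      using nl that v simple_generated[OF sM M] M unfolding lowest_weight_module_def weight_vector_def by blast
    show "v = 0" if "act M age_e v = 0" "act M age_p v = 0"
      using nh that v simple_generated[OF sM M] M unfolding highest_weight_module_def weight_vector_def by blast
  qed
qed

theorem theorem11:
  fixes M :: "(age, 'v::ab_group_add) rep"
  shows
    "(simple_age_module M \<and> weight_module M \<longrightarrow>
        highest_weight_module M \<or> lowest_weight_module M \<or>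
        (\<exists>l hh. l \<noteq> 0 \<and> M \<cong>\<^bsub>age\<^esub> Q_module l hh) \<or>
        (\<exists>zz hh l. zz \<noteq> 0 \<and> l \<notin> \<int> \<and> M \<cong>\<^bsub>age\<^esub> Q'_module zz hh l) \<or>
        (\<exists>zz hh (N :: (weyl, 'v) rep).
            infdim_simple_module (R_algebra zz) N \<and> M \<cong>\<^bsub>age\<^esub> N_module N zz hh)) \<and>
     (\<forall>l hh. l \<noteq> 0 \<longrightarrow> simple_age_module (Q_module l hh)) \<and>
     (\<forall>zz hh l. zz \<noteq> 0 \<longrightarrow> l \<notin> \<int> \<longrightarrow> simple_age_module (Q'_module zz hh l)) \<and>
     (\<forall>zz hh (N :: (weyl, 'n::ab_group_add) rep).
        infdim_simple_module (R_algebra zz) N \<longrightarrow> simple_age_module (N_module N zz hh))"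
proof (intro conjI allI impI)
  show "highest_weight_module M \<or> lowest_weight_module M \<or>
        (\<exists>l hh. l \<noteq> 0 \<and> M \<cong>\<^bsub>age\<^esub> Q_module l hh) \<or>
        (\<exists>zz hh l. zz \<noteq> 0 \<and> l \<notin> \<int> \<and> M \<cong>\<^bsub>age\<^esub> Q'_module zz hh l) \<or>
        (\<exists>zz hh (N :: (weyl, 'v) rep).
            infdim_simple_module (R_algebra zz) N \<and> M \<cong>\<^bsub>age\<^esub> N_module N zz hh)"
    if "simple_age_module M \<and> weight_module M"
    using weight_module_classification[of M] that by argo
  show "simple_age_module (N_module N zz hh)" if "infdim_simple_module (R_algebra zz) N"
    for zz hh and N :: "(weyl, 'n) rep"
    using that R_module.simple_N[of N zz] by (simp add: infdim_simple_module_def R_module_def)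
qed (simp_all add: simple_Q simple_Q')

end
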